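(* Let $\alpha(n)$ be defined by $$\sum_{n=0}^\infty \alpha(n)q^n=\prod_{n=1}^\infty\frac{(1-q^{2n})^3}{(1-q^n)^2},$$ with the convention that $\alpha(x)=0$ whenever $x$ is not a nonnegative integer. Let $\ell>3$ be prime and $N_\ell=\frac{1}{6}(\ell^2-1)$. Then for every nonnegative integer $n$, $$\ell\,\alpha(\ell^2 n+N_\ell)+\left(\frac{-1}{\ell}\right)\left(\frac{N_\ell-n}{\ell}\right)\alpha(n)+\alpha\!\left(\frac{n-N_\ell}{\ell^2}\right)\equiv c_\ell\,\alpha(n)\pmod{2^{12}},$$ where $c_\ell=\ell\,\alpha(N_\ell)+\left(\frac{6}{\ell}\right)$.
   Context: $\left(\frac{\cdot}{\ell}\right)$ denotes the Legendre symbol (equal to $0$ when $\ell$ divides the top entry). The numbers $\alpha(n)$ satisfy $\overline{\mathcal{EO}}(2m)=\alpha(m)$, where $\overline{\mathcal{EO}}(n)$ is Andrews's function counting partitions of $n$ in which every even part is less than each odd part and only the largest even part occurs an odd number of times. *)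

theory Defs
  imports "HOL-Analysis.Analysis" "HOL-Number_Theory.Number_Theory"
begin

(* The factor (1 - q^{2m})^3 / (1 - q^m)^2 with m = n + 1.  The type int has no field
   inverse, so the quotient is taken via the right inverse in the power series ring; the 1 is the
   inverse of the constant coefficient. *)
definition alpha_factor :: "nat \<Rightarrow> int fps" where
  "alpha_factor n =
     (1 - fps_X ^ (2 * Suc n)) ^ 3 * fps_right_inverse ((1 - fps_X ^ Suc n) ^ 2) 1"

(* The infinite product is taken in the library's (X-adic) topology on formal power series. *)
definition alpha_gf :: "int fps" where
  "alpha_gf = (\<Prod>n. alpha_factor n)"

definition alpha :: "rat \<Rightarrow> int" where
  "alpha x = (if x \<in> \<nat> then fps_nth alpha_gf (nat \<lfloor>x\<rfloor>) else 0)"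

(* The division is exact for every prime l > 3; see six_N_ell below. *)
definition N_ell :: "nat \<Rightarrow> int" where
  "N_ell l = (int l ^ 2 - 1) div 6"

definition c_ell :: "nat \<Rightarrow> int" where
  "c_ell l = int l * alpha (of_int (N_ell l)) + Legendre 6 (int l)"

lemma alpha_factor_times:
  "alpha_factor n * (1 - fps_X ^ Suc n) ^ 2 = (1 - fps_X ^ (2 * Suc n)) ^ 3"
proof -
  have "fps_right_inverse ((1 - fps_X ^ Suc n) ^ 2) 1 * (1 - fps_X ^ Suc n :: int fps) ^ 2 = 1"
    by (subst mult.commute, rule fps_right_inverse) (simp add: fps_nth_power_0)
  then show ?thesis
    unfolding alpha_factor_def by (simp only: mult.assoc mult_1_right)
qed

lemma alpha_factor_nth:
  assumes "0 < k" "k \<le> n"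
  shows "fps_nth (alpha_factor n) k = 0"
proof -
  define x where "x = (fps_X ^ Suc n :: int fps)"
  define g where "g = fps_right_inverse ((1 - x) ^ 2) 1"
  have 1: "(1 - x) ^ 2 * g = 1"
    unfolding g_def by (rule fps_right_inverse) (simp add: fps_nth_power_0 x_def)
  have "alpha_factor n = (1 - x ^ 2) ^ 3 * g"
    unfolding alpha_factor_def g_def x_def by (simp only: power_mult mult.commute [of 2])
  also have "(1 - x ^ 2) ^ 3 = (1 - x) ^ 2 + x * (2 - 4 * x + 3 * x ^ 3 - x ^ 5)"
    by (simp add: eval_nat_numeral algebra_simps)
  also have "\<dots> * g = 1 + x * ((2 - 4 * x + 3 * x ^ 3 - x ^ 5) * g)"
    using 1 by (simp only: distrib_right mult.assoc)
  finally have "alpha_factor n = 1 + fps_X ^ Suc n * ((2 - 4 * x + 3 * x ^ 3 - x ^ 5) * g)"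
    by (simp only: x_def)
  then show ?thesis
    using assms by (simp add: fps_X_power_mult_nth del: power_Suc)
qed

lemma alpha_factor_nth_0: "fps_nth (alpha_factor n) 0 = 1"
  by (simp add: alpha_factor_def fps_nth_power_0)

lemma alpha_factor_nonzero: "alpha_factor n \<noteq> 0"
  using alpha_factor_nth_0 [of n] by auto

lemma alpha_partial_nth:
  assumes "k \<le> n"
  shows "fps_nth (\<Prod>i\<le>n. alpha_factor i) k = fps_nth (\<Prod>i\<le>k. alpha_factor i) k"
  using assms
proof (induction n rule: dec_induct)
  case (step n)
  have "fps_nth (\<Prod>i\<le>Suc n. alpha_factor i) k =
      (\<Sum>j=0..k. fps_nth (\<Prod>i\<le>n. alpha_factor i) j * fps_nth (alpha_factor (Suc n)) (k - j))"
    by (simp add: fps_mult_nth)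
  also have "\<dots> = (\<Sum>j=0..k. if j = k then fps_nth (\<Prod>i\<le>n. alpha_factor i) j else 0)"
    using step.hyps by (intro sum.cong) (auto simp: alpha_factor_nth alpha_factor_nth_0)
  finally show ?case using step.IH by simp
qed simp

lemma alpha_gf_has_prod: "alpha_factor has_prod alpha_gf"
proof -
  define L where "L = Abs_fps (\<lambda>k. fps_nth (\<Prod>i\<le>k. alpha_factor i) k)"
  have lim: "(\<lambda>n. \<Prod>i\<le>n. alpha_factor i) \<longlonglongrightarrow> L"
  proof (rule tendsto_fpsI)
    fix k
    show "\<forall>\<^sub>F n in sequentially. fps_nth (\<Prod>i\<le>n. alpha_factor i) k = fps_nth L k"
      unfolding L_def fps_nth_Abs_fps
      using eventually_ge_at_top [of k] by eventually_elim (rule alpha_partial_nth)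
  qed
  have "fps_nth L 0 = 1"
    by (simp add: L_def alpha_factor_nth_0)
  then have "L \<noteq> 0" by auto
  with lim have "alpha_factor has_prod L"
    by (simp add: has_prod_def raw_has_prod_def)
  moreover have "p = L" if "alpha_factor has_prod p" for p
    using that lim
    by (auto simp: has_prod_def raw_has_prod_def alpha_factor_nonzero intro: LIMSEQ_unique)
  ultimately show ?thesis
    unfolding alpha_gf_def prodinf_def by (rule theI)
qed

lemma alpha_of_nat: "alpha (of_nat n) = fps_nth alpha_gf n"
  by (simp add: alpha_def)

lemma six_N_ell:
  assumes "prime l" "l > 3"
  shows "6 * N_ell l = int l ^ 2 - 1"
proof -
  have "\<not> 2 dvd l" "\<not> 3 dvd l"
    using assms primes_dvd_imp_eq [of 2 l] primes_dvd_imp_eq [of 3 l] by auto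
  then have "int l mod 6 = 1 \<or> int l mod 6 = 5" by presburger
  then have "(int l ^ 2) mod 6 = 1 mod 6"
    using power_mod [of "int l" 6 2] by auto
  then have "6 dvd int l ^ 2 - 1"
    by (simp only: mod_eq_dvd_iff)
  then show ?thesis by (simp add: N_ell_def)
qed

end

theory Submission
  imports Defs "HOL-Complex_Analysis.Complex_Analysis" "HOL-Probability.Probability"
begin

text \<open>
  Let \<open>F = eta(2z)^3 / eta(z)^2\<close>, whose coefficients are the \<open>\<alpha>(n)\<close>, and \<open>G = eta(z)^3 / eta(2z)^2\<close>; the
  Fricke involution \<open>z \<mapsto> -1/(2z)\<close> exchanges them up to a factor of weight 1/2.  Poisson
  summation for the theta series of \<open>eta\<close> twisted by \<open>e(b n^2 / c)\<close> and the evaluation of quadratic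
  Gauss sums for \<open>c = l, l^2\<close> show that the Hecke operator \<open>T(l^2)\<close> respects this exchange, so the
  involution turns \<open>F|T / F\<close> into \<open>G|T / G\<close>.  The latter is a Laurent series in \<open>q\<close> with integral
  coefficients and a pole at \<open>q = 0\<close>.  With \<open>t = (eta(2z) / eta(z))^24\<close>, some integral polynomial
  \<open>P(1/t)\<close> agrees with it up to terms vanishing at \<open>q = 0\<close>.  The involution sends \<open>1/t\<close> to
  \<open>2^12 t\<close>, hence it exchanges \<open>F|T / F - P(2^12 t)\<close> and \<open>G|T / G - P(1/t)\<close>, both holomorphic in the
  disc \<open>|q| < 1\<close>.  By the maximum principle they are constant, hence zero.  Thus
  \<open>F|T / F = P(2^12 t)\<close> is congruent to a constant modulo \<open>2^12\<close>.
\<close>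

section \<open>Euler products and power series on the unit disc\<close>

text \<open>The weight is 1/2, so every transformation carries a square root and a multiplier. Both
  stay tame on the imaginary axis with real y > 0: the root is \<open>sqrt y\<close>, the multiplier
  is a Gauss sum, and the identity theorem is applied only to the final quotients, where both have
  cancelled. The exponents of q are multiples of 1/24; hence the translations by multiples of 24,
  and the coefficients indexed by 24 n + 4 for F and by 24 n - 1 for G. Write l^2 = 24 M + 1, so
  that N_l = 4 M. Replacing z by l^2 z in G = q^(-1/24) (1 + ...) gives the leading exponent -l^2/24
  = -1/24 - M, so the pole of G|T / G has order at most M, while F begins with q^(1/6) and F|T / F
  has no pole. Invariance under z -> z + 1 and the Fricke involution suffices for the maximum
  principle, since these two moves bring every point of the upper half-plane to a fixed height, that
  is, into a compact disc in q. The constant 2^12 is (sqrt 2)^24, with sqrt 2 the ratio of the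
  factors sqrt (2 y) and sqrt y of the two etas.\<close>

definition parity_sign :: "int \<Rightarrow> 'a::comm_ring_1" where
  "parity_sign k = (if even k then 1 else -1)"

text \<open>Generalized pentagonal numbers, signed so that 24 * pent k + 1 = (6 * k + 1)^2; this
  square turns the Euler product into a theta series in \<open>eta_series\<close>.\<close>

definition pent :: "int \<Rightarrow> nat" where
  "pent k = nat (k * (3 * k + 1) div 2)"

lemma two_pent: "2 * int (pent k) = k * (3 * k + 1)"
proof -
  have "even (k * (3 * k + 1))" by simp
  moreover have "k * (3 * k + 1) \<ge> 0"
    by (cases "k \<ge> 0") (auto simp: zero_le_mult_iff)
  ultimately show ?thesis by (auto simp: pent_def)
qed

lemma inj_pent: "inj pent"
proof (rule injI)
  fix x y assume "pent x = pent y"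
  then have "x * (3 * x + 1) = y * (3 * y + 1)" by (metis two_pent)
  then have "(x - y) * (3 * (x + y) + 1) = 0" by (simp add: algebra_simps)
  moreover have "3 * (x + y) + 1 \<noteq> 0" by presburger
  ultimately show "x = y" by simp
qed

lemma abs_le_pent: "\<bar>k\<bar> \<le> int (pent k)"
proof -
  have "2 * \<bar>k\<bar> \<le> k * (3 * k + 1)"
  proof (cases "k \<ge> 0")
    case True
    then show ?thesis by (cases "k = 0") (auto simp: algebra_simps mult_le_cancel_left)
  next
    case False
    then have "(-k) * (-3 * k - 1) \<ge> (-k) * 2" by (intro mult_left_mono) auto
    then show ?thesis using False by (simp add: algebra_simps)
  qed
  then show ?thesis using two_pent[of k] by linarith
qed

lemma pent_pos: "pent (int (Suc n)) = Suc n * Suc n + (Suc (Suc n) choose 2)"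
proof -
  have "2 * (Suc (Suc n) choose 2) = Suc n * Suc (Suc n)"
    by (simp add: choose_two)
  then have "2 * int (Suc (Suc n) choose 2) = int (Suc n * Suc (Suc n))" by linarith
  then have "2 * int (pent (int (Suc n))) = 2 * int (Suc n * Suc n + (Suc (Suc n) choose 2))"
    unfolding two_pent by (simp add: algebra_simps)
  then show ?thesis by (simp only: mult_cancel_left of_nat_eq_iff) simp
qed

lemma pent_neg: "pent (- int (Suc n)) = Suc n * Suc n + (Suc n choose 2)"
proof -
  have "2 * (Suc n choose 2) = Suc n * n"
    by (simp add: choose_two)
  then have "2 * int (Suc n choose 2) = int (Suc n * n)" by linarith
  then have "2 * int (pent (- int (Suc n))) = 2 * int (Suc n * Suc n + (Suc n choose 2))"
    unfolding two_pent by (simp add: algebra_simps)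
  then show ?thesis by (simp only: mult_cancel_left of_nat_eq_iff) simp
qed

text \<open>Shanks's finite form of the pentagonal number theorem. The summand s = 0 on the right is
  the partial Euler product and every other summand carries a power of x above n, so one identity
  yields both the formal and the analytic theorem.\<close>

theorem shanks_identity:
  fixes x :: "'a::comm_ring_1"
  shows "(\<Sum>k\<in>{- int n..int n}. parity_sign k * x ^ pent k) =
    (\<Sum>s\<le>n. (-1) ^ s * (\<Prod>j\<in>{s<..n}. 1 - x ^ j) * x ^ (s * n + (Suc s choose 2)))"
proof (induction n)
  case 0
  show ?case by (simp add: pent_def parity_sign_def numeral_2_eq_2)
next
  case (Suc n)
  define P where "P s m = (\<Prod>j\<in>{s<..m}. 1 - x ^ j)" for s m
  define T where "T s = (Suc s choose 2)" for s
  have T_Suc: "T (Suc s) = T s + Suc s" for s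
    by (simp add: T_def numeral_2_eq_2)
  have P1: "P s (Suc n) = P s n * (1 - x ^ Suc n)" if "s \<le> n" for s
  proof -
    have "{s<..Suc n} = insert (Suc n) {s<..n}" using that by auto
    then show ?thesis by (simp add: P_def mult.commute)
  qed
  have P2: "P s n = P (Suc s) n * (1 - x ^ Suc s)" if "s < n" for s
  proof -
    have "{s<..n} = insert (Suc s) {Suc s<..n}" using that by auto
    then show ?thesis by (simp add: P_def mult.commute)
  qed
  \<comment> \<open>Splitting the new factor 1 - x^(n+1) gives \<open>u s - v s\<close>. Then
    \<open>u (Suc s) - v s\<close> is the summand Suc s of the sum for n; what is left over,
    \<open>- v n\<close> and the summand Suc n, are the two new terms k = -(n+1) and k =
    n+1.\<close>
  define u where "u s = (-1) ^ s * P s n * x ^ (s * Suc n + T s)" for s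
  define v where "v s = (-1) ^ s * P s n * x ^ (Suc s * Suc n + T s)" for s
  have "(\<Sum>s\<le>Suc n. (-1) ^ s * P s (Suc n) * x ^ (s * Suc n + T s)) =
     (\<Sum>s\<le>n. u s - v s) + (-1) ^ Suc n * x ^ (Suc n * Suc n + T (Suc n))"
  proof -
    have "(\<Sum>s\<le>n. (-1) ^ s * P s (Suc n) * x ^ (s * Suc n + T s)) = (\<Sum>s\<le>n. u s - v s)"
      by (intro sum.cong refl) (simp add: P1 u_def v_def algebra_simps power_add)
    moreover have "P (Suc n) (Suc n) = 1" by (simp add: P_def)
    ultimately show ?thesis by simp
  qed
  also have "(\<Sum>s\<le>n. u s - v s) = (\<Sum>s\<le>n. (-1) ^ s * P s n * x ^ (s * n + T s)) - v n"
  proof -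
    have "(\<Sum>s\<le>n. u s) - (\<Sum>s<n. v s) = (\<Sum>s\<le>n. (-1) ^ s * P s n * x ^ (s * n + T s))"
    proof -
      have "u (Suc s) - v s = (-1) ^ Suc s * P (Suc s) n * x ^ (Suc s * n + T (Suc s))" if "s < n" for s
        unfolding u_def v_def P2[OF that]
        by (simp add: T_Suc algebra_simps power_add)
      then have "(\<Sum>s<n. u (Suc s) - v s) =
         (\<Sum>s<n. (-1) ^ Suc s * P (Suc s) n * x ^ (Suc s * n + T (Suc s)))"
        by (intro sum.cong) auto
      moreover have "u 0 = (-1) ^ 0 * P 0 n * x ^ (0 * n + T 0)" by (simp add: u_def)
      ultimately show ?thesis
        by (simp only: sum.atMost_shift sum_subtractf add_diff_eq[symmetric])
    qed
    then show ?thesis by (simp add: sum_subtractf lessThan_Suc_atMost[symmetric] algebra_simps)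
  qed
  finally have *: "(\<Sum>s\<le>Suc n. (-1) ^ s * P s (Suc n) * x ^ (s * Suc n + T s)) =
     (\<Sum>s\<le>n. (-1) ^ s * P s n * x ^ (s * n + T s)) - v n + (-1) ^ Suc n * x ^ (Suc n * Suc n + T (Suc n))" .
  have set: "{- int (Suc n)..int (Suc n)} =
      insert (- int (Suc n)) (insert (int (Suc n)) {- int n..int n})" by auto
  have sgn: "parity_sign (int (Suc n)) = ((-1) ^ Suc n :: 'a)"
      "parity_sign (- int (Suc n)) = ((-1) ^ Suc n :: 'a)"
    by (auto simp: parity_sign_def)
  have "(\<Sum>k\<in>{- int (Suc n)..int (Suc n)}. parity_sign k * x ^ pent k) =
     (-1) ^ Suc n * x ^ pent (- int (Suc n)) + ((-1) ^ Suc n * x ^ pent (int (Suc n)) +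
      (\<Sum>k\<in>{- int n..int n}. parity_sign k * x ^ pent k))"
    unfolding set using sgn by (simp del: of_nat_Suc power_Suc)
  also have "\<dots> = (-1) ^ Suc n * x ^ pent (- int (Suc n)) + ((-1) ^ Suc n * x ^ pent (int (Suc n)) +
       (\<Sum>s\<le>n. (-1) ^ s * P s n * x ^ (s * n + T s)))"
    unfolding Suc.IH P_def T_def ..
  also have "\<dots> = (\<Sum>s\<le>Suc n. (-1) ^ s * P s (Suc n) * x ^ (s * Suc n + T s))"
    unfolding * pent_pos pent_neg by (simp add: v_def P_def T_def)
  finally show ?case unfolding P_def T_def .
qed

text \<open>The window -n..n catches every k with pent k = n because |k| \<le> pent k, and
  injectivity leaves at most one.\<close>

definition euler_fps :: "int fps" where
  "euler_fps = Abs_fps (\<lambda>n. \<Sum>k\<in>{- int n..int n}. if pent k = n then parity_sign k else 0)"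

lemma euler_fps_nth_pent: "fps_nth euler_fps (pent k) = parity_sign k"
proof -
  have "fps_nth euler_fps (pent k) =
      (\<Sum>j\<in>{- int (pent k)..int (pent k)}. if j = k then parity_sign j else 0)"
    unfolding euler_fps_def fps_nth_Abs_fps
    by (intro sum.cong) (use inj_pent in \<open>auto dest: injD\<close>)
  then show ?thesis using abs_le_pent[of k] by (auto simp: abs_le_iff)
qed

lemma euler_fps_nth_not_pent: "n \<notin> range pent \<Longrightarrow> fps_nth euler_fps n = 0"
  by (auto simp: euler_fps_def intro!: sum.neutral)

lemma euler_fps_nth_0 [simp]: "fps_nth euler_fps 0 = 1"
  using euler_fps_nth_pent[of 0] by (simp add: pent_def parity_sign_def)

lemma parity_sign_of_int [simp]: "of_int (parity_sign k) = parity_sign k"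
  by (simp add: parity_sign_def)

lemma norm_parity_sign [simp]:
  "norm (parity_sign k :: 'a::{comm_ring_1, real_normed_algebra_1}) = 1"
  by (simp add: parity_sign_def)

lemma fps_X_power_dvd_iff_nth:
  fixes f :: "'a::comm_ring_1 fps"
  shows "fps_X ^ n dvd f \<longleftrightarrow> (\<forall>i<n. fps_nth f i = 0)"
proof
  assume "fps_X ^ n dvd f"
  then show "\<forall>i<n. fps_nth f i = 0" by (auto elim!: dvdE simp: fps_X_power_mult_nth)
next
  assume "\<forall>i<n. fps_nth f i = 0"
  then have "f = fps_X ^ n * fps_shift n f"
    by (intro fps_ext) (simp add: fps_X_power_mult_nth)
  then show "fps_X ^ n dvd f" by (metis dvd_triv_left)
qed

text \<open>By \<open>shanks_identity\<close> the partial product and the truncated pentagonal sum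
  differ by a multiple of X^(n+1), and the terms with |k| > n start beyond degree n.\<close>

lemma euler_fps_cong:
  "fps_X ^ Suc n dvd (\<Prod>j<n. 1 - fps_X ^ Suc j) - euler_fps"
proof -
  let ?R = "\<lambda>s. (-1) ^ s * (\<Prod>j\<in>{s<..n}. 1 - fps_X ^ j) * fps_X ^ (s * n + (Suc s choose 2)) :: int fps"
  have "(\<Sum>k\<in>{- int n..int n}. parity_sign k * fps_X ^ pent k) = (\<Sum>s\<le>n. ?R s)"
    by (rule shanks_identity)
  also have "\<dots> = ?R 0 + (\<Sum>s<n. ?R (Suc s))"
    by (simp only: sum.atMost_shift)
  also have "?R 0 = (\<Prod>j<n. 1 - fps_X ^ Suc j)"
  proof -
    have "(\<Prod>j\<in>{0<..n}. 1 - fps_X ^ j) = (\<Prod>j<n. 1 - fps_X ^ Suc j :: int fps)"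
      by (rule prod.reindex_bij_witness[of _ Suc "\<lambda>j. j - 1"]) auto
    then show ?thesis by (simp add: numeral_2_eq_2)
  qed
  finally have 1: "(\<Sum>k\<in>{- int n..int n}. parity_sign k * fps_X ^ pent k) - (\<Prod>j<n. 1 - fps_X ^ Suc j) = (\<Sum>s<n. ?R (Suc s))"
    by (simp only: add_diff_cancel_left')
  have "fps_X ^ Suc n dvd ?R (Suc s)" for s
  proof -
    have "Suc n \<le> Suc s * n + (Suc (Suc s) choose 2)"
      by (simp add: numeral_2_eq_2)
    then show ?thesis by (intro dvd_mult le_imp_power_dvd)
  qed
  then have 2: "fps_X ^ Suc n dvd (\<Sum>k\<in>{- int n..int n}. parity_sign k * fps_X ^ pent k) - (\<Prod>j<n. 1 - fps_X ^ Suc j :: int fps)"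
    unfolding 1 by (intro dvd_sum) auto
  have "fps_nth (euler_fps - (\<Sum>k\<in>{- int n..int n}. parity_sign k * fps_X ^ pent k)) i = 0" if "i < Suc n" for i
  proof -
    have "fps_nth (\<Sum>k\<in>{- int n..int n}. parity_sign k * fps_X ^ pent k :: int fps) i =
        (\<Sum>k\<in>{- int n..int n}. if pent k = i then parity_sign k else 0)"
      unfolding fps_sum_nth by (intro sum.cong) (auto simp: parity_sign_def)
    also have "\<dots> = fps_nth euler_fps i"
      unfolding euler_fps_def fps_nth_Abs_fps
    proof (intro sum.mono_neutral_right ballI)
      fix k assume "k \<in> {- int n..int n} - {- int i..int i}"
      then have "pent k \<noteq> i" using abs_le_pent[of k] by auto
      then show "(if pent k = i then parity_sign k else 0) = (0::int)" by simp
    qed (use that in auto)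
    finally show ?thesis by simp
  qed
  then have 3: "fps_X ^ Suc n dvd euler_fps - (\<Sum>k\<in>{- int n..int n}. parity_sign k * fps_X ^ pent k)"
    by (simp add: fps_X_power_dvd_iff_nth del: power_Suc)
  show ?thesis using dvd_diff[OF dvd_minus_iff[THEN iffD2, OF 3] 2] by (simp add: algebra_simps)
qed


section \<open>Integral power series as holomorphic functions on the unit disc\<close>

text \<open>The bridge of the whole proof: f keeps integer coefficients, so congruences can be read
  off, while identities are proved for values of \<phi>. The values of \<phi> outside the open disc
  are unconstrained.\<close>

definition disc_fps :: "int fps \<Rightarrow> (complex \<Rightarrow> complex) \<Rightarrow> bool" where
  "disc_fps f \<phi> \<longleftrightarrow> (\<forall>q. norm q < 1 \<longrightarrow> (\<lambda>n. of_int (fps_nth f n) * q ^ n) sums \<phi> q)"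

definition complex_fps :: "int fps \<Rightarrow> complex fps" where
  "complex_fps f = Abs_fps (\<lambda>n. of_int (fps_nth f n))"

lemma complex_fps_nth [simp]: "fps_nth (complex_fps f) n = of_int (fps_nth f n)"
  by (simp add: complex_fps_def)

lemma complex_fps_mult: "complex_fps (f * g) = complex_fps f * complex_fps g"
  by (rule fps_ext) (simp add: fps_mult_nth)

lemma complex_fps_inj: "complex_fps f = complex_fps g \<longleftrightarrow> f = g"
  by (simp add: fps_eq_iff)

lemma fps_conv_radius_ge_1:
  fixes f :: "complex fps"
  assumes "\<And>q. norm q < 1 \<Longrightarrow> summable (\<lambda>n. fps_nth f n * q ^ n)"
  shows "fps_conv_radius f \<ge> 1"
proof -
  have "conv_radius (fps_nth f) \<ge> ereal 1"
  proof (rule conv_radius_geI_ex)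
    fix r :: real assume "0 < r" "ereal r < ereal 1"
    then show "\<exists>z. norm z = r \<and> summable (\<lambda>n. fps_nth f n * z ^ n)"
      by (intro exI[of _ "of_real r"]) (auto intro!: assms)
  qed
  then show ?thesis by (simp add: fps_conv_radius_def one_ereal_def)
qed

lemma disc_fps_iff:
  "disc_fps f \<phi> \<longleftrightarrow> fps_conv_radius (complex_fps f) \<ge> 1 \<and>
     (\<forall>q. norm q < 1 \<longrightarrow> eval_fps (complex_fps f) q = \<phi> q)" (is "_ \<longleftrightarrow> ?R")
proof
  assume "disc_fps f \<phi>"
  then show ?R
    by (auto simp: disc_fps_def eval_fps_def sums_iff intro!: fps_conv_radius_ge_1)
next
  assume R: ?R
  show "disc_fps f \<phi>" unfolding disc_fps_def
  proof safe
    fix q :: complex assume q: "norm q < 1"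
    then have "ereal (norm q) < fps_conv_radius (complex_fps f)"
      using R by (meson ereal_less(3) less_le_trans)
    from sums_eval_fps[OF this] show "(\<lambda>n. of_int (fps_nth f n) * q ^ n) sums \<phi> q"
      using R q by simp
  qed
qed

lemma disc_fps_radius:
  "disc_fps f \<phi> \<Longrightarrow> norm q < 1 \<Longrightarrow> ereal (norm q) < fps_conv_radius (complex_fps f)"
  unfolding disc_fps_iff by (meson ereal_less(3) less_le_trans)

lemma disc_fps_eval: "disc_fps f \<phi> \<Longrightarrow> norm q < 1 \<Longrightarrow> eval_fps (complex_fps f) q = \<phi> q"
  unfolding disc_fps_iff by blast

lemma disc_fps_at_0: "disc_fps f \<phi> \<Longrightarrow> \<phi> 0 = of_int (fps_nth f 0)"
  using disc_fps_eval[of f \<phi> 0] by (simp add: eval_fps_at_0)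

lemma disc_fps_holomorphic:
  assumes "disc_fps f \<phi>" shows "\<phi> holomorphic_on ball 0 1"
proof -
  have "eval_fps (complex_fps f) holomorphic_on ball 0 1"
    using disc_fps_radius[OF assms] by (intro holomorphic_on_eval_fps) auto
  then show ?thesis
    by (rule holomorphic_transform) (auto simp: disc_fps_eval[OF assms])
qed

lemma disc_fps_const: "disc_fps (fps_const c) (\<lambda>_. of_int c)"
proof -
  have "complex_fps (fps_const c) = fps_const (of_int c)"
    by (rule fps_ext) simp
  then show ?thesis by (simp add: disc_fps_iff)
qed

lemma disc_fps_1: "disc_fps 1 (\<lambda>_. 1)"
  using disc_fps_const[of 1] by simp

lemma disc_fps_0: "disc_fps 0 (\<lambda>_. 0)"
  using disc_fps_const[of 0] by simp

lemma disc_fps_X: "disc_fps fps_X (\<lambda>q. q)"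
proof -
  have "complex_fps fps_X = fps_X" by (rule fps_ext) simp
  then show ?thesis by (simp add: disc_fps_iff)
qed

lemma disc_fps_add:
  assumes "disc_fps f \<phi>" "disc_fps g \<gamma>" shows "disc_fps (f + g) (\<lambda>q. \<phi> q + \<gamma> q)"
  using assms unfolding disc_fps_def by (auto simp: ring_distribs intro!: sums_add)

lemma disc_fps_diff:
  assumes "disc_fps f \<phi>" "disc_fps g \<gamma>" shows "disc_fps (f - g) (\<lambda>q. \<phi> q - \<gamma> q)"
  using assms unfolding disc_fps_def by (auto simp: ring_distribs intro!: sums_diff)

lemma disc_fps_mult:
  assumes "disc_fps f \<phi>" "disc_fps g \<gamma>" shows "disc_fps (f * g) (\<lambda>q. \<phi> q * \<gamma> q)"
proof -
  have "fps_conv_radius (complex_fps f * complex_fps g) \<ge> 1"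
    using fps_conv_radius_mult[of "complex_fps f" "complex_fps g"] assms
    by (auto simp: disc_fps_iff min_def split: if_splits intro: order_trans)
  then show ?thesis using assms
    by (auto simp: disc_fps_iff[of "f * g"] complex_fps_mult disc_fps_eval
         eval_fps_mult[OF disc_fps_radius disc_fps_radius])
qed

lemma disc_fps_power:
  assumes "disc_fps f \<phi>" shows "disc_fps (f ^ n) (\<lambda>q. \<phi> q ^ n)"
  by (induction n) (auto intro: disc_fps_1 disc_fps_mult assms)

lemma disc_fps_sum:
  assumes "\<And>i. i \<in> A \<Longrightarrow> disc_fps (f i) (\<phi> i)"
  shows "disc_fps (\<Sum>i\<in>A. f i) (\<lambda>q. \<Sum>i\<in>A. \<phi> i q)"
  using assms by (induction A rule: infinite_finite_induct) (auto intro: disc_fps_0 disc_fps_add)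

lemma disc_fps_cong:
  "disc_fps f \<phi> \<Longrightarrow> (\<And>q. norm q < 1 \<Longrightarrow> \<phi> q = \<gamma> q) \<Longrightarrow> disc_fps f \<gamma>"
  by (simp add: disc_fps_def)

text \<open>The way back from functions to integers, by the identity theorem for power series at
  0.\<close>

lemma disc_fps_unique:
  assumes "disc_fps f \<phi>" "disc_fps g \<phi>" shows "f = g"
proof -
  have "complex_fps f = complex_fps g"
  proof (rule eval_fps_eqD)
    show "fps_conv_radius (complex_fps f) > 0" "fps_conv_radius (complex_fps g) > 0"
      using assms[THEN disc_fps_radius, of 0] by (auto simp: zero_ereal_def)
    have "eventually (\<lambda>z::complex. z \<in> ball 0 1) (nhds 0)"
      by (rule eventually_nhds_in_open) auto
    then show "eventually (\<lambda>z. eval_fps (complex_fps f) z = eval_fps (complex_fps g) z) (nhds 0)"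
      by eventually_elim (simp add: assms[THEN disc_fps_eval])
  qed
  then show ?thesis by (simp add: complex_fps_inj)
qed

text \<open>Constant term 1 gives an inverse over the integers, but says nothing about its
  convergence. The Taylor series of the holomorphic function 1/\<phi> converges on the disc and
  inverts f over the complex numbers, so uniqueness of inverses identifies the two.\<close>

lemma disc_fps_inverse:
  assumes f: "disc_fps f \<phi>" and "fps_nth f 0 = 1" and nz: "\<And>q. norm q < 1 \<Longrightarrow> \<phi> q \<noteq> 0"
  obtains g where "f * g = 1" "disc_fps g (\<lambda>q. inverse (\<phi> q))"
proof -
  define g where "g = fps_right_inverse f 1"
  have fg: "f * g = 1"
    unfolding g_def by (rule fps_right_inverse) (use assms in simp)
  define h where "h = Abs_fps (\<lambda>n. (deriv ^^ n) (\<lambda>q. inverse (\<phi> q)) 0 / fact n)"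
  have hol: "(\<lambda>q. inverse (\<phi> q)) holomorphic_on ball 0 1"
    using disc_fps_holomorphic[OF f] nz by (intro holomorphic_intros) auto
  have h: "(\<lambda>n. fps_nth h n * q ^ n) sums inverse (\<phi> q)" if "norm q < 1" for q
    using holomorphic_power_series[OF hol, of q] that by (simp add: h_def)
  have rad: "fps_conv_radius h \<ge> 1"
    by (rule fps_conv_radius_ge_1) (use h in \<open>auto simp: sums_iff\<close>)
  have radf: "fps_conv_radius (complex_fps f) \<ge> 1" using f by (simp add: disc_fps_iff)
  have ev: "eval_fps h q = inverse (\<phi> q)" if "norm q < 1" for q
    using h[OF that] by (simp add: eval_fps_def sums_iff)
  have "complex_fps f * h = 1"
  proof (rule eval_fps_eqD)
    show "fps_conv_radius (complex_fps f * h) > 0"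
    proof -
      have "1 \<le> min (fps_conv_radius (complex_fps f)) (fps_conv_radius h)"
        using rad radf by simp
      also have "\<dots> \<le> fps_conv_radius (complex_fps f * h)" by (rule fps_conv_radius_mult)
      finally show ?thesis by (rule less_le_trans[rotated]) simp
    qed
    have "eventually (\<lambda>z::complex. z \<in> ball 0 1) (nhds 0)"
      by (rule eventually_nhds_in_open) auto
    then show "eventually (\<lambda>z. eval_fps (complex_fps f * h) z = eval_fps 1 z) (nhds 0)"
    proof eventually_elim
      case (elim z)
      then have z: "norm z < 1" by simp
      have "ereal (norm z) < fps_conv_radius h"
        using rad z by (meson ereal_less(3) less_le_trans)
      then show ?case using z nz[OF z]
        by (simp add: eval_fps_mult disc_fps_radius[OF f] disc_fps_eval[OF f] ev)
    qed
  qed simp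
  moreover have "complex_fps f * complex_fps g = 1"
    using fg by (metis complex_fps_mult complex_fps_nth fps_ext fps_one_nth of_int_0 of_int_1)
  ultimately have "complex_fps g = h"
    by (metis mult.assoc mult.commute mult_1_right)
  then have "fps_nth h n = of_int (fps_nth g n)" for n by (metis complex_fps_nth)
  then have "disc_fps g (\<lambda>q. inverse (\<phi> q))"
    using h by (simp add: disc_fps_def)
  then show ?thesis using fg that by blast
qed

lemma disc_fps_compose_X_power:
  assumes f: "disc_fps f \<phi>" and k: "k > 0"
  shows "disc_fps (f oo fps_X ^ k) (\<lambda>q. \<phi> (q ^ k))"
  unfolding disc_fps_def
proof safe
  fix q :: complex assume q: "norm q < 1"
  have "norm (q ^ k) < 1" using q k by (simp add: norm_power power_less_one_iff)
  then have "(\<lambda>n. of_int (fps_nth f n) * (q ^ k) ^ n) sums \<phi> (q ^ k)"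
    using f by (simp add: disc_fps_def)
  then have *: "(\<lambda>n. of_int (fps_nth (f oo fps_X ^ k) (k * n)) * q ^ (k * n)) sums \<phi> (q ^ k)"
    using k by (simp add: fps_nth_compose_X_power power_mult)
  have mono: "strict_mono (\<lambda>n. k * n)" using k by (simp add: strict_mono_def)
  have "fps_nth (f oo fps_X ^ k) n = 0" if "n \<notin> range (\<lambda>n. k * n)" for n
    using that k by (subst fps_nth_compose_X_power) (auto elim!: dvdE)
  then show "(\<lambda>n. of_int (fps_nth (f oo fps_X ^ k) n) * q ^ n) sums \<phi> (q ^ k)"
    using * by (subst sums_mono_reindex[OF mono, symmetric]) simp_all
qed

section \<open>The Euler product and the pentagonal number theorem\<close>

definition euler :: "complex \<Rightarrow> complex" where
  "euler q = (\<Prod>n. 1 - q ^ Suc n)"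

lemma one_minus_power_Suc_nonzero:
  fixes q :: complex assumes "norm q < 1" shows "1 - q ^ Suc n \<noteq> 0"
proof
  assume "1 - q ^ Suc n = 0"
  then have "norm q ^ Suc n = 1" by (metis norm_one norm_power right_minus_eq)
  moreover have "norm q ^ Suc n < 1" using assms by (simp add: power_less_one_iff del: power_Suc)
  ultimately show False by simp
qed

lemma convergent_prod_euler:
  fixes q :: complex assumes "norm q < 1" shows "convergent_prod (\<lambda>n. 1 - q ^ Suc n)"
proof -
  have "summable (\<lambda>n. norm q ^ Suc n)"
    using assms by (simp add: summable_geometric summable_mult)
  then show ?thesis
    by (intro abs_convergent_prod_imp_convergent_prod summable_imp_abs_convergent_prod)
       (simp add: norm_mult norm_power)
qed

lemma euler_nonzero: "norm q < 1 \<Longrightarrow> euler q \<noteq> 0"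
  unfolding euler_def using convergent_prod_euler one_minus_power_Suc_nonzero by (intro prodinf_nonzero)

text \<open>Turns an unconditional sum over the integers into a limit along symmetric windows, the
  shape in which both Shanks's identity and the telescoping integrals below deliver partial
  sums.\<close>

lemma has_sum_int_imp_symmetric_LIMSEQ:
  assumes "(f has_sum S) (UNIV :: int set)"
  shows "(\<lambda>n. \<Sum>k\<in>{- int n..int n}. f k) \<longlonglongrightarrow> S"
proof -
  have "filterlim (\<lambda>n. {- int n..int n}) (finite_subsets_at_top UNIV) sequentially"
  proof (rule filterlim_finite_subsets_at_top[THEN iffD2], safe)
    fix X :: "int set" assume "finite X"
    define m where "m = nat (\<Sum>x\<in>X. \<bar>x\<bar>)"
    have *: "\<bar>x\<bar> \<le> int m" if "x \<in> X" for x
      unfolding m_def using member_le_sum[of x X abs] that \<open>finite X\<close> by auto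
    show "\<forall>\<^sub>F n in sequentially. finite {- int n..int n} \<and> X \<subseteq> {- int n..int n} \<and> {- int n..int n} \<subseteq> UNIV"
      using eventually_ge_at_top[of m]
      by eventually_elim (use * in force)
  qed
  with assms show ?thesis unfolding has_sum_def by (rule filterlim_compose)
qed

lemma abs_summable_pent:
  fixes q :: complex assumes "norm q < 1"
  shows "(\<lambda>k. norm (parity_sign k * q ^ pent k)) summable_on UNIV"
proof -
  have "(\<lambda>n. norm q ^ n) summable_on UNIV"
    using assms by (intro norm_summable_imp_summable_on) (simp add: summable_geometric norm_power)
  then have "(\<lambda>n. norm q ^ n) summable_on range pent"
    by (rule summable_on_subset_banach) simp
  then show ?thesis
    by (subst (asm) summable_on_reindex[OF inj_pent]) (simp add: o_def norm_mult norm_power)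
qed

text \<open>The products over s < j \<le> n are quotients of partial products, which converge to a
  nonzero limit; hence they are bounded uniformly in s and n, and the error in
  \<open>shanks_identity\<close> is at most n times a constant times |q|^n.\<close>

theorem euler_pentagonal:
  fixes q :: complex assumes q: "norm q < 1"
  shows "((\<lambda>k. parity_sign k * q ^ pent k) has_sum euler q) UNIV"
proof -
  define P where "P n = (\<Prod>j<n. 1 - q ^ Suc j)" for n
  define f where "f k = parity_sign k * q ^ pent k" for k
  obtain S where S: "(f has_sum S) UNIV"
    using abs_summable_summable[OF abs_summable_pent[OF q]] unfolding f_def summable_on_def by blast
  have P_nz: "P n \<noteq> 0" for n
    unfolding P_def using one_minus_power_Suc_nonzero[OF q] by auto
  have P: "P \<longlonglongrightarrow> euler q"
  proof -
    have "(\<lambda>n. P (Suc n)) \<longlonglongrightarrow> euler q"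
      using convergent_prod_LIMSEQ[OF convergent_prod_euler[OF q]]
      by (simp add: P_def euler_def lessThan_Suc_atMost)
    then show ?thesis by (rule filterlim_sequentially_Suc[THEN iffD1])
  qed
  obtain B where B: "norm (P n) \<le> B" for n
    using P convergent_imp_Bseq[of P] unfolding convergent_def Bseq_def by blast
  have "(\<lambda>n. inverse (P n)) \<longlonglongrightarrow> inverse (euler q)"
    using P euler_nonzero[OF q] by (rule tendsto_inverse)
  then obtain C where C: "norm (inverse (P n)) \<le> C" for n
    using convergent_imp_Bseq[of "\<lambda>n. inverse (P n)"] unfolding convergent_def Bseq_def by blast
  have nn: "0 \<le> B" "0 \<le> C" using B[of 0] C[of 0] by (auto intro: order_trans[OF norm_ge_zero])
  have prod: "(\<Prod>j\<in>{s<..n}. 1 - q ^ j) = P n * inverse (P s)" if "s \<le> n" for s n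
  proof -
    have "(\<Prod>j\<in>{s<..n}. 1 - q ^ j) = (\<Prod>j\<in>{s..<n}. 1 - q ^ Suc j)"
      by (rule prod.reindex_bij_witness[of _ Suc "\<lambda>j. j - 1"]) auto
    moreover have "P n = P s * (\<Prod>j\<in>{s..<n}. 1 - q ^ Suc j)"
      unfolding P_def using that by (metis atLeast0LessThan le0 prod.atLeastLessThan_concat)
    ultimately show ?thesis using P_nz[of s] by simp
  qed
  have est: "norm ((\<Sum>k\<in>{- int n..int n}. f k) - P n) \<le> real n * (B * C * norm q ^ n)" for n
  proof -
    let ?R = "\<lambda>s. (-1) ^ s * (\<Prod>j\<in>{s<..n}. 1 - q ^ j) * q ^ (s * n + (Suc s choose 2))"
    have "(\<Sum>k\<in>{- int n..int n}. f k) = (\<Sum>s\<le>n. ?R s)"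
      unfolding f_def by (rule shanks_identity)
    also have "\<dots> = ?R 0 + (\<Sum>s<n. ?R (Suc s))"
      by (simp only: sum.atMost_shift)
    also have "?R 0 = P n" using prod[of 0 n] by (simp add: P_def numeral_2_eq_2)
    finally have "(\<Sum>k\<in>{- int n..int n}. f k) - P n = (\<Sum>s<n. ?R (Suc s))" by (simp only: add_diff_cancel_left')
    also have "norm \<dots> \<le> (\<Sum>s<n. B * C * norm q ^ n)"
    proof (rule sum_norm_le)
      fix s assume "s \<in> {..<n}"
      then have "norm (?R (Suc s)) = norm (P n) * norm (inverse (P (Suc s))) * norm q ^ (Suc s * n + (Suc (Suc s) choose 2))"
        by (subst prod) (auto simp: norm_mult norm_power)
      also have "\<dots> \<le> B * C * norm q ^ n"
        using q nn by (intro mult_mono B C power_decreasing) auto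
      finally show "norm (?R (Suc s)) \<le> B * C * norm q ^ n" .
    qed
    finally show ?thesis by simp
  qed
  have "(\<lambda>n. real n * (B * C * norm q ^ n)) \<longlonglongrightarrow> 0"
    using tendsto_mult[OF tendsto_const[of "B * C"] powser_times_n_limit_0[of "norm q"]] q
    by (simp add: algebra_simps)
  from Lim_null_comparison[OF always_eventually[OF allI[OF est]] this]
  have "(\<lambda>n. (\<Sum>k\<in>{- int n..int n}. f k) - P n) \<longlonglongrightarrow> 0" .
  from tendsto_add[OF this P] have "(\<lambda>n. \<Sum>k\<in>{- int n..int n}. f k) \<longlonglongrightarrow> euler q" by simp
  moreover have "(\<lambda>n. \<Sum>k\<in>{- int n..int n}. f k) \<longlonglongrightarrow> S"
    using S by (rule has_sum_int_imp_symmetric_LIMSEQ)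
  ultimately have "S = euler q" by (metis LIMSEQ_unique)
  then show ?thesis using S by (simp add: f_def[abs_def])
qed

lemma disc_fps_euler: "disc_fps euler_fps euler"
  unfolding disc_fps_def
proof safe
  fix q :: complex assume q: "norm q < 1"
  let ?g = "\<lambda>n. of_int (fps_nth euler_fps n) * q ^ n"
  have "((?g \<circ> pent) has_sum euler q) UNIV"
    using euler_pentagonal[OF q] by (simp add: o_def euler_fps_nth_pent)
  then have "(?g has_sum euler q) (range pent)"
    by (simp add: has_sum_reindex[OF inj_pent])
  then have "(?g has_sum euler q) UNIV"
    by (rule has_sum_cong_neutral[THEN iffD1, rotated -1]) (auto simp: euler_fps_nth_not_pent)
  then show "?g sums euler q" by (rule has_sum_imp_sums)
qed

section \<open>The generating function of \<alpha> on the disc\<close>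

lemma alpha_gf_cong: "fps_X ^ Suc n dvd (\<Prod>i\<le>n. alpha_factor i) - alpha_gf"
proof -
  have "fps_nth alpha_gf k = fps_nth (\<Prod>i\<le>n. alpha_factor i) k" if "k \<le> n" for k
  proof -
    have "(\<lambda>n. \<Prod>i\<le>n. alpha_factor i) \<longlonglongrightarrow> alpha_gf"
      using alpha_gf_has_prod alpha_factor_nonzero by (auto simp: has_prod_def raw_has_prod_def)
    then have "\<forall>\<^sub>F m in sequentially. fps_nth (\<Prod>i\<le>m. alpha_factor i) k = fps_nth alpha_gf k"
      unfolding tendsto_fps_iff by blast
    then have "\<forall>\<^sub>F m in sequentially. fps_nth (\<Prod>i\<le>m. alpha_factor i) k = fps_nth alpha_gf k \<and> m \<ge> k"
      using eventually_ge_at_top[of k] by (rule eventually_conj)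
    then obtain m where "fps_nth (\<Prod>i\<le>m. alpha_factor i) k = fps_nth alpha_gf k" "m \<ge> k"
      unfolding eventually_sequentially by blast
    then show ?thesis using alpha_partial_nth[of k m] alpha_partial_nth[of k n] that by simp
  qed
  then show ?thesis by (auto simp: fps_X_power_dvd_iff_nth simp del: power_Suc)
qed

lemma dvd_diff_mult:
  fixes a b c d m :: "'a::comm_ring_1"
  assumes "m dvd a - b" "m dvd c - d" shows "m dvd a * c - b * d"
proof -
  have "a * c - b * d = (a - b) * c + b * (c - d)" by (simp add: algebra_simps)
  then show ?thesis using assms by (metis dvd_add dvd_mult dvd_mult2)
qed

lemma dvd_diff_power:
  fixes a b m :: "'a::comm_ring_1"
  assumes "m dvd a - b" shows "m dvd a ^ n - b ^ n"
  by (induction n) (use dvd_diff_mult[OF assms] in auto)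

text \<open>The denominator is cleared so that everything stays a power series over the integers.
  Modulo X^(n+1) the infinite products may be replaced by finite ones, where the identity is the
  defining relation of the factors.\<close>

lemma alpha_gf_times_euler: "alpha_gf * euler_fps ^ 2 = (euler_fps oo fps_X ^ 2) ^ 3"
proof -
  have "fps_nth (alpha_gf * euler_fps ^ 2) n = fps_nth ((euler_fps oo fps_X ^ 2) ^ 3) n" for n
  proof -
    define P where "P = (\<Prod>j\<le>n. 1 - fps_X ^ Suc j :: int fps)"
    have P: "fps_X ^ Suc n dvd P - euler_fps"
      using euler_fps_cong[of "Suc n"] unfolding P_def lessThan_Suc_atMost
      by (rule dvd_trans[rotated]) simp
    have P2: "fps_X ^ Suc n dvd (P oo fps_X ^ 2) - (euler_fps oo fps_X ^ 2)"
      using P unfolding fps_X_power_dvd_iff_nth fps_compose_sub_distrib[symmetric]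
      by (auto simp: fps_nth_compose_X_power)
    have "(\<Prod>i\<le>n. alpha_factor i) * P ^ 2 = (\<Prod>i\<le>n. alpha_factor i * (1 - fps_X ^ Suc i) ^ 2)"
      unfolding P_def by (simp only: prod.distrib prod_power_distrib)
    also have "\<dots> = (\<Prod>i\<le>n. 1 - fps_X ^ (2 * Suc i)) ^ 3"
      by (simp only: alpha_factor_times prod_power_distrib)
    also have "(\<Prod>i\<le>n. 1 - fps_X ^ (2 * Suc i)) = P oo fps_X ^ 2"
    proof -
      have "(1 - fps_X ^ Suc i) oo fps_X ^ 2 = (1 - fps_X ^ (2 * Suc i) :: int fps)" for i
        by (subst fps_compose_sub_distrib, subst fps_X_power_compose) (simp_all only: fps_compose_1 power_mult, simp)
      then show ?thesis unfolding P_def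
        by (subst fps_compose_prod_distrib) (simp_all del: power_Suc)
    qed
    finally have eq: "(\<Prod>i\<le>n. alpha_factor i) * P ^ 2 = (P oo fps_X ^ 2) ^ 3" .
    have "fps_X ^ Suc n dvd (\<Prod>i\<le>n. alpha_factor i) * P ^ 2 - alpha_gf * euler_fps ^ 2"
      by (intro dvd_diff_mult alpha_gf_cong dvd_diff_power P)
    moreover have "fps_X ^ Suc n dvd (P oo fps_X ^ 2) ^ 3 - (euler_fps oo fps_X ^ 2) ^ 3"
      by (intro dvd_diff_power P2)
    ultimately have "fps_X ^ Suc n dvd alpha_gf * euler_fps ^ 2 - (euler_fps oo fps_X ^ 2) ^ 3"
      unfolding eq by (metis (no_types, lifting) diff_diff_eq2 dvd_diff minus_diff_eq dvd_minus_iff diff_add_cancel)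
    then show ?thesis unfolding fps_X_power_dvd_iff_nth by (force simp del: power_Suc)
  qed
  then show ?thesis by (rule fps_ext)
qed

lemma disc_fps_alpha: "disc_fps alpha_gf (\<lambda>q. euler (q\<^sup>2) ^ 3 / euler q ^ 2)"
proof -
  obtain g where g: "euler_fps * g = 1" "disc_fps g (\<lambda>q. inverse (euler q))"
    using disc_fps_inverse[OF disc_fps_euler] euler_nonzero by auto
  have "alpha_gf = alpha_gf * (euler_fps * g) ^ 2" using g by simp
  also have "\<dots> = (euler_fps oo fps_X ^ 2) ^ 3 * g ^ 2"
    by (simp add: power_mult_distrib flip: alpha_gf_times_euler mult.assoc)
  finally have "alpha_gf = (euler_fps oo fps_X ^ 2) ^ 3 * g ^ 2" .
  moreover have "disc_fps ((euler_fps oo fps_X ^ 2) ^ 3 * g ^ 2)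
      (\<lambda>q. euler (q ^ 2) ^ 3 * inverse (euler q) ^ 2)"
    by (intro disc_fps_mult disc_fps_power disc_fps_compose_X_power disc_fps_euler g) auto
  ultimately show ?thesis by (simp add: field_simps)
qed

section \<open>Theta inversion\<close>

text \<open>One factor cos^2 is a combination of the frequencies -1, 0 and 1, so it only shifts m;
  with m arbitrary in the induction each of the three resulting integrals is already zero.\<close>

lemma cos_power_integral_zero:
  fixes D :: "real \<Rightarrow> complex"
  assumes D: "continuous_on {0..1} D"
    and zero: "\<And>m::int. integral {0..1} (\<lambda>x. D x * cis (2 * pi * m * x)) = 0"
  shows "integral {0..1} (\<lambda>x. D x * of_real (cos (pi * (x - a)) ^ (2 * n)) * cis (2 * pi * real_of_int m * x)) = 0"
proof (induction n arbitrary: m)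
  case 0
  then show ?case by (simp add: zero)
next
  case (Suc n)
  define I where "I m x = D x * of_real (cos (pi * (x - a)) ^ (2 * n)) * cis (2 * pi * real_of_int m * x)" for m x
  have int: "I m integrable_on {0..1}" for m
    unfolding I_def by (intro integrable_continuous_interval continuous_intros D)
  have eq: "D x * of_real (cos (pi * (x - a)) ^ (2 * Suc n)) * cis (2 * pi * real_of_int m * x) =
      (1/2) * I m x + (cis (- 2 * pi * a) / 4) * I (m + 1) x + (cis (2 * pi * a) / 4) * I (m - 1) x" for x
  proof -
    have "complex_of_real (cos (pi * (x - a)) ^ 2) =
       1 / 2 + cis (- 2 * pi * a) * cis (2 * pi * x) / 4 + cis (2 * pi * a) * cis (- 2 * pi * x) / 4"
    proof -
      have "cos (pi * (x - a)) ^ 2 = (1 + cos (2 * pi * x - 2 * pi * a)) / 2"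
        using cos_double_cos[of "pi * (x - a)"] by (simp add: algebra_simps)
      moreover have "cis (- 2 * pi * a) * cis (2 * pi * x) = cis (2 * pi * x - 2 * pi * a)"
        "cis (2 * pi * a) * cis (- 2 * pi * x) = cis (- (2 * pi * x - 2 * pi * a))"
        by (simp_all add: cis_mult algebra_simps)
      ultimately show ?thesis by (simp add: complex_eq_iff cis.sel)
    qed
    moreover have "cis (2 * pi * real_of_int (m + 1) * x) = cis (2 * pi * x) * cis (2 * pi * real_of_int m * x)"
      "cis (2 * pi * real_of_int (m - 1) * x) = cis (- 2 * pi * x) * cis (2 * pi * real_of_int m * x)"
      by (simp_all add: cis_mult algebra_simps)
    moreover have "cos (pi * (x - a)) ^ (2 * Suc n) = cos (pi * (x - a)) ^ 2 * cos (pi * (x - a)) ^ (2 * n)"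
      by (simp add: power_add[symmetric])
    ultimately show ?thesis unfolding I_def by (simp only: of_real_mult) (simp add: algebra_simps)
  qed
  have *: "((\<lambda>x. (1/2) * I m x + (cis (- 2 * pi * a) / 4) * I (m + 1) x + (cis (2 * pi * a) / 4) * I (m - 1) x)
    has_integral ((1/2) * 0 + (cis (- 2 * pi * a) / 4) * 0 + (cis (2 * pi * a) / 4) * 0)) {0..1}"
    using int Suc.IH unfolding I_def[symmetric]
    by (intro has_integral_add has_integral_mult_right) (metis integrable_integral)+
  show ?case unfolding eq using integral_unique[OF *] by simp
qed

lemma abs_cos_pi_le:
  assumes "0 \<le> d" "d \<le> \<bar>u\<bar>" "\<bar>u\<bar> \<le> 1 - d"
  shows "\<bar>cos (pi * u)\<bar> \<le> cos (pi * d)"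
proof -
  have "cos (pi * u) = cos (pi * \<bar>u\<bar>)"
    by (metis abs_if cos_minus mult_minus_right)
  moreover have "cos (pi * \<bar>u\<bar>) \<le> cos (pi * d)"
    using assms by (intro cos_monotone_0_pi_le) (auto simp: mult_le_cancel_left1)
  moreover have "cos (pi * (1 - d)) \<le> cos (pi * \<bar>u\<bar>)"
    using assms by (intro cos_monotone_0_pi_le) (auto simp: mult_le_cancel_left1)
  moreover have "cos (pi * (1 - d)) = - cos (pi * d)"
    by (simp add: right_diff_distrib cos_diff)
  ultimately show ?thesis by linarith
qed

text \<open>The nonnegative trigonometric polynomials \<open>cos (pi * (x - a)) ^ (2 * n)\<close> concentrate at \<open>a\<close>.\<close>

lemma fourier_unique_interior:
  fixes D :: "real \<Rightarrow> complex"
  assumes D: "continuous_on {0..1} D"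
    and zero: "\<And>m::int. integral {0..1} (\<lambda>x. D x * cis (2 * pi * m * x)) = 0"
    and a: "0 < a" "a < 1"
  shows "D a = 0"
proof -
  have "norm (D a) \<le> \<epsilon>" if eps: "\<epsilon> > 0" for \<epsilon>
  proof -
    obtain d0 where d0: "d0 > 0" "\<And>x. x \<in> {0..1} \<Longrightarrow> dist x a < d0 \<Longrightarrow> dist (D x) (D a) < \<epsilon>"
      using D a eps unfolding continuous_on_iff by (metis atLeastAtMost_iff less_imp_le)
    \<comment> \<open>The bound 1/4 keeps cos (pi * d) positive. The bounds a and 1 - a keep the
      d-neighbourhood of a inside the unit interval and give |x - a| \<le> 1 - d, as
      \<open>abs_cos_pi_le\<close> asks.\<close>
    define d where "d = min (min (d0 / 2) (1/4)) (min a (1 - a))"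
    have d: "0 < d" "d < d0" "d \<le> 1/4" "d \<le> a" "d \<le> 1 - a"
      unfolding d_def using d0 a by linarith+
    obtain B where "\<forall>y\<in>D ` {0..1}. norm y \<le> B"
      using compact_imp_bounded[OF compact_continuous_image[OF D]] unfolding bounded_iff by blast
    then have B: "norm (D x) \<le> B" if "x \<in> {0..1}" for x using that by blast
    \<comment> \<open>\<open>\<rho>\<close> bounds cos^2 from above at distance at least d from a,
      and \<open>\<sigma>\<close> bounds it from below within d/2. Since \<rho> < \<sigma>, the
      share of the kernel outside the d-neighbourhood decays like (\<rho>/\<sigma>)^n.\<close>
    define \<rho> where "\<rho> = cos (pi * d) ^ 2"
    define \<sigma> where "\<sigma> = cos (pi * (d / 2)) ^ 2"
    have cosd: "0 < cos (pi * d)" "cos (pi * d) < cos (pi * (d / 2))"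
    proof -
      show "0 < cos (pi * d)" using d by (intro cos_gt_zero_pi) (auto simp: field_simps intro: less_trans[of _ 0])
      show "cos (pi * d) < cos (pi * (d / 2))"
        using d by (intro cos_monotone_0_pi) (auto simp: mult_le_cancel_left1)
    qed
    then have rs: "0 < \<rho>" "\<rho> < \<sigma>" unfolding \<rho>_def \<sigma>_def by (auto intro: power_strict_mono)
    define K where "K n x = cos (pi * (x - a)) ^ (2 * n)" for n x
    have K0: "0 \<le> K n x" for n x by (simp add: K_def power_mult)
    have Kcont: "continuous_on S (K n)" for S n unfolding K_def by (intro continuous_intros)
    have Kint: "K n integrable_on {0..1}" for n by (intro integrable_continuous_interval Kcont)
    have lower: "integral {0..1} (K n) \<ge> d * \<sigma> ^ n" for n
    proof -
      have "d * \<sigma> ^ n = integral {a - d/2..a + d/2} (\<lambda>_. \<sigma> ^ n)" using d by simp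
      also have "\<dots> \<le> integral {a - d/2..a + d/2} (K n)"
      proof (rule integral_le)
        fix x assume "x \<in> {a - d/2..a + d/2}"
        then have x: "\<bar>x - a\<bar> \<le> d / 2" unfolding atLeastAtMost_iff by linarith
        have "cos (pi * (d/2)) \<le> cos (pi * \<bar>x - a\<bar>)"
          using x d by (intro cos_monotone_0_pi_le) (auto simp: mult_le_cancel_left1)
        also have "\<dots> = cos (pi * (x - a))" by (metis abs_if cos_minus mult_minus_right)
        finally have "\<sigma> \<le> cos (pi * (x - a)) ^ 2" unfolding \<sigma>_def
          using cosd by (intro power_mono) auto
        then show "\<sigma> ^ n \<le> K n x" unfolding K_def power_mult
          using rs by (intro power_mono) auto
      qed (auto intro!: integrable_continuous_interval Kcont)
      also have "\<dots> \<le> integral {0..1} (K n)"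
        by (rule integral_subset_le) (use d in \<open>auto intro!: integrable_continuous_interval Kcont K0\<close>)
      finally show ?thesis .
    qed
    have B0: "0 \<le> B" using B[of 0] by (auto intro: order_trans[OF norm_ge_zero])
    have pw: "norm ((D a - D x) * of_real (K n x)) \<le> \<epsilon> * K n x + 2 * B * \<rho> ^ n" if x: "x \<in> {0..1}" for n x
    proof (cases "\<bar>x - a\<bar> < d")
      case True
      then have "norm (D a - D x) \<le> \<epsilon>" using d0(2)[OF x] d
        by (simp add: dist_norm norm_minus_commute)
      then have "norm ((D a - D x) * of_real (K n x)) \<le> \<epsilon> * K n x"
        unfolding norm_mult using K0[of n x] by (simp add: mult_right_mono)
      then show ?thesis using rs B0 by (smt (verit) mult_nonneg_nonneg zero_le_power)
    next
      case False
      then have "\<bar>cos (pi * (x - a))\<bar> \<le> cos (pi * d)"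
        using d x by (intro abs_cos_pi_le) auto
      then have "cos (pi * (x - a)) ^ 2 \<le> \<rho>" unfolding \<rho>_def by (rule power2_le_iff_abs_le[THEN iffD2, rotated]) (use cosd in auto)
      then have "K n x \<le> \<rho> ^ n" unfolding K_def power_mult by (intro power_mono) auto
      moreover have "norm (D a - D x) \<le> 2 * B"
        using B[of a] B[of x] x a norm_triangle_ineq4[of "D a" "D x"] by auto
      ultimately have "norm ((D a - D x) * of_real (K n x)) \<le> 2 * B * \<rho> ^ n"
        unfolding norm_mult using K0[of n x] B0 by (intro mult_mono) auto
      then show ?thesis using K0[of n x] eps by (smt (verit) mult_nonneg_nonneg)
    qed
    have main: "norm (D a) \<le> \<epsilon> + 2 * B / d * (\<rho> / \<sigma>) ^ n" for n
    proof -
      have z: "integral {0..1} (\<lambda>x. D x * of_real (K n x)) = 0"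
        using cos_power_integral_zero[OF D zero, of a n 0] by (simp add: K_def)
      have "integral {0..1} (\<lambda>x. (D a - D x) * of_real (K n x)) =
        integral {0..1} (\<lambda>x. D a * of_real (K n x)) - integral {0..1} (\<lambda>x. D x * of_real (K n x))"
        unfolding left_diff_distrib
        by (intro integral_diff integrable_continuous_interval continuous_intros D Kcont)
      also have "\<dots> = D a * of_real (integral {0..1} (K n))"
        using integral_linear[OF Kint bounded_linear_of_real[where 'a = complex], of n] by (simp add: z o_def)
      finally have "norm (D a) * integral {0..1} (K n) = norm (integral {0..1} (\<lambda>x. (D a - D x) * of_real (K n x)))"
        using integral_nonneg[OF Kint, of n] K0 by (simp add: norm_mult)
      also have "\<dots> \<le> integral {0..1} (\<lambda>x. \<epsilon> * K n x + 2 * B * \<rho> ^ n)"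
        by (rule integral_norm_bound_integral)
           (auto intro!: integrable_continuous_interval continuous_intros D Kcont pw simp del: norm_mult)
      also have "\<dots> = \<epsilon> * integral {0..1} (K n) + 2 * B * \<rho> ^ n"
        by (subst integral_add) (auto intro!: integrable_continuous_interval continuous_intros Kcont)
      finally have "norm (D a) * integral {0..1} (K n) \<le> \<epsilon> * integral {0..1} (K n) + 2 * B * \<rho> ^ n" .
      moreover have pos: "integral {0..1} (K n) > 0"
        using lower[of n] d rs by (smt (verit) mult_pos_pos zero_less_power)
      ultimately have "norm (D a) \<le> \<epsilon> + 2 * B * \<rho> ^ n / integral {0..1} (K n)"
        by (simp add: field_simps)
      also have "2 * B * \<rho> ^ n / integral {0..1} (K n) \<le> 2 * B * \<rho> ^ n / (d * \<sigma> ^ n)"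
        using lower[of n] d rs B0 by (intro divide_left_mono) (auto intro!: mult_pos_pos pos)
      also have "\<dots> = 2 * B / d * (\<rho> / \<sigma>) ^ n" by (simp add: power_divide)
      finally show ?thesis by simp
    qed
    have "(\<lambda>n. (\<rho> / \<sigma>) ^ n) \<longlonglongrightarrow> 0"
      by (rule LIMSEQ_realpow_zero) (use rs in auto)
    then have "(\<lambda>n. \<epsilon> + 2 * B / d * (\<rho> / \<sigma>) ^ n) \<longlonglongrightarrow> \<epsilon> + 2 * B / d * 0"
      by (intro tendsto_add tendsto_mult tendsto_const)
    then show ?thesis using main by (intro LIMSEQ_le_const) auto
  qed
  then show ?thesis by (metis dense_ge norm_le_zero_iff)
qed

text \<open>Continuity closes up to the endpoints. The endpoint 0 matters: it is the shift of the
  residue class 0 in \<open>poisson_periodic_gaussian\<close>.\<close>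

lemma fourier_unique:
  fixes D :: "real \<Rightarrow> complex"
  assumes D: "continuous_on {0..1} D"
    and zero: "\<And>m::int. integral {0..1} (\<lambda>x. D x * cis (2 * pi * m * x)) = 0"
    and a: "a \<in> {0..1}"
  shows "D a = 0"
proof (rule continuous_constant_on_closure[of "{0<..<1}" D 0 a])
  show "continuous_on (closure {0<..<1}) D" using D by simp
  show "a \<in> closure {0<..<1}" using a by simp
qed (use fourier_unique_interior[OF D zero] in auto)

section \<open>Poisson summation for the Gaussian\<close>

lemma has_sum_integral_unit_interval:
  fixes f :: "'i \<Rightarrow> real \<Rightarrow> complex"
  assumes cont: "\<And>k. continuous_on {0..1} (f k)"
    and M: "\<And>k x. x \<in> {0..1} \<Longrightarrow> norm (f k x) \<le> M k" and "M summable_on UNIV"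
  shows "continuous_on {0..1} (\<lambda>x. \<Sum>\<^sub>\<infinity>k. f k x)"
    and "((\<lambda>k. integral {0..1} (f k)) has_sum integral {0..1} (\<lambda>x. \<Sum>\<^sub>\<infinity>k. f k x)) UNIV"
proof -
  have u: "uniform_limit {0..1} (\<lambda>X y. \<Sum>x\<in>X. f x y) (\<lambda>y. \<Sum>\<^sub>\<infinity>x. f x y) (finite_subsets_at_top UNIV)"
    by (rule Weierstrass_m_test_general) (use assms in auto)
  show "continuous_on {0..1} (\<lambda>x. \<Sum>\<^sub>\<infinity>k. f k x)"
    by (rule uniform_limit_theorem[OF _ u]) (auto intro!: always_eventually continuous_intros cont)
  have u': "uniform_limit (cbox 0 1) (\<lambda>X y. \<Sum>x\<in>X. f x y) (\<lambda>y. \<Sum>\<^sub>\<infinity>x. f x y) (finite_subsets_at_top UNIV)"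
    using u by simp
  have c': "continuous_on (cbox 0 1) (\<lambda>y. \<Sum>x\<in>X. f x y)" for X
    unfolding box_real by (intro continuous_on_sum cont)
  obtain I J where IJ: "\<And>X. ((\<lambda>y. \<Sum>x\<in>X. f x y) has_integral I X) (cbox 0 1)"
    "((\<lambda>y. \<Sum>\<^sub>\<infinity>x. f x y) has_integral J) (cbox 0 1)" "(I \<longlongrightarrow> J) (finite_subsets_at_top UNIV)"
    by (rule uniform_limit_integral_cbox[OF u' c' finite_subsets_at_top_neq_bot]) blast
  have "eventually (\<lambda>X. I X = (\<Sum>k\<in>X. integral {0..1} (f k))) (finite_subsets_at_top UNIV)"
  proof (rule eventually_finite_subsets_at_top_weakI)
    fix X :: "'i set" assume "finite X"
    have "((\<lambda>y. \<Sum>x\<in>X. f x y) has_integral (\<Sum>k\<in>X. integral {0..1} (f k))) {0..1}"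
      using \<open>finite X\<close> by (intro has_integral_sum integrable_integral integrable_continuous_interval cont)
    then show "I X = (\<Sum>k\<in>X. integral {0..1} (f k))"
      using IJ(1)[of X] by (auto dest: has_integral_unique)
  qed
  moreover have "J = integral {0..1} (\<lambda>x. \<Sum>\<^sub>\<infinity>k. f k x)" using IJ(2) by (simp add: integral_unique)
  ultimately show "((\<lambda>k. integral {0..1} (f k)) has_sum integral {0..1} (\<lambda>x. \<Sum>\<^sub>\<infinity>k. f k x)) UNIV"
    using IJ(3) unfolding has_sum_def by (auto elim!: Lim_transform_eventually)
qed

lemma summable_on_int_power_abs:
  fixes r :: real assumes "0 \<le> r" "r < 1"
  shows "(\<lambda>k::int. r ^ nat \<bar>k\<bar>) summable_on UNIV"
proof -
  have s: "(\<lambda>n. r ^ n) summable_on UNIV"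
    using assms by (intro norm_summable_imp_summable_on) (simp add: summable_geometric norm_power)
  have i1: "inj_on int UNIV" and i2: "inj_on (\<lambda>n. - int n) UNIV" by (auto simp: inj_on_def)
  have "(\<lambda>k::int. r ^ nat \<bar>k\<bar>) summable_on range int"
    by (subst summable_on_reindex[OF i1]) (use s in \<open>simp add: o_def\<close>)
  moreover have "(\<lambda>k::int. r ^ nat \<bar>k\<bar>) summable_on range (\<lambda>n. - int n)"
    by (subst summable_on_reindex[OF i2]) (use s in \<open>simp add: o_def\<close>)
  ultimately have "(\<lambda>k::int. r ^ nat \<bar>k\<bar>) summable_on (range int \<union> range (\<lambda>n. - int n))"
    by (rule summable_on_union)
  moreover have "range int \<union> range (\<lambda>n. - int n) = UNIV"
  proof (rule UNIV_eq_I[symmetric])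
    fix k :: int
    show "k \<in> range int \<union> range (\<lambda>n. - int n)" by (cases k rule: int_cases2) auto
  qed
  ultimately show ?thesis by simp
qed

text \<open>A majorant that is uniform in x, for the Weierstrass test, and geometric in |k|: for k
  \<noteq> 0 one has (x + k)^2 \<ge> (|k| - 1)^2 \<ge> |k| - 1.\<close>

lemma gauss_term_le:
  fixes x t :: real and k :: int
  assumes t: "t > 0" and x: "x \<in> {0..1}"
  shows "exp (- pi * t * (x + k)\<^sup>2) \<le> exp (pi * t) * exp (- pi * t) ^ nat \<bar>k\<bar>"
proof -
  have "\<bar>real_of_int k\<bar> - 1 \<le> (x + k)\<^sup>2"
  proof (cases "k = 0")
    case False
    then have 1: "0 \<le> \<bar>real_of_int k\<bar> - 1" by linarith
    have "\<bar>real_of_int k\<bar> - 1 \<le> (\<bar>real_of_int k\<bar> - 1)\<^sup>2"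
    proof -
      define j where "j = \<bar>k\<bar> - 1"
      have "j \<ge> 0" using False by (simp add: j_def)
      then have "j \<le> j * j" by (cases "j = 0") (auto simp: mult_le_cancel_left1)
      then have "real_of_int j \<le> real_of_int (j * j)" by (simp only: of_int_le_iff)
      then show ?thesis by (simp add: j_def power2_eq_square)
    qed
    also have "\<dots> \<le> \<bar>x + k\<bar>\<^sup>2" using 1 x by (intro power_mono) auto
    finally show ?thesis by simp
  qed (auto intro: order_trans[of _ 0])
  then have "pi * t * (\<bar>real_of_int k\<bar> - 1) \<le> pi * t * (x + k)\<^sup>2"
    using t by (intro mult_left_mono) auto
  then have "- pi * t * (x + k)\<^sup>2 \<le> pi * t + real (nat \<bar>k\<bar>) * (- pi * t)"
    by (simp add: algebra_simps)
  then have "exp (- pi * t * (x + k)\<^sup>2) \<le> exp (pi * t + real (nat \<bar>k\<bar>) * (- pi * t))" by simp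
  also have "\<dots> = exp (pi * t) * exp (- pi * t) ^ nat \<bar>k\<bar>" by (simp only: exp_add exp_of_nat_mult)
  finally show ?thesis .
qed

lemma summable_gauss_bound:
  "t > 0 \<Longrightarrow> (\<lambda>k::int. exp (pi * t) * exp (- pi * t) ^ nat \<bar>k\<bar>) summable_on UNIV"
  by (intro summable_on_cmult_right summable_on_int_power_abs) auto

text \<open>With c^2 = 2 * pi * t the Gaussian is, up to a constant, the standard normal density at
  c * x, so the transform is the known characteristic function at s = 2 * pi * \<xi> / c.\<close>

lemma gauss_fourier_transform:
  fixes t \<xi> :: real assumes t: "t > 0"
  shows "has_bochner_integral lborel (\<lambda>x. of_real (exp (- pi * t * x\<^sup>2)) * cis (2 * pi * \<xi> * x))
           (complex_of_real (exp (- pi * \<xi>\<^sup>2 / t) / sqrt t))"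
proof -
  define c where "c = sqrt (2 * pi * t)"
  have c: "c > 0" "c\<^sup>2 = 2 * pi * t" using t by (auto simp: c_def)
  define s where "s = 2 * pi * \<xi> / c"
  let ?f = "\<lambda>x. of_real (std_normal_density x) * cis (s * x)"
  have int: "integrable lborel ?f"
  proof (rule Bochner_Integration.integrable_bound[of lborel std_normal_density])
    show "AE x in lborel. norm (?f x) \<le> norm (std_normal_density x)" by (simp add: norm_mult)
    have "?f \<in> borel_measurable borel"
      unfolding normal_density_def by (intro borel_measurable_continuous_onI continuous_intros) auto
    then show "?f \<in> borel_measurable lborel" by simp
  qed simp
  have "char std_normal_distribution s = (LINT x|lborel. ?f x)"
    unfolding char_def
    by (subst integral_density) (auto simp: cis_conv_exp scaleR_conv_of_real)
  then have val: "(LINT x|lborel. ?f x) = of_real (exp (- (s\<^sup>2) / 2))"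
    by (simp add: char_std_normal_distribution)
  have eq: "?f (0 + c * x) = of_real (1 / sqrt (2 * pi)) * (of_real (exp (- pi * t * x\<^sup>2)) * cis (2 * pi * \<xi> * x))" for x
    using c t by (simp add: std_normal_density_def power_mult_distrib s_def mult_ac)
  have int2: "integrable lborel (\<lambda>x. ?f (0 + c * x))"
    using int c by (intro lborel_integrable_real_affine) auto
  have "of_real (exp (- (s\<^sup>2) / 2)) = \<bar>c\<bar> *\<^sub>R (LINT x|lborel. ?f (0 + c * x))"
    unfolding val[symmetric] by (rule lborel_integral_real_affine) (use c in auto)
  also have "\<dots> = of_real c * of_real (1 / sqrt (2 * pi)) * (LINT x|lborel. of_real (exp (- pi * t * x\<^sup>2)) * cis (2 * pi * \<xi> * x))"
    unfolding eq using c by (simp add: scaleR_conv_of_real)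
  also have "of_real c * of_real (1 / sqrt (2 * pi)) = complex_of_real (sqrt t)"
    using t by (simp add: c_def real_sqrt_mult)
  finally have "(LINT x|lborel. of_real (exp (- pi * t * x\<^sup>2)) * cis (2 * pi * \<xi> * x)) = of_real (exp (- (s\<^sup>2) / 2) / sqrt t)"
    using t by (simp add: field_simps)
  moreover have "- (s\<^sup>2) / 2 = - pi * \<xi>\<^sup>2 / t"
    unfolding s_def power_divide c using t by (simp add: power2_eq_square field_simps)
  ultimately have "(LINT x|lborel. of_real (exp (- pi * t * x\<^sup>2)) * cis (2 * pi * \<xi> * x)) = of_real (exp (- pi * \<xi>\<^sup>2 / t) / sqrt t)"
    by simp
  moreover have "integrable lborel (\<lambda>x. of_real (exp (- pi * t * x\<^sup>2)) * cis (2 * pi * \<xi> * x))"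
    using integrable_mult_right[OF int2[unfolded eq], of "of_real (sqrt (2 * pi))"] by (simp add: mult.assoc[symmetric])
  ultimately show ?thesis by (simp add: has_bochner_integral_iff)
qed

lemma integral_cis_int:
  fixes m :: int
  shows "integral {0..1} (\<lambda>x. cis (2 * pi * m * x)) = (if m = 0 then 1 else 0)"
proof (cases "m = 0")
  case False
  define c where "c = \<i> * of_real (2 * pi * m)"
  have c: "c \<noteq> 0" using False by (simp add: c_def)
  define F where "F x = exp (c * of_real x) / c" for x :: real
  have "((\<lambda>x. cis (2 * pi * m * x)) has_integral (F 1 - F 0)) {0..1}"
  proof (rule fundamental_theorem_of_calculus)
    fix x :: real
    have "((\<lambda>z. exp (c * z) / c) has_field_derivative exp (c * of_real x)) (at (of_real x))"
      using c by (auto intro!: derivative_eq_intros)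
    then have "(F has_vector_derivative exp (c * of_real x)) (at x within {0..1})"
      unfolding F_def by (rule has_vector_derivative_real_field)
    moreover have "exp (c * of_real x) = cis (2 * pi * m * x)" by (simp add: c_def cis_conv_exp mult_ac)
    ultimately show "(F has_vector_derivative cis (2 * pi * m * x)) (at x within {0..1})" by simp
  qed simp
  moreover have "F 1 = F 0"
    using cis_multiple_2pi[of "of_int m"] by (simp add: F_def c_def cis_conv_exp mult_ac)
  ultimately show ?thesis using False by (simp add: integral_unique)
qed simp

text \<open>Since \<open>cis (2 * pi * m * x)\<close> has period 1, the Fourier coefficient of the
  periodization unfolds: the translates of [0, 1] tile the line, and the coefficient becomes the
  Fourier transform of the Gaussian at m.\<close>

lemma gauss_periodization_coeff:
  fixes t :: real and m :: int assumes t: "t > 0"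
  shows "integral {0..1} (\<lambda>x. (\<Sum>\<^sub>\<infinity>k::int. complex_of_real (exp (- pi * t * (x + k)\<^sup>2))) * cis (2 * pi * m * x))
     = of_real (exp (- pi * (real_of_int m)\<^sup>2 / t) / sqrt t)"
proof -
  define g where "g x = complex_of_real (exp (- pi * t * x\<^sup>2)) * cis (2 * pi * m * x)" for x
  have gcont: "continuous_on S g" for S unfolding g_def by (intro continuous_intros)
  have per: "g (x + of_int k) = complex_of_real (exp (- pi * t * (x + k)\<^sup>2)) * cis (2 * pi * m * x)" for x and k :: int
  proof -
    have "cis (2 * pi * m * (x + k)) = cis (2 * pi * m * x) * cis (2 * pi * of_int (m * k))"
      by (simp add: cis_mult algebra_simps)
    then show ?thesis unfolding g_def by (simp add: cis_multiple_2pi)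
  qed
  have bd: "norm (g (x + of_int k)) \<le> exp (pi * t) * exp (- pi * t) ^ nat \<bar>k\<bar>" if "x \<in> {0..1}" for x and k :: int
    unfolding per using gauss_term_le[OF t that, of k] by (simp add: norm_mult)
  have 1: "((\<lambda>k::int. integral {0..1} (\<lambda>x. g (x + of_int k))) has_sum integral {0..1} (\<lambda>x. \<Sum>\<^sub>\<infinity>k::int. g (x + of_int k))) UNIV"
    by (rule has_sum_integral_unit_interval(2)[OF _ bd summable_gauss_bound[OF t]])
       (auto intro!: continuous_on_compose2[OF gcont[of UNIV]] continuous_intros)
  have shift: "integral {0..1} (\<lambda>x. g (x + of_int k)) = integral {of_int k..of_int k + 1} g" for k :: int
    using integral_shift_real_ivl[of "of_int k" "of_int k" "of_int k + 1" g] by simp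
  have tele: "(\<Sum>k\<in>{- int n..int n}. integral {of_int k..of_int k + 1} g) = integral {- real n..real n + 1} g" for n
  proof (induction n)
    case (Suc n)
    have set: "{- int (Suc n)..int (Suc n)} =
      insert (- int (Suc n)) (insert (int (Suc n)) {- int n..int n})" by auto
    have int: "g integrable_on {a..b}" for a b by (intro integrable_continuous_interval gcont)
    have "(\<Sum>k\<in>{- int (Suc n)..int (Suc n)}. integral {of_int k..of_int k + 1} g) =
       integral {- real (Suc n)..- real n} g + (integral {real n + 1..real (Suc n) + 1} g + integral {- real n..real n + 1} g)"
      unfolding set using Suc.IH by (simp add: add.commute)
    also have "\<dots> = (integral {- real (Suc n)..- real n} g + integral {- real n..real n + 1} g) + integral {real n + 1..real (Suc n) + 1} g"
      by simp
    also have "integral {- real (Suc n)..- real n} g + integral {- real n..real n + 1} g = integral {- real (Suc n)..real n + 1} g"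
      by (rule Henstock_Kurzweil_Integration.integral_combine[OF _ _ int]) auto
    also have "integral {- real (Suc n)..real n + 1} g + integral {real n + 1..real (Suc n) + 1} g = integral {- real (Suc n)..real (Suc n) + 1} g"
      by (rule Henstock_Kurzweil_Integration.integral_combine[OF _ _ int]) auto
    finally show ?case .
  qed simp
  have bint: "integrable lborel g" "(LINT x|lborel. g x) = of_real (exp (- pi * (real_of_int m)\<^sup>2 / t) / sqrt t)"
    using gauss_fourier_transform[OF t, of m] unfolding g_def has_bochner_integral_iff by auto
  \<comment> \<open>Dominated convergence, with the norm of g itself as majorant, exhausts the line
    by the windows [-n, n+1] that the telescoping sum produces.\<close>
  have 2: "(\<lambda>n. integral {- real n..real n + 1} g) \<longlonglongrightarrow> of_real (exp (- pi * (real_of_int m)\<^sup>2 / t) / sqrt t)"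
  proof -
    have "(\<lambda>n. LINT x|lborel. indicator {- real n..real n + 1} x *\<^sub>R g x) \<longlonglongrightarrow> (LINT x|lborel. g x)"
    proof (rule integral_dominated_convergence[where w = "\<lambda>x. norm (g x)"])
      show "AE x in lborel. (\<lambda>n. indicator {- real n..real n + 1} x *\<^sub>R g x) \<longlonglongrightarrow> g x"
      proof (rule AE_I2)
        fix x :: real
        obtain N :: nat where N: "\<bar>x\<bar> \<le> real N" using real_arch_simple by blast
        have "eventually (\<lambda>n. indicator {- real n..real n + 1} x *\<^sub>R g x = g x) sequentially"
          using eventually_ge_at_top[of N] by eventually_elim (use N in \<open>auto simp: indicator_def\<close>)
        then show "(\<lambda>n. indicator {- real n..real n + 1} x *\<^sub>R g x) \<longlonglongrightarrow> g x"
          by (rule tendsto_eventually)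
      qed
    qed (use bint in \<open>auto simp: indicator_def\<close>)
    moreover have "(LINT x|lborel. indicator {a..b} x *\<^sub>R g x) = integral {a..b} g" for a b
      using set_borel_integral_eq_integral(2)[of "{a..b}" g] bint(1)
      by (simp add: set_lebesgue_integral_def set_integrable_def integrable_mult_indicator)
    ultimately show ?thesis using bint by simp
  qed
  have "integral {0..1} (\<lambda>x. \<Sum>\<^sub>\<infinity>k::int. g (x + of_int k)) = of_real (exp (- pi * (real_of_int m)\<^sup>2 / t) / sqrt t)"
    using has_sum_int_imp_symmetric_LIMSEQ[OF 1] 2 unfolding shift tele by (rule LIMSEQ_unique)
  then show ?thesis unfolding per by (subst (asm) infsum_cmult_left') simp
qed

lemma summable_gauss_coeff:
  fixes t :: real assumes "t > 0"
  shows "(\<lambda>k::int. exp (- pi * (real_of_int k)\<^sup>2 / t)) summable_on UNIV"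
proof (rule summable_on_comparison_test[OF summable_gauss_bound[of "1 / t"]])
  show "exp (- pi * (real_of_int k)\<^sup>2 / t) \<le> exp (pi * (1/t)) * exp (- pi * (1/t)) ^ nat \<bar>k\<bar>" for k
    using gauss_term_le[of "1/t" 0 k] assms by simp
qed (use assms in auto)

text \<open>Both sides are continuous functions of a on [0, 1], so it suffices to compare Fourier
  coefficients: on the left by unfolding, on the right by orthogonality.\<close>

theorem theta_inversion:
  fixes t a :: real assumes t: "t > 0" and a: "a \<in> {0..1}"
  shows "(\<Sum>\<^sub>\<infinity>k::int. complex_of_real (exp (- pi * t * (a + k)\<^sup>2))) =
     (\<Sum>\<^sub>\<infinity>k::int. of_real (exp (- pi * (real_of_int k)\<^sup>2 / t)) * cis (2 * pi * k * a)) / sqrt t"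
proof -
  define G where "G x = (\<Sum>\<^sub>\<infinity>k::int. complex_of_real (exp (- pi * t * (x + k)\<^sup>2)))" for x
  define H where "H x = (\<Sum>\<^sub>\<infinity>k::int. of_real (exp (- pi * (real_of_int k)\<^sup>2 / t)) * cis (2 * pi * k * x))" for x
  have Gc: "continuous_on {0..1} G" unfolding G_def
  proof (rule has_sum_integral_unit_interval(1)[OF _ _ summable_gauss_bound[OF t]])
    fix k :: int and x :: real assume "x \<in> {0..1}"
    from gauss_term_le[OF t this, of k]
    show "norm (complex_of_real (exp (- pi * t * (x + k)\<^sup>2))) \<le> exp (pi * t) * exp (- pi * t) ^ nat \<bar>k\<bar>" by simp
  qed (intro continuous_intros)
  have Hc: "continuous_on {0..1} H" unfolding H_def
    by (rule has_sum_integral_unit_interval(1)[OF _ _ summable_gauss_coeff[OF t]])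
       (auto intro!: continuous_intros simp: norm_mult)
  have Hcoeff: "integral {0..1} (\<lambda>x. H x * cis (2 * pi * m * x)) = of_real (exp (- pi * (real_of_int m)\<^sup>2 / t))" for m :: int
  proof -
    let ?h = "\<lambda>(k::int) x. of_real (exp (- pi * (real_of_int k)\<^sup>2 / t)) * cis (2 * pi * (k + m) * x)"
    have "((\<lambda>k. integral {0..1} (?h k)) has_sum integral {0..1} (\<lambda>x. \<Sum>\<^sub>\<infinity>k. ?h k x)) UNIV"
      by (rule has_sum_integral_unit_interval(2)[OF _ _ summable_gauss_coeff[OF t]])
         (auto intro!: continuous_intros simp: norm_mult)
    \<comment> \<open>Only the frequency k = -m survives, and the Gaussian weight is even in
      k.\<close>
    moreover have "integral {0..1} (?h k) = (if k = - m then of_real (exp (- pi * (real_of_int m)\<^sup>2 / t)) else 0)" for k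
      using integral_cis_int[of "k + m"] by (auto simp: add_eq_0_iff2)
    ultimately have "((\<lambda>k. if k = - m then of_real (exp (- pi * (real_of_int m)\<^sup>2 / t)) else 0) has_sum integral {0..1} (\<lambda>x. \<Sum>\<^sub>\<infinity>k. ?h k x)) UNIV"
      by simp
    moreover have "((\<lambda>k. if k = - m then complex_of_real (exp (- pi * (real_of_int m)\<^sup>2 / t)) else 0) has_sum
        of_real (exp (- pi * (real_of_int m)\<^sup>2 / t))) UNIV"
      by (rule has_sum_finite_neutralI[of "{- m}"]) auto
    ultimately have "integral {0..1} (\<lambda>x. \<Sum>\<^sub>\<infinity>k. ?h k x) = of_real (exp (- pi * (real_of_int m)\<^sup>2 / t))"
      by (rule has_sum_unique)
    moreover have "?h k x = of_real (exp (- pi * (real_of_int k)\<^sup>2 / t)) * cis (2 * pi * k * x) * cis (2 * pi * m * x)" for k x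
      by (simp add: cis_mult algebra_simps)
    ultimately show ?thesis unfolding H_def by (simp only: infsum_cmult_left')
  qed
  have "G a - H a / sqrt t = 0"
  proof (rule fourier_unique[OF _ _ a, of "\<lambda>x. G x - H x / sqrt t"])
    show "continuous_on {0..1} (\<lambda>x. G x - H x / sqrt t)"
      using t by (intro continuous_intros Gc Hc) auto
    fix m :: int
    have "integral {0..1} (\<lambda>x. (G x - H x / sqrt t) * cis (2 * pi * m * x)) =
      integral {0..1} (\<lambda>x. G x * cis (2 * pi * m * x) - (1 / sqrt t) * (H x * cis (2 * pi * m * x)))"
      by (simp add: algebra_simps)
    also have "\<dots> = integral {0..1} (\<lambda>x. G x * cis (2 * pi * m * x)) - integral {0..1} (\<lambda>x. (1 / sqrt t) * (H x * cis (2 * pi * m * x)))"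
      by (intro integral_diff integrable_continuous_interval continuous_intros Gc Hc)
    also have "\<dots> = 0"
      unfolding integral_mult_right Hcoeff using gauss_periodization_coeff[OF t, of m] by (simp add: G_def)
    finally show "integral {0..1} (\<lambda>x. (G x - H x / sqrt t) * cis (2 * pi * m * x)) = 0" .
  qed
  then show ?thesis by (simp add: G_def H_def)
qed

section \<open>Gauss sums\<close>

definition unity_root :: "int \<Rightarrow> int \<Rightarrow> complex" where
  "unity_root c n = cis (2 * pi * (of_int n / of_int c))"

lemma unity_root_0 [simp]: "unity_root c 0 = 1"
  by (simp add: unity_root_def)

lemma unity_root_add: "unity_root c (m + n) = unity_root c m * unity_root c n"
  by (simp add: unity_root_def cis_mult ring_distribs add_divide_distrib)

lemma unity_root_self: "c \<noteq> 0 \<Longrightarrow> unity_root c (c * k) = 1"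
  using cis_multiple_2pi[of "of_int k"] by (simp add: unity_root_def)

lemma unity_root_cong:
  assumes "[m = n] (mod c)" shows "unity_root c m = unity_root c n"
proof (cases "c = 0")
  case False
  obtain k where "m = n + c * k" using assms by (metis cong_iff_lin cong_sym)
  then show ?thesis using False by (simp add: unity_root_add unity_root_self)
qed (use assms in \<open>simp add: cong_def\<close>)

lemma unity_root_mult_cancel: "k \<noteq> 0 \<Longrightarrow> unity_root (k * c) (k * n) = unity_root c n"
  by (simp add: unity_root_def)

lemma norm_unity_root [simp]: "norm (unity_root c n) = 1"
  by (simp add: unity_root_def)

lemma unity_root_mult_of_nat: "unity_root c (n * int k) = unity_root c n ^ k"
  by (induction k) (auto simp: ring_distribs unity_root_add)

lemma unity_root_eq_1_iff:
  assumes "c > 0" shows "unity_root c n = 1 \<longleftrightarrow> c dvd n"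
proof
  assume "unity_root c n = 1"
  then have "cos (2 * pi * (of_int n / of_int c)) = 1"
    by (metis unity_root_def cis.sel(1) one_complex.sel(1))
  then obtain k :: int where "2 * pi * (real_of_int n / of_int c) = of_int k * 2 * pi"
    by (auto simp: cos_one_2pi_int)
  then have "real_of_int n = real_of_int (k * c)" using assms by (simp add: field_simps)
  then have "n = k * c" by (simp only: of_int_eq_iff)
  then show "c dvd n" by simp
next
  assume "c dvd n"
  then show "unity_root c n = 1" using assms by (auto elim!: dvdE simp: unity_root_self)
qed

lemma sum_int_interval_nat: "(\<Sum>x\<in>{0..<int n}. f x) = (\<Sum>k<n. f (int k))"
  by (rule sum.reindex_bij_witness[of _ int nat]) auto

lemma sum_unity_root:
  assumes "c > 0"
  shows "(\<Sum>x\<in>{0..<c}. unity_root c (n * x)) = (if c dvd n then of_int c else 0)"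
proof -
  define w where "w = unity_root c n"
  have "(\<Sum>x\<in>{0..<c}. unity_root c (n * x)) = (\<Sum>k<nat c. w ^ k)"
    using sum_int_interval_nat[of "\<lambda>x. unity_root c (n * x)" "nat c"] assms
    by (simp add: w_def unity_root_mult_of_nat)
  also have "\<dots> = (if w = 1 then of_nat (nat c) else (1 - w ^ nat c) / (1 - w))"
    by (simp add: sum_gp_strict)
  also have "w ^ nat c = 1"
    using assms unity_root_mult_of_nat[of c n "nat c"] unity_root_self[of c n] by (simp add: w_def mult.commute)
  finally show ?thesis using assms unity_root_eq_1_iff[of c n] by (simp add: w_def)
qed

text \<open>A change of variable in a complete residue sum. Injectivity modulo c is enough because
  {0..<c} is finite.\<close>

lemma sum_periodic_bij:
  fixes f :: "int \<Rightarrow> 'a::comm_monoid_add"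
  assumes c: "c > 0" and per: "\<And>x. f (x mod c) = f x"
    and inj: "\<And>x y. [g x = g y] (mod c) \<Longrightarrow> [x = y] (mod c)"
  shows "(\<Sum>x\<in>{0..<c}. f (g x)) = (\<Sum>x\<in>{0..<c}. f x)"
proof -
  have inj': "inj_on (\<lambda>x. g x mod c) {0..<c}"
  proof (rule inj_onI)
    fix x y assume xy: "x \<in> {0..<c}" "y \<in> {0..<c}" and "g x mod c = g y mod c"
    then have "[x = y] (mod c)" using inj[of x y] by (simp only: cong_def)
    then show "x = y" using xy by (simp add: cong_def)
  qed
  have "(\<lambda>x. g x mod c) ` {0..<c} \<subseteq> {0..<c}" using c by auto
  then have "(\<lambda>x. g x mod c) ` {0..<c} = {0..<c}"
    using inj' by (intro card_subset_eq) (auto simp: card_image)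
  then have "(\<Sum>x\<in>{0..<c}. f x) = sum f ((\<lambda>x. g x mod c) ` {0..<c})" by (simp only:)
  also have "\<dots> = (\<Sum>x\<in>{0..<c}. f (g x mod c))"
    by (simp only: sum.reindex[OF inj'] o_def)
  finally show ?thesis by (simp only: per)
qed

definition quad_gauss_sum :: "int \<Rightarrow> int \<Rightarrow> complex" where
  "quad_gauss_sum a c = (\<Sum>x\<in>{0..<c}. unity_root c (a * x\<^sup>2))"

section \<open>The character modulo 12\<close>

text \<open>The Kronecker symbol (12/n): the even primitive real character modulo 12, which carries
  the signs of the eta series.\<close>

definition chi12 :: "int \<Rightarrow> int" where
  "chi12 n = (if n mod 12 = 1 \<or> n mod 12 = 11 then 1
     else if n mod 12 = 5 \<or> n mod 12 = 7 then -1 else 0)"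

lemma chi12_mod [simp]: "chi12 (n mod 12) = chi12 n"
  by (simp add: chi12_def)

lemma chi12_cong: "[m = n] (mod 12) \<Longrightarrow> chi12 m = chi12 n"
  by (simp add: chi12_def cong_def)

lemma int_interval_12: "{0..<12::int} = {0,1,2,3,4,5,6,7,8,9,10,11}"
proof -
  have "{0..<12::int} = set [0..11]" by auto
  also have "\<dots> = {0,1,2,3,4,5,6,7,8,9,10,11}" by (simp add: upto.simps del: set_upto)
  finally show ?thesis .
qed

lemma mod_12_cases:
  fixes n :: int
  obtains "n mod 12 = 0" | "n mod 12 = 1" | "n mod 12 = 2" | "n mod 12 = 3" | "n mod 12 = 4"
    | "n mod 12 = 5" | "n mod 12 = 6" | "n mod 12 = 7" | "n mod 12 = 8" | "n mod 12 = 9"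
    | "n mod 12 = 10" | "n mod 12 = 11"
proof -
  have "n mod 12 \<in> {0..<12}" by simp
  then show ?thesis unfolding int_interval_12 using that by auto
qed

lemma chi12_mult: "chi12 (m * n) = chi12 m * chi12 n"
proof -
  have "chi12 (m * n) = chi12 ((m mod 12) * (n mod 12))"
    by (metis chi12_mod mod_mult_eq)
  also have "\<dots> = chi12 (m mod 12) * chi12 (n mod 12)"
    by (cases m rule: mod_12_cases; cases n rule: mod_12_cases) (simp_all add: chi12_def)
  finally show ?thesis by simp
qed

lemma chi12_minus [simp]: "chi12 (- n) = chi12 n"
  using chi12_mult[of "- 1" n] by (simp add: chi12_def[of "- 1"])

text \<open>An even primitive real character is its own finite Fourier transform up to the square
  root of the modulus, also at m not coprime to 12. This self-duality is why inversion sends eta to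
  eta.\<close>

lemma chi12_fourier: "(\<Sum>y\<in>{0..<12}. of_int (chi12 y) * unity_root 12 (m * y)) = of_int (chi12 m) * sqrt 12"
proof -
  have "(\<Sum>y\<in>{0..<12}. of_int (chi12 y) * unity_root 12 (m * y)) =
     (unity_root 12 (m * 1) + unity_root 12 (m * 11)) - (unity_root 12 (m * 5) + unity_root 12 (m * 7))"
    unfolding int_interval_12 by (simp add: chi12_def)
  also have "unity_root 12 (m * 11) = unity_root 12 (- (m * 1))"
    by (rule unity_root_cong) (simp add: cong_iff_dvd_diff)
  also have "unity_root 12 (m * 7) = unity_root 12 (- (m * 5))"
    by (rule unity_root_cong) (simp add: cong_iff_dvd_diff)
  also have "unity_root 12 (m * 1) + unity_root 12 (- (m * 1)) = of_real (2 * cos (2 * pi * (m / 12)))"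
    by (simp add: unity_root_def complex_eq_iff)
  also have "unity_root 12 (m * 5) + unity_root 12 (- (m * 5)) = of_real (2 * cos (2 * pi * (5 * m / 12)))"
    by (simp add: unity_root_def complex_eq_iff mult.commute)
  also have "of_real (2 * cos (2 * pi * (m / 12))) - of_real (2 * cos (2 * pi * (5 * m / 12))) =
      complex_of_real (4 * sin (pi * m / 2) * sin (pi * m / 3))"
    using cos_diff_cos[of "2 * pi * (m / 12)" "2 * pi * (5 * m / 12)"] by (simp add: field_simps)
  \<comment> \<open>Both sides have period 12 in m. The values at r = 0..11 come from half periods:
    sin (pi * x / 2) changes sign under x + 2, and sin (pi * x / 3) under x + 3.\<close>
  also have "4 * sin (pi * m / 2) * sin (pi * m / 3) = of_int (chi12 m) * sqrt 12"
  proof -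
    have s12: "sqrt 12 = 2 * sqrt 3"
      using real_sqrt_mult[of 4 3] by simp
    define r where "r = m mod 12"
    define k where "k = m div 12"
    have m: "real_of_int m = of_int r + 12 * of_int k"
    proof -
      have "m = r + 12 * k" by (simp add: r_def k_def)
      then have "real_of_int m = real_of_int (r + 12 * k)" by (rule arg_cong)
      then show ?thesis by simp
    qed
    have "sin (pi * m / 2) = sin (pi * r / 2 + 2 * pi * of_int (3 * k))"
      "sin (pi * m / 3) = sin (pi * r / 3 + 2 * pi * of_int (2 * k))"
      unfolding m by (simp_all add: field_simps)
    then have *: "sin (pi * m / 2) = sin (pi * r / 2)" "sin (pi * m / 3) = sin (pi * r / 3)"
      by (simp_all only: sin_add sin_int_2pin cos_int_2pin mult_1_right mult_zero_right add_0_right)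
    define s2 where "s2 x = sin (pi * x / 2)" for x :: real
    define s3 where "s3 x = sin (pi * x / 3)" for x :: real
    have step2: "s2 (x + 2) = - s2 x" for x
      using sin_periodic_pi[of "pi * x / 2"] by (simp add: s2_def ring_distribs add_divide_distrib)
    have step3: "s3 (x + 3) = - s3 x" for x
      using sin_periodic_pi[of "pi * x / 3"] by (simp add: s3_def ring_distribs add_divide_distrib)
    have base: "s2 0 = 0" "s2 1 = 1" "s3 0 = 0" "s3 1 = sqrt 3 / 2" "s3 2 = sqrt 3 / 2"
      using sin_60 sin_pi_minus[of "pi / 3"] by (simp_all add: s2_def s3_def field_simps)
    have "s2 2 = 0" "s2 3 = -1" using step2[of 0] step2[of 1] base by simp_all
    moreover from this have "s2 4 = 0" "s2 5 = 1" using step2[of 2] step2[of 3] by simp_all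
    moreover from this have "s2 6 = 0" "s2 7 = -1" using step2[of 4] step2[of 5] by simp_all
    moreover from this have "s2 8 = 0" "s2 9 = 1" using step2[of 6] step2[of 7] by simp_all
    moreover from this have "s2 10 = 0" "s2 11 = -1" using step2[of 8] step2[of 9] by simp_all
    moreover have "s3 3 = 0" "s3 4 = - (sqrt 3 / 2)" "s3 5 = - (sqrt 3 / 2)"
      using step3[of 0] step3[of 1] step3[of 2] base by simp_all
    moreover from this have "s3 6 = 0" "s3 7 = sqrt 3 / 2" "s3 8 = sqrt 3 / 2"
      using step3[of 3] step3[of 4] step3[of 5] by simp_all
    moreover from this have "s3 9 = 0" "s3 10 = - (sqrt 3 / 2)" "s3 11 = - (sqrt 3 / 2)"
      using step3[of 6] step3[of 7] step3[of 8] by simp_all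
    ultimately have "4 * s2 r * s3 r = of_int (chi12 r) * sqrt 12"
      unfolding s12 r_def using base by (cases m rule: mod_12_cases) (simp_all add: chi12_def)
    then have "4 * sin (pi * r / 2) * sin (pi * r / 3) = of_int (chi12 r) * sqrt 12"
      by (simp add: s2_def s3_def)
    then show ?thesis by (simp add: * r_def)
  qed
  finally show ?thesis by simp
qed

text \<open>Here 576 = 4 * 144, so b' is minus the inverse of four times the leading coefficient,
  and completing the square leaves the phase b' * m^2. The leading coefficient 144 * b arises from r
  = 12 * x + c * y in \<open>chi12_gauss_fourier\<close>.\<close>

lemma quad_gauss_complete_square:
  assumes c: "c > 0" and inv: "[576 * b * b' = - 1] (mod c)"
  shows "(\<Sum>x\<in>{0..<c}. unity_root c (144 * b * x\<^sup>2 + m * x)) = unity_root c (b' * m\<^sup>2) * quad_gauss_sum (144 * b) c"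
proof -
  \<comment> \<open>The solution of 288 * b * h = m modulo c.\<close>
  define h where "h = - 2 * b' * m"
  obtain k where k: "576 * b * b' = - 1 + c * k" using inv by (metis cong_iff_lin cong_sym)
  have "unity_root c (144 * b * x\<^sup>2 + m * x) = unity_root c (b' * m\<^sup>2) * unity_root c (144 * b * (x + h)\<^sup>2)" for x
  proof -
    have "144 * b * x\<^sup>2 + m * x - (b' * m\<^sup>2 + 144 * b * (x + h)\<^sup>2) =
        m * x * (1 + 576 * b * b') - b' * m\<^sup>2 * (1 + 576 * b * b')"
      unfolding h_def by (simp add: power2_eq_square algebra_simps)
    also have "\<dots> = c * (k * (m * x - b' * m\<^sup>2))"
      unfolding k by (simp add: algebra_simps)
    finally have "[144 * b * x\<^sup>2 + m * x = b' * m\<^sup>2 + 144 * b * (x + h)\<^sup>2] (mod c)"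
      by (simp add: cong_iff_dvd_diff)
    then show ?thesis by (metis unity_root_cong unity_root_add)
  qed
  then have "(\<Sum>x\<in>{0..<c}. unity_root c (144 * b * x\<^sup>2 + m * x)) =
     unity_root c (b' * m\<^sup>2) * (\<Sum>x\<in>{0..<c}. unity_root c (144 * b * (x + h)\<^sup>2))"
    by (simp add: sum_distrib_left)
  also have "(\<Sum>x\<in>{0..<c}. unity_root c (144 * b * (x + h)\<^sup>2)) = quad_gauss_sum (144 * b) c"
    unfolding quad_gauss_sum_def
  proof (rule sum_periodic_bij[OF c, of "\<lambda>x. unity_root c (144 * b * x\<^sup>2)"])
    show "unity_root c (144 * b * (x mod c)\<^sup>2) = unity_root c (144 * b * x\<^sup>2)" for x
      by (intro unity_root_cong cong_mult cong_pow) auto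
  qed (simp add: cong_add_rcancel)
  finally show ?thesis .
qed

text \<open>The Chinese remainder substitution r = 12 * x + c * y separates the sum into a quadratic
  sum modulo c and a Fourier sum of chi12. The outcome has the shape of the original coefficient
  with b replaced by b', which makes the eta transformation close up.\<close>

lemma chi12_gauss_fourier:
  assumes c: "c > 0" "coprime c 12" and inv: "[576 * b * b' = - 1] (mod c)"
  shows "(\<Sum>r\<in>{0..<12 * c}. of_int (chi12 r) * unity_root c (b * r\<^sup>2) * unity_root (12 * c) (m * r)) =
    of_int (chi12 c) * quad_gauss_sum (144 * b) c * sqrt 12 * (of_int (chi12 m) * unity_root c (b' * m\<^sup>2))"
proof -
  define f where "f r = of_int (chi12 r) * unity_root c (b * r\<^sup>2) * unity_root (12 * c) (m * r)" for r
  have per: "f (r mod (12 * c)) = f r" for r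
  proof -
    have "[r mod (12 * c) = r] (mod 12 * c)" by simp
    then have 1: "[r mod (12 * c) = r] (mod 12)" "[r mod (12 * c) = r] (mod c)"
      by (rule cong_dvd_modulus; simp)+
    show ?thesis unfolding f_def
      by (intro arg_cong2[of _ _ _ _ "(*)"] arg_cong[of _ _ of_int] chi12_cong unity_root_cong
          cong_mult cong_pow 1 cong_refl) simp
  qed
  define g where "g = (\<lambda>(x, y). (12 * x + c * y) mod (12 * c))"
  have inj: "inj_on g ({0..<c} \<times> {0..<12})"
  proof (rule inj_onI, clarify)
    fix x y x' y' assume xy: "x \<in> {0..<c}" "y \<in> {0..<12::int}" "x' \<in> {0..<c}" "y' \<in> {0..<12::int}"
      and "g (x, y) = g (x', y')"
    then have e: "[12 * x + c * y = 12 * x' + c * y'] (mod 12 * c)" by (simp add: g_def cong_def)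
    then have "[12 * x + c * y = 12 * x' + c * y'] (mod c)" by (rule cong_dvd_modulus) simp
    then have "[12 * x = 12 * x'] (mod c)" by (simp add: cong_def)
    then have "[x = x'] (mod c)" using c cong_mult_lcancel[of 12 c x x'] by (simp add: coprime_commute)
    then have x: "x = x'" using xy by (simp add: cong_def)
    from e have "[12 * x + c * y = 12 * x' + c * y'] (mod 12)" by (rule cong_dvd_modulus) simp
    then have "[c * y = c * y'] (mod 12)" by (simp add: cong_def)
    then have "[y = y'] (mod 12)" using c cong_mult_lcancel[of c 12 y y'] by simp
    then have "y = y'" using xy by (simp add: cong_def)
    with x show "x = x' \<and> y = y'" by simp
  qed
  have "g ` ({0..<c} \<times> {0..<12}) \<subseteq> {0..<12 * c}" using c by (auto simp: g_def)
  then have img: "g ` ({0..<c} \<times> {0..<12}) = {0..<12 * c}"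
    using c by (intro card_subset_eq) (auto simp: card_image[OF inj] nat_mult_distrib)
  have "(\<Sum>r\<in>{0..<12 * c}. f r) = (\<Sum>(x, y)\<in>{0..<c} \<times> {0..<12}. f (12 * x + c * y))"
    unfolding img[symmetric] using per by (subst sum.reindex[OF inj]) (auto simp: g_def intro!: sum.cong)
  also have "\<dots> = (\<Sum>(x, y)\<in>{0..<c} \<times> {0..<12}.
     unity_root c (144 * b * x\<^sup>2 + m * x) * (of_int (chi12 c) * (of_int (chi12 y) * unity_root 12 (m * y))))"
  proof (intro sum.cong refl, clarify)
    fix x y
    have "chi12 (12 * x + c * y) = chi12 c * chi12 y"
      unfolding chi12_mult[symmetric] by (rule chi12_cong) (simp add: cong_def)
    moreover have "unity_root c (b * (12 * x + c * y)\<^sup>2) = unity_root c (144 * b * x\<^sup>2)"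
    proof (rule unity_root_cong)
      have "[b * (12 * x + c * y)\<^sup>2 = b * (12 * x + 0)\<^sup>2] (mod c)"
        by (intro cong_mult cong_pow cong_add cong_refl) (simp add: cong_def)
      then show "[b * (12 * x + c * y)\<^sup>2 = 144 * b * x\<^sup>2] (mod c)"
        by (simp add: power_mult_distrib mult_ac)
    qed
    moreover have "unity_root (12 * c) (m * (12 * x + c * y)) = unity_root c (m * x) * unity_root 12 (m * y)"
      using unity_root_mult_cancel[of 12 c "m * x"] unity_root_mult_cancel[of c 12 "m * y"] c
      by (simp add: unity_root_add ring_distribs mult_ac)
    ultimately show "f (12 * x + c * y) = unity_root c (144 * b * x\<^sup>2 + m * x) * (of_int (chi12 c) * (of_int (chi12 y) * unity_root 12 (m * y)))"
      unfolding f_def by (simp add: unity_root_add mult_ac)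
  qed
  also have "\<dots> = (\<Sum>x\<in>{0..<c}. unity_root c (144 * b * x\<^sup>2 + m * x)) * (of_int (chi12 c) * (\<Sum>y\<in>{0..<12}. of_int (chi12 y) * unity_root 12 (m * y)))"
    by (simp only: sum_distrib_left[of "of_int (chi12 c)"] sum_product sum.cartesian_product)
  also have "\<dots> = of_int (chi12 c) * quad_gauss_sum (144 * b) c * sqrt 12 * (of_int (chi12 m) * unity_root c (b' * m\<^sup>2))"
    unfolding chi12_fourier quad_gauss_complete_square[OF c(1) inv] by (simp add: mult_ac)
  finally show ?thesis by (simp add: f_def)
qed

text \<open>For x = u + p * v the square is u^2 + 2 p u v modulo p^2, so the sum over v is a
  complete sum of p-th roots of unity that kills every u \<noteq> 0.\<close>

lemma quad_gauss_sum_prime_square: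
  assumes p: "prime p" "p > 2" and a: "\<not> p dvd a"
  shows "quad_gauss_sum a (p\<^sup>2) = of_int p"
proof -
  have p0: "p > 0" using p by simp
  define g where "g = (\<lambda>(u, v). u + p * v)"
  have inj: "inj_on g ({0..<p} \<times> {0..<p})"
  proof (rule inj_onI, clarify)
    fix u v u' v' assume u: "u \<in> {0..<p}" "u' \<in> {0..<p}" and "g (u, v) = g (u', v')"
    then have e: "u + p * v = u' + p * v'" by (simp add: g_def)
    then have "(u + p * v) mod p = (u' + p * v') mod p" by simp
    then have "u = u'" using u by simp
    with e p0 show "u = u' \<and> v = v'" by simp
  qed
  have "g ` ({0..<p} \<times> {0..<p}) \<subseteq> {0..<p\<^sup>2}"
  proof (clarify)
    fix u v assume uv: "u \<in> {0..<p}" "v \<in> {0..<p}"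
    then have "u + p * v < p + p * (p - 1)" using p0 by (intro add_less_le_mono mult_left_mono) auto
    then show "g (u, v) \<in> {0..<p\<^sup>2}" using uv p0 by (simp add: g_def power2_eq_square algebra_simps)
  qed
  then have img: "g ` ({0..<p} \<times> {0..<p}) = {0..<p\<^sup>2}"
    using p0 by (intro card_subset_eq) (auto simp: card_image[OF inj] nat_mult_distrib power2_eq_square)
  have "quad_gauss_sum a (p\<^sup>2) = (\<Sum>(u, v)\<in>{0..<p} \<times> {0..<p}. unity_root (p\<^sup>2) (a * (u + p * v)\<^sup>2))"
    unfolding quad_gauss_sum_def img[symmetric]
    by (subst sum.reindex[OF inj]) (auto simp: g_def intro!: sum.cong)
  also have "\<dots> = (\<Sum>u\<in>{0..<p}. unity_root (p\<^sup>2) (a * u\<^sup>2) * (\<Sum>v\<in>{0..<p}. unity_root p ((2 * a * u) * v)))"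
    unfolding sum_distrib_left sum.cartesian_product[symmetric]
  proof (intro sum.cong refl)
    fix u v
    have "a * (u + p * v)\<^sup>2 - (a * u\<^sup>2 + p * ((2 * a * u) * v)) = p\<^sup>2 * (a * v\<^sup>2)"
      by (simp add: power2_eq_square algebra_simps)
    then have "[a * (u + p * v)\<^sup>2 = a * u\<^sup>2 + p * ((2 * a * u) * v)] (mod p\<^sup>2)"
      by (simp add: cong_iff_dvd_diff)
    then have "unity_root (p\<^sup>2) (a * (u + p * v)\<^sup>2) = unity_root (p\<^sup>2) (a * u\<^sup>2) * unity_root (p\<^sup>2) (p * ((2 * a * u) * v))"
      by (metis unity_root_cong unity_root_add)
    also have "unity_root (p\<^sup>2) (p * ((2 * a * u) * v)) = unity_root p ((2 * a * u) * v)"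
      unfolding power2_eq_square by (rule unity_root_mult_cancel) (use p0 in simp)
    finally show "unity_root (p\<^sup>2) (a * (u + p * v)\<^sup>2) = unity_root (p\<^sup>2) (a * u\<^sup>2) * unity_root p ((2 * a * u) * v)" .
  qed
  also have "\<dots> = (\<Sum>u\<in>{0..<p}. if u = 0 then of_int p else 0)"
  proof (intro sum.cong refl)
    fix u assume u: "u \<in> {0..<p}"
    have "p dvd 2 * a * u \<longleftrightarrow> u = 0"
    proof
      assume "p dvd 2 * a * u"
      moreover have "\<not> p dvd 2" using p by (auto dest: zdvd_imp_le)
      ultimately have "p dvd u" using a p(1) by (simp add: prime_dvd_mult_iff)
      then show "u = 0" using u by (auto dest: zdvd_imp_le)
    qed simp
    then show "unity_root (p\<^sup>2) (a * u\<^sup>2) * (\<Sum>v\<in>{0..<p}. unity_root p ((2 * a * u) * v)) = (if u = 0 then of_int p else 0)"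
      using sum_unity_root[OF p0, of "2 * a * u"] by auto
  qed
  also have "\<dots> = of_int p" using p0 by simp
  finally show ?thesis .
qed

section \<open>The Legendre symbol and the Gauss sum of an odd prime\<close>

context
  fixes p :: int
  assumes p: "prime p" "p > 2"
begin

lemma Legendre_cong: "[a = b] (mod p) \<Longrightarrow> Legendre a p = Legendre b p"
  by (simp add: Legendre_def QuadRes_def cong_def)

lemma Legendre_eq_0_iff: "Legendre a p = 0 \<longleftrightarrow> p dvd a"
  by (simp add: Legendre_def cong_0_iff)

text \<open>Euler's criterion gives the equation modulo p; both sides lie in {-1, 0, 1}, so their
  difference is at most 2 < p in absolute value.\<close>

lemma Legendre_mult: "Legendre (a * b) p = Legendre a p * Legendre b p"
proof -
  define q where "q = nat p"
  have q: "prime q" "2 < q" "int q = p" using p by (auto simp: q_def)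
  have "[Legendre (a * b) p = (a * b) ^ ((q - 1) div 2)] (mod p)"
    using euler_criterion[OF q(1,2)] q by simp
  moreover have "[Legendre a p * Legendre b p = (a * b) ^ ((q - 1) div 2)] (mod p)"
    unfolding power_mult_distrib using euler_criterion[OF q(1,2)] q by (intro cong_mult) auto
  ultimately have "[Legendre (a * b) p = Legendre a p * Legendre b p] (mod p)"
    by (metis cong_sym cong_trans)
  then have dvd: "p dvd Legendre (a * b) p - Legendre a p * Legendre b p"
    by (simp add: cong_iff_dvd_diff)
  have "\<bar>Legendre (a * b) p - Legendre a p * Legendre b p\<bar> \<le> 2"
    by (auto simp: Legendre_def)
  then have "\<not> (\<bar>p\<bar> \<le> \<bar>Legendre (a * b) p - Legendre a p * Legendre b p\<bar>)" using p by linarith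
  then have "Legendre (a * b) p - Legendre a p * Legendre b p = 0"
    using dvd dvd_imp_le_int by blast
  then show ?thesis by simp
qed

lemma Legendre_square: "\<not> p dvd a \<Longrightarrow> Legendre (a\<^sup>2) p = 1"
proof -
  assume a: "\<not> p dvd a"
  then have "\<not> p dvd a\<^sup>2" using p by (simp add: prime_dvd_power_iff)
  then show ?thesis by (auto simp: Legendre_def cong_0_iff QuadRes_def intro!: exI[of _ a])
qed

lemma Legendre_mult_self: "\<not> p dvd a \<Longrightarrow> Legendre a p * Legendre a p = 1"
  using Legendre_square[of a] Legendre_mult[of a a] by (simp add: power2_eq_square)

lemma card_square_roots:
  "int (card {x\<in>{0..<p}. [x\<^sup>2 = u] (mod p)}) = 1 + Legendre u p"
proof -
  have p0: "p > 0" using p by simp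
  consider "p dvd u" | "\<not> p dvd u" "\<not> QuadRes p u" | y where "\<not> p dvd u" "[y\<^sup>2 = u] (mod p)"
    by (auto simp: QuadRes_def)
  then show ?thesis
  proof cases
    case 1
    then have "[x\<^sup>2 = u] (mod p) \<longleftrightarrow> p dvd x" for x
      using p by (metis cong_dvd_iff prime_dvd_power_iff pos2 cong_0_iff cong_sym cong_trans)
    moreover have "p dvd x \<longleftrightarrow> x = 0" if "x \<in> {0..<p}" for x
      using that by (auto dest: zdvd_imp_le)
    ultimately have "{x\<in>{0..<p}. [x\<^sup>2 = u] (mod p)} = {0}" using p0 by auto
    then show ?thesis using 1 by (simp add: Legendre_eq_0_iff[THEN iffD2])
  next
    case 2
    then have "{x\<in>{0..<p}. [x\<^sup>2 = u] (mod p)} = {}" by (auto simp: QuadRes_def)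
    then show ?thesis using 2 by (simp only: card.empty) (auto simp: Legendre_def cong_0_iff)
  next
    case 3
    define s where "s = y mod p"
    have s: "s \<in> {0..<p}" using p0 by (simp add: s_def)
    have "[s\<^sup>2 = y\<^sup>2] (mod p)" unfolding s_def by (intro cong_pow) simp
    then have su: "[s\<^sup>2 = u] (mod p)" using 3 by (metis cong_trans)
    have ndvd: "\<not> p dvd s"
    proof
      assume "p dvd s"
      then have "p dvd s\<^sup>2" by (simp add: power2_eq_square)
      then show False using 3 su by (metis cong_dvd_iff)
    qed
    then have s0: "s \<noteq> 0" by auto
    have "{x\<in>{0..<p}. [x\<^sup>2 = u] (mod p)} = {s, p - s}"
    proof (intro equalityI subsetI)
      fix x assume "x \<in> {x\<in>{0..<p}. [x\<^sup>2 = u] (mod p)}"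
      then have x: "0 \<le> x" "x < p" and "[x\<^sup>2 = s\<^sup>2] (mod p)" using su by (auto intro: cong_trans cong_sym)
      then have "p dvd (x - s) * (x + s)"
        by (simp add: cong_iff_dvd_diff power2_eq_square algebra_simps)
      then consider "p dvd x - s" | "p dvd x + s" using p by (metis prime_dvd_mult_iff)
      then show "x \<in> {s, p - s}"
      proof cases
        case 1
        then have "[x = s] (mod p)" by (simp add: cong_iff_dvd_diff)
        then show ?thesis using x s by (simp add: cong_def)
      next
        case 2
        then have "[x = p - s] (mod p)" by (metis cong_iff_dvd_diff diff_diff_eq2 dvd_diff dvd_refl)
        then have "x = p - s" using x s s0 by (intro cong_less_imp_eq_int) auto
        then show ?thesis by simp
      qed
    next
      fix x assume x: "x \<in> {s, p - s}"
      have "(p - s)\<^sup>2 - s\<^sup>2 = p * (p - 2 * s)" by (simp add: power2_eq_square algebra_simps)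
      then have "[(p - s)\<^sup>2 = s\<^sup>2] (mod p)" by (simp add: cong_iff_dvd_diff)
      then show "x \<in> {x\<in>{0..<p}. [x\<^sup>2 = u] (mod p)}" using x s s0 su by (auto intro: cong_trans)
    qed
    moreover have "s \<noteq> p - s"
    proof
      assume "s = p - s"
      then have "p dvd 2 * s" by (metis diff_add_cancel dvd_refl mult_2)
      moreover have "\<not> p dvd 2" using p by (auto dest: zdvd_imp_le)
      ultimately show False using ndvd p by (metis prime_dvd_mult_iff)
    qed
    moreover have "Legendre u p = 1" using 3 by (auto simp: Legendre_def cong_0_iff QuadRes_def)
    ultimately show ?thesis by simp
  qed
qed

text \<open>Group the x by x^2 mod p: the fibre over u is counted by
  \<open>card_square_roots\<close>.\<close>

lemma sum_squares_Legendre: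
  fixes f :: "int \<Rightarrow> complex"
  assumes per: "\<And>x. f (x mod p) = f x"
  shows "(\<Sum>x\<in>{0..<p}. f (x\<^sup>2)) = (\<Sum>u\<in>{0..<p}. (1 + of_int (Legendre u p)) * f u)"
proof -
  have p0: "p > 0" using p by simp
  have "(\<Sum>x\<in>{0..<p}. f (x\<^sup>2)) = (\<Sum>x\<in>{0..<p}. f (x\<^sup>2 mod p))" by (simp add: per)
  also have "\<dots> = (\<Sum>u\<in>{0..<p}. \<Sum>x\<in>{x\<in>{0..<p}. x\<^sup>2 mod p = u}. f (x\<^sup>2 mod p))"
    using p0 by (intro sum.group[symmetric]) auto
  also have "\<dots> = (\<Sum>u\<in>{0..<p}. (1 + of_int (Legendre u p)) * f u)"
  proof (intro sum.cong refl)
    fix u assume u: "u \<in> {0..<p}"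
    then have eq: "{x\<in>{0..<p}. x\<^sup>2 mod p = u} = {x\<in>{0..<p}. [x\<^sup>2 = u] (mod p)}"
      by (auto simp: cong_def)
    have "(\<Sum>x\<in>{x\<in>{0..<p}. x\<^sup>2 mod p = u}. f (x\<^sup>2 mod p)) = of_nat (card {x\<in>{0..<p}. x\<^sup>2 mod p = u}) * f u"
      by simp
    also have "of_nat (card {x\<in>{0..<p}. x\<^sup>2 mod p = u}) = (of_int (1 + Legendre u p) :: complex)"
      unfolding eq card_square_roots[symmetric] by simp
    finally show "(\<Sum>x\<in>{x\<in>{0..<p}. x\<^sup>2 mod p = u}. f (x\<^sup>2 mod p)) = (1 + of_int (Legendre u p)) * f u" by simp
  qed
  finally show ?thesis .
qed

lemma sum_Legendre: "(\<Sum>u\<in>{0..<p}. complex_of_int (Legendre u p)) = 0"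
  using sum_squares_Legendre[of "\<lambda>_. 1"] by (simp add: sum.distrib)

definition gauss_sum :: complex where
  "gauss_sum = (\<Sum>u\<in>{0..<p}. of_int (Legendre u p) * unity_root p u)"

text \<open>For a coprime to p substitute u -> a u; for p dividing a both sides vanish. This
  extracts (e/p) from the additive twists in the middle term of the Hecke operator.\<close>

lemma gauss_sum_twist: "(\<Sum>u\<in>{0..<p}. of_int (Legendre u p) * unity_root p (a * u)) = of_int (Legendre a p) * gauss_sum"
proof (cases "p dvd a")
  case True
  then have "unity_root p (a * u) = 1" for u using p unity_root_eq_1_iff[of p "a * u"] by auto
  then show ?thesis using sum_Legendre Legendre_eq_0_iff[of a] True by simp
next
  case False
  have p0: "p > 0" using p by simp
  have cop: "coprime a p" using False p by (metis coprime_commute prime_imp_coprime)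
  have "gauss_sum = (\<Sum>u\<in>{0..<p}. of_int (Legendre (a * u) p) * unity_root p (a * u))"
    unfolding gauss_sum_def
    by (rule sum_periodic_bij[OF p0, of "\<lambda>x. of_int (Legendre x p) * unity_root p x" "\<lambda>x. a * x", symmetric])
       (use cop in \<open>auto intro!: arg_cong2[of _ _ _ _ "(*)"] arg_cong[of _ _ of_int] Legendre_cong unity_root_cong simp: cong_mult_lcancel\<close>)
  also have "\<dots> = of_int (Legendre a p) * (\<Sum>u\<in>{0..<p}. of_int (Legendre u p) * unity_root p (a * u))"
    by (simp add: Legendre_mult sum_distrib_left mult_ac)
  finally have "of_int (Legendre a p) * gauss_sum = of_int (Legendre a p * Legendre a p) * (\<Sum>u\<in>{0..<p}. of_int (Legendre u p) * unity_root p (a * u))"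
    by (simp add: mult_ac)
  then show ?thesis using Legendre_mult_self[OF False] by simp
qed

lemma quad_gauss_sum_prime:
  assumes "\<not> p dvd a" shows "quad_gauss_sum a p = of_int (Legendre a p) * gauss_sum"
proof -
  have p0: "p > 0" using p by simp
  have "quad_gauss_sum a p = (\<Sum>u\<in>{0..<p}. (1 + of_int (Legendre u p)) * unity_root p (a * u))"
    unfolding quad_gauss_sum_def
    by (rule sum_squares_Legendre[of "\<lambda>x. unity_root p (a * x)"]) (intro unity_root_cong cong_mult, auto)
  also have "\<dots> = of_int (Legendre a p) * gauss_sum"
    using sum_unity_root[OF p0, of a] assms gauss_sum_twist[of a] by (simp add: ring_distribs sum.distrib)
  finally show ?thesis .
qed

text \<open>Absorbing one factor into \<open>gauss_sum_twist\<close> and summing over x first leaves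
  only y = p - 1. The relation later serves as (-1/p) g = p / g, matching a Gauss sum from the eta
  multiplier with the 1 / g in \<open>hecke\<close>.\<close>

lemma gauss_sum_squared: "gauss_sum\<^sup>2 = of_int (Legendre (-1) p * p)"
proof -
  have p0: "p > 0" using p by simp
  have "gauss_sum\<^sup>2 = (\<Sum>x\<in>{0..<p}. unity_root p x * (of_int (Legendre x p) * gauss_sum))"
    unfolding power2_eq_square by (subst gauss_sum_def) (simp add: sum_distrib_left mult_ac)
  also have "\<dots> = (\<Sum>x\<in>{0..<p}. \<Sum>y\<in>{0..<p}. of_int (Legendre y p) * unity_root p ((1 + y) * x))"
    unfolding gauss_sum_twist[symmetric] sum_distrib_left
    by (intro sum.cong refl) (simp add: ring_distribs unity_root_add mult_ac)
  also have "\<dots> = (\<Sum>y\<in>{0..<p}. of_int (Legendre y p) * (\<Sum>x\<in>{0..<p}. unity_root p ((1 + y) * x)))"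
    unfolding sum_distrib_left by (rule sum.swap)
  also have "\<dots> = (\<Sum>y\<in>{0..<p}. if y = p - 1 then of_int (Legendre (-1) p * p) else 0)"
  proof (intro sum.cong refl)
    fix y assume y: "y \<in> {0..<p}"
    have "p dvd 1 + y \<longleftrightarrow> y = p - 1" using y by (auto dest: zdvd_imp_le)
    moreover have "Legendre (p - 1) p = Legendre (-1) p"
      by (rule Legendre_cong) (simp add: cong_iff_dvd_diff)
    ultimately show "of_int (Legendre y p) * (\<Sum>x\<in>{0..<p}. unity_root p ((1 + y) * x)) = (if y = p - 1 then of_int (Legendre (-1) p * p) else 0)"
      using sum_unity_root[OF p0, of "1 + y"] by auto
  qed
  also have "\<dots> = of_int (Legendre (-1) p * p)" using p0 by simp
  finally show ?thesis .
qed

end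

text \<open>Quadratic reciprocity with 3: the symbol depends on p modulo 3 and on the parity of (p -
  1) / 2, hence on p modulo 12. It lets chi12 p in the eta multiplier combine with the other
  Legendre symbols.\<close>

lemma Legendre_3_eq_chi12:
  assumes "prime p" "p > 3"
  shows "Legendre 3 (int p) = chi12 (int p)"
proof -
  have "prime (3::nat)" by (rule prime_nat_iff'[THEN iffD2]) (auto simp: atLeastLessThan_nat_numeral)
  have rec: "Legendre 3 (int p) * Legendre (int p) 3 = (-1) ^ ((p - 1) div 2)"
    using Quadratic_Reciprocity[of 3 p] assms \<open>prime (3::nat)\<close> by simp
  have nd: "\<not> 2 dvd p" "\<not> 3 dvd p"
    using assms primes_dvd_imp_eq[of 2 p] primes_dvd_imp_eq[of 3 p] \<open>prime (3::nat)\<close> by auto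
  have L1: "Legendre (int p) 3 = 1" if "p mod 3 = 1"
  proof -
    have "[int p = 1] (mod 3)" using that by (simp add: cong_def) presburger
    then have "Legendre (int p) 3 = Legendre 1 3"
      by (intro Legendre_cong) auto
    also have "Legendre 1 3 = 1" by (auto simp: Legendre_def cong_def QuadRes_def intro: exI[of _ 1])
    finally show ?thesis .
  qed
  have L2: "Legendre (int p) 3 = -1" if "p mod 3 = 2"
  proof -
    have "[int p = 2] (mod 3)" using that by (simp add: cong_def) presburger
    then have "Legendre (int p) 3 = Legendre 2 3"
      by (intro Legendre_cong) auto
    also have "Legendre 2 3 = -1"
    proof -
      have "\<not> [y\<^sup>2 = 2] (mod 3)" for y :: int
      proof -
        have "y mod 3 = 0 \<or> y mod 3 = 1 \<or> y mod 3 = 2" by presburger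
        then have "y\<^sup>2 mod 3 \<noteq> 2" using power_mod[of y 3 2] by auto
        then show ?thesis by (simp add: cong_def)
      qed
      then show ?thesis by (auto simp: Legendre_def cong_def QuadRes_def)
    qed
    finally show ?thesis .
  qed
  \<comment> \<open>For p = 12 k + r the number (p - 1) / 2 is 6 k + (r - 1) / 2, so its parity
    depends on r alone.\<close>
  define k r where "k = p div 12" and "r = p mod 12"
  have pk: "p = 12 * k + r" by (simp add: k_def r_def)
  have p3: "p mod 3 = r mod 3" unfolding r_def by (simp add: mod_mod_cancel)
  have p2: "p mod 2 = r mod 2" unfolding r_def by (simp add: mod_mod_cancel)
  have "int p mod 12 = int r" by (simp add: r_def of_nat_mod)
  then have chi: "chi12 (int p) = chi12 (int r)" by (metis chi12_mod)
  have "r < 12" by (simp add: r_def)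
  then have "int r \<in> {0..<12}" by simp
  then have "r \<in> {0,1,2,3,4,5,6,7,8,9,10,11}" unfolding int_interval_12 by auto
  moreover have "r mod 2 \<noteq> 0" "r mod 3 \<noteq> 0" using nd p2 p3 by (auto simp: dvd_eq_mod_eq_0)
  ultimately consider "r = 1" | "r = 5" | "r = 7" | "r = 11" by auto
  then show ?thesis
  proof cases
    case 1
    then have "(p - 1) div 2 = 2 * (3 * k)" using pk by simp
    then show ?thesis using rec L1 p3 1 unfolding chi by (simp add: chi12_def)
  next
    case 2
    then have "(p - 1) div 2 = 2 * (3 * k + 1)" using pk by simp
    then show ?thesis using rec L2 p3 2 unfolding chi by (simp add: chi12_def)
  next
    case 3
    then have "(p - 1) div 2 = Suc (2 * (3 * k + 1))" using pk by simp
    then show ?thesis using rec L1 p3 3 unfolding chi by (simp add: chi12_def)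
  next
    case 4
    then have "(p - 1) div 2 = Suc (2 * (3 * k + 2))" using pk by simp
    then show ?thesis using rec L2 p3 4 unfolding chi by (simp add: chi12_def)
  qed
qed

section \<open>The Dedekind eta function\<close>

lemma has_sum_finite_sum:
  fixes f :: "'i \<Rightarrow> 'a \<Rightarrow> complex"
  assumes "finite I" "\<And>i. i \<in> I \<Longrightarrow> (f i has_sum s i) A"
  shows "((\<lambda>x. \<Sum>i\<in>I. f i x) has_sum (\<Sum>i\<in>I. s i)) A"
  using assms by (induction I rule: finite_induct) (auto intro: has_sum_add)

lemma has_sum_residue_class:
  fixes f :: "int \<Rightarrow> complex"
  assumes N: "N > 0" and r: "r \<in> {0..<N}" and f: "((\<lambda>k. f (N * k + r)) has_sum S) UNIV"
  shows "((\<lambda>n. if n mod N = r then f n else 0) has_sum S) UNIV"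
proof -
  have inj: "inj (\<lambda>k. N * k + r)" using N by (auto simp: inj_on_def)
  have img: "range (\<lambda>k. N * k + r) = {n. n mod N = r}"
  proof (intro equalityI subsetI)
    fix n assume "n \<in> {n. n mod N = r}"
    then have "n = N * (n div N) + r" by auto
    then show "n \<in> range (\<lambda>k. N * k + r)" by blast
  qed (use r in auto)
  have "(f has_sum S) {n. n mod N = r}"
    using f has_sum_reindex[OF inj, of f S] unfolding img by (simp add: o_def)
  then show ?thesis
    by (rule has_sum_cong_neutral[THEN iffD1, rotated -1]) auto
qed

text \<open>Split the sum by n mod N and apply \<open>theta_inversion\<close> to each class with a =
  r / N and t = N / y; collecting the classes turns \<phi> into its finite Fourier
  transform.\<close>

theorem poisson_periodic_gaussian:
  fixes \<phi> :: "int \<Rightarrow> complex" and y :: real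
  assumes N: "N > 0" and per: "\<And>n. \<phi> (n mod N) = \<phi> n" and y: "y > 0"
  shows "(\<Sum>\<^sub>\<infinity>n. \<phi> n * of_real (exp (- pi * (real_of_int n)\<^sup>2 / (of_int N * y)))) =
     of_real (sqrt (y / of_int N)) *
     (\<Sum>\<^sub>\<infinity>m. (\<Sum>r\<in>{0..<N}. \<phi> r * unity_root N (m * r)) * of_real (exp (- pi * (real_of_int m)\<^sup>2 * y / of_int N)))"
proof -
  define t where "t = of_int N / y"
  have t: "t > 0" using N y by (simp add: t_def)
  define E where "E n = complex_of_real (exp (- pi * (real_of_int n)\<^sup>2 / (of_int N * y)))" for n
  define H where "H m = complex_of_real (exp (- pi * (real_of_int m)\<^sup>2 * y / of_int N))" for m
  have Hsum: "(\<lambda>m. norm (H m)) summable_on UNIV"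
    using summable_gauss_coeff[OF t] N y by (simp add: H_def t_def)
  define S where "S r = (\<Sum>\<^sub>\<infinity>m. H m * unity_root N (m * r))" for r
  have S: "((\<lambda>m. H m * unity_root N (m * r)) has_sum S r) UNIV" for r
    unfolding S_def using Hsum
    by (intro has_sum_infsum abs_summable_summable[where f = "\<lambda>m. H m * unity_root N (m * r)"]) (simp add: norm_mult)
  have cls: "((\<lambda>k. E (N * k + r)) has_sum (of_real (sqrt (y / of_int N)) * S r)) UNIV" if r: "r \<in> {0..<N}" for r
  proof -
    define a where "a = real_of_int r / of_int N"
    have a: "a \<in> {0..1}" using r N by (auto simp: a_def field_simps)
    have E: "E (N * k + r) = complex_of_real (exp (- pi * t * (a + k)\<^sup>2))" for k
    proof -
      have "real_of_int (N * k + r) = of_int N * (a + k)" using N by (simp add: a_def field_simps)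
      then have eq: "(real_of_int (N * k + r))\<^sup>2 / (of_int N * y) = t * (a + k)\<^sup>2"
        using N y by (simp add: t_def power2_eq_square field_simps)
      have "- pi * (real_of_int (N * k + r))\<^sup>2 / (of_int N * y) = - pi * ((real_of_int (N * k + r))\<^sup>2 / (of_int N * y))"
        by (rule times_divide_eq_right[symmetric])
      also have "\<dots> = - pi * t * (a + k)\<^sup>2" unfolding eq by (rule mult.assoc[symmetric])
      finally show ?thesis unfolding E_def by (rule arg_cong)
    qed
    have "(\<lambda>k::int. exp (- pi * t * (a + k)\<^sup>2)) summable_on UNIV"
      by (rule summable_on_comparison_test[OF summable_gauss_bound[OF t]])
         (use gauss_term_le[OF t a] in auto)
    then have "(\<lambda>k. E (N * k + r)) summable_on UNIV"
      unfolding E by (rule summable_on_of_real)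
    moreover have "(\<Sum>\<^sub>\<infinity>k. E (N * k + r)) = of_real (sqrt (y / of_int N)) * S r"
    proof -
      have "(\<Sum>\<^sub>\<infinity>k. E (N * k + r)) = (\<Sum>\<^sub>\<infinity>k::int. of_real (exp (- pi * (real_of_int k)\<^sup>2 / t)) * cis (2 * pi * k * a)) / sqrt t"
        unfolding E by (rule theta_inversion[OF t a])
      also have "(\<lambda>k::int. of_real (exp (- pi * (real_of_int k)\<^sup>2 / t)) * cis (2 * pi * k * a)) = (\<lambda>k. H k * unity_root N (k * r))"
        using N y by (intro ext) (simp add: H_def t_def unity_root_def a_def mult_ac)
      also have "infsum \<dots> UNIV / sqrt t = of_real (sqrt (y / of_int N)) * S r"
        using N y by (simp add: S_def t_def real_sqrt_divide)
      finally show ?thesis .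
    qed
    ultimately show ?thesis using has_sum_infsum by metis
  qed
  have "((\<lambda>n. \<Sum>r\<in>{0..<N}. \<phi> r * (if n mod N = r then E n else 0)) has_sum
      (\<Sum>r\<in>{0..<N}. \<phi> r * (of_real (sqrt (y / of_int N)) * S r))) UNIV"
    by (intro has_sum_finite_sum has_sum_cmult_right has_sum_residue_class[OF N] cls) auto
  also have "(\<lambda>n. \<Sum>r\<in>{0..<N}. \<phi> r * (if n mod N = r then E n else 0)) = (\<lambda>n. \<phi> n * E n)"
  proof
    fix n
    have "(\<Sum>r\<in>{0..<N}. \<phi> r * (if n mod N = r then E n else 0)) = (\<Sum>r\<in>{0..<N}. if r = n mod N then \<phi> r * E n else 0)"
      by (intro sum.cong) auto
    also have "\<dots> = \<phi> (n mod N) * E n" using N by simp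
    finally show "(\<Sum>r\<in>{0..<N}. \<phi> r * (if n mod N = r then E n else 0)) = \<phi> n * E n" by (simp add: per)
  qed
  finally have L: "((\<lambda>n. \<phi> n * E n) has_sum (\<Sum>r\<in>{0..<N}. \<phi> r * (of_real (sqrt (y / of_int N)) * S r))) UNIV" .
  have "((\<lambda>m. \<Sum>r\<in>{0..<N}. \<phi> r * (H m * unity_root N (m * r))) has_sum (\<Sum>r\<in>{0..<N}. \<phi> r * S r)) UNIV"
    by (intro has_sum_finite_sum has_sum_cmult_right S) auto
  then have R: "((\<lambda>m. (\<Sum>r\<in>{0..<N}. \<phi> r * unity_root N (m * r)) * H m) has_sum (\<Sum>r\<in>{0..<N}. \<phi> r * S r)) UNIV"
    by (simp add: sum_distrib_left mult_ac)
  show ?thesis using infsumI[OF L] infsumI[OF R] unfolding E_def H_def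
    by (simp add: sum_distrib_left mult_ac)
qed

section \<open>The eta function and its transformation\<close>

definition qexp :: "complex \<Rightarrow> complex" where
  "qexp w = exp (2 * of_real pi * \<i> * w)"

lemma qexp_add: "qexp (v + w) = qexp v * qexp w"
  by (simp add: qexp_def ring_distribs exp_add)

lemma qexp_nonzero [simp]: "qexp w \<noteq> 0"
  by (simp add: qexp_def)

lemma qexp_0 [simp]: "qexp 0 = 1"
  by (simp add: qexp_def)

lemma qexp_of_nat_mult: "qexp (of_nat n * w) = qexp w ^ n"
  using exp_of_nat_mult[of n "2 * of_real pi * \<i> * w"] by (simp add: qexp_def mult_ac)

lemma norm_qexp: "norm (qexp w) = exp (- 2 * pi * Im w)"
  by (simp add: qexp_def norm_exp_eq_Re)

lemma norm_qexp_less_1: "Im w > 0 \<Longrightarrow> norm (qexp w) < 1"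
  by (simp add: norm_qexp)

lemma qexp_of_real: "qexp (of_real x) = cis (2 * pi * x)"
  by (simp add: qexp_def cis_conv_exp mult_ac)

lemma qexp_of_int_divide: "qexp (of_int n / of_int c) = unity_root c n"
  using qexp_of_real[of "of_int n / of_int c"] by (simp add: unity_root_def)

lemma qexp_imaginary: "qexp (\<i> * of_real x) = of_real (exp (- 2 * pi * x))"
proof -
  have "2 * of_real pi * \<i> * (\<i> * of_real x) = complex_of_real (- 2 * pi * x)"
    by (simp add: complex_eq_iff)
  then show ?thesis unfolding qexp_def by (metis exp_of_real)
qed

text \<open>The 24th root of q is written \<open>qexp (w / 24)\<close>, which is single-valued in
  w.\<close>

definition eta :: "complex \<Rightarrow> complex" where
  "eta w = qexp (w / 24) * euler (qexp w)"

text \<open>By 24 * pent k + 1 = (6 * k + 1)^2 the pentagonal series is the part over n = 6 * k + 1.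
  The part over the negatives is equal, whence the factor 2, and chi12 vanishes elsewhere. A sum
  over all integers is what Poisson summation needs.\<close>

lemma eta_series:
  assumes w: "Im w > 0"
  shows "((\<lambda>n. of_int (chi12 n) * qexp (w * (of_int n)\<^sup>2 / 24)) has_sum 2 * eta w) UNIV"
proof -
  define f where "f n = of_int (chi12 n) * qexp (w * (of_int n)\<^sup>2 / 24)" for n
  have trm: "f (6 * k + 1) = qexp (w / 24) * (parity_sign k * qexp w ^ pent k)" for k
  proof -
    have "(6 * k + 1) mod 12 = (if even k then 1 else 7)" by presburger
    then have "chi12 (6 * k + 1) = parity_sign k" by (simp add: chi12_def parity_sign_def)
    moreover have "w * (of_int (6 * k + 1))\<^sup>2 / 24 = w / 24 + of_nat (pent k) * w"
    proof -
      have "2 * of_int (int (pent k)) = (of_int (k * (3 * k + 1)) :: complex)"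
        unfolding two_pent[symmetric] by simp
      then have p: "of_nat (pent k) = (of_int (k * (3 * k + 1)) / 2 :: complex)" by (simp add: mult.commute)
      show ?thesis unfolding p by (simp add: power2_eq_square field_simps)
    qed
    ultimately show ?thesis
      unfolding f_def by (simp only: qexp_add qexp_of_nat_mult parity_sign_of_int mult.left_commute)
  qed
  have even: "f (- n) = f n" for n by (simp add: f_def)
  have sum: "((\<lambda>k. f (6 * k + 1)) has_sum eta w) UNIV"
    unfolding trm eta_def by (intro has_sum_cmult_right euler_pentagonal norm_qexp_less_1 w)
  have i1: "inj (\<lambda>k::int. 6 * k + 1)" and i2: "inj (\<lambda>k::int. - (6 * k + 1))"
    by (auto simp: inj_on_def)
  have "(f has_sum eta w) (range (\<lambda>k. 6 * k + 1))"
    using sum by (subst has_sum_reindex[OF i1]) (simp add: o_def)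
  moreover have "(f has_sum eta w) (range (\<lambda>k. - (6 * k + 1)))"
    using sum by (subst has_sum_reindex[OF i2]) (simp add: o_def even del: minus_add_distrib)
  moreover have "range (\<lambda>k. 6 * k + 1) \<inter> range (\<lambda>k::int. - (6 * k + 1)) = {}"
  proof (safe, goal_cases)
    case (1 _ k k')
    then show ?case by presburger
  qed
  ultimately have *: "(f has_sum (eta w + eta w)) (range (\<lambda>k. 6 * k + 1) \<union> range (\<lambda>k. - (6 * k + 1)))"
    by (rule has_sum_Un_disjoint)
  have out: "f n = 0" if "n \<notin> range (\<lambda>k. 6 * k + 1) \<union> range (\<lambda>k. - (6 * k + 1))" for n
  proof -
    have ne: "n \<noteq> 6 * k + 1" "n \<noteq> - (6 * k + 1)" for k using that by auto
    define d r where "d = n div 12" and "r = n mod 12"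
    have n: "n = 12 * d + r" by (simp add: d_def r_def)
    have "r \<noteq> 1" "r \<noteq> 7" "r \<noteq> 5" "r \<noteq> 11"
      using ne(1)[of "2 * d"] ne(1)[of "2 * d + 1"] ne(2)[of "- 2 * d - 1"] ne(2)[of "- 2 * d - 2"] n by auto
    then have "n mod 12 \<noteq> 1" "n mod 12 \<noteq> 5" "n mod 12 \<noteq> 7" "n mod 12 \<noteq> 11" by (simp_all add: r_def)
    then have "chi12 n = 0" by (simp add: chi12_def)
    then show ?thesis by (simp add: f_def)
  qed
  have "(f has_sum (eta w + eta w)) UNIV"
    using * by (rule has_sum_cong_neutral[THEN iffD1, rotated -1]) (use out in auto)
  then show ?thesis by (simp add: f_def[abs_def])
qed

text \<open>The factor 24 in the real part cancels the 24 in the exponent, so the twist e(b n^2 / c)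
  depends on n modulo c only.\<close>

lemma eta_rational_series:
  assumes c: "c > 0" and y: "y > 0"
  shows "2 * eta ((24 * of_int b + \<i> * of_real y) / of_int c) =
    (\<Sum>\<^sub>\<infinity>n. of_int (chi12 n) * unity_root c (b * n\<^sup>2) * of_real (exp (- pi * (real_of_int n)\<^sup>2 * y / of_int (12 * c))))"
proof -
  define w where "w = (24 * of_int b + \<i> * of_real y) / of_int c"
  have w: "Im w > 0" using c y by (simp add: w_def)
  have "qexp (w * (of_int n)\<^sup>2 / 24) = unity_root c (b * n\<^sup>2) * of_real (exp (- pi * (real_of_int n)\<^sup>2 * y / of_int (12 * c)))" for n
  proof -
    have "w * (of_int n)\<^sup>2 / 24 = of_int (b * n\<^sup>2) / of_int c + \<i> * of_real (y * (of_int n)\<^sup>2 / (24 * of_int c))"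
      using c by (simp add: w_def field_simps)
    then show ?thesis using c
      by (simp only: qexp_add qexp_of_int_divide qexp_imaginary) (simp add: field_simps)
  qed
  then show ?thesis using infsumI[OF eta_series[OF w]] by (simp add: w_def mult_ac)
qed

text \<open>The eta multiplier for translates with denominator c, kept as a Gauss sum; it gets
  evaluated for c = 1, p and p^2.\<close>

definition eta_factor :: "int \<Rightarrow> int \<Rightarrow> complex" where
  "eta_factor c b = of_int (chi12 c) * quad_gauss_sum (144 * b) c / sqrt (of_int c)"

text \<open>Poisson summation with modulus 12 * c, where \<open>chi12_gauss_fourier\<close>
  reproduces the coefficients with b' in place of b. For c = 1 and b = b' = 0 it is the classical
  inversion eta (i / y) = sqrt y * eta (i y).\<close>

theorem eta_transform:
  assumes c: "c > 0" "coprime c 12" and inv: "[576 * b * b' = - 1] (mod c)" and y: "y > 0"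
  shows "eta ((24 * of_int b + \<i> * of_real (1 / y)) / of_int c) =
    eta_factor c b * sqrt y * eta ((24 * of_int b' + \<i> * of_real y) / of_int c)"
proof -
  define \<phi> where "\<phi> n = of_int (chi12 n) * unity_root c (b * n\<^sup>2)" for n
  have per: "\<phi> (n mod (12 * c)) = \<phi> n" for n
  proof -
    have "[n mod (12 * c) = n] (mod 12 * c)" by simp
    then have 1: "[n mod (12 * c) = n] (mod 12)" "[n mod (12 * c) = n] (mod c)"
      by (rule cong_dvd_modulus; simp)+
    show ?thesis unfolding \<phi>_def
      by (intro arg_cong2[of _ _ _ _ "(*)"] arg_cong[of _ _ of_int] chi12_cong unity_root_cong
          cong_mult cong_pow 1 cong_refl)
  qed
  have "2 * eta ((24 * of_int b + \<i> * of_real (1 / y)) / of_int c) =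
     (\<Sum>\<^sub>\<infinity>n. \<phi> n * of_real (exp (- pi * (real_of_int n)\<^sup>2 / (of_int (12 * c) * y))))"
    using y by (subst eta_rational_series[OF c(1)]) (auto simp: \<phi>_def mult_ac)
  also have "\<dots> = of_real (sqrt (y / of_int (12 * c))) *
     (\<Sum>\<^sub>\<infinity>m. (\<Sum>r\<in>{0..<12 * c}. \<phi> r * unity_root (12 * c) (m * r)) * of_real (exp (- pi * (real_of_int m)\<^sup>2 * y / of_int (12 * c))))"
    using c y per by (intro poisson_periodic_gaussian) auto
  also have "(\<lambda>m. (\<Sum>r\<in>{0..<12 * c}. \<phi> r * unity_root (12 * c) (m * r)) * of_real (exp (- pi * (real_of_int m)\<^sup>2 * y / of_int (12 * c)))) =
    (\<lambda>m. (of_int (chi12 c) * quad_gauss_sum (144 * b) c * sqrt 12) *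
       (of_int (chi12 m) * unity_root c (b' * m\<^sup>2) * of_real (exp (- pi * (real_of_int m)\<^sup>2 * y / of_int (12 * c)))))"
    unfolding \<phi>_def chi12_gauss_fourier[OF c inv] by (simp add: mult_ac)
  also have "infsum \<dots> UNIV = (of_int (chi12 c) * quad_gauss_sum (144 * b) c * sqrt 12) * (2 * eta ((24 * of_int b' + \<i> * of_real y) / of_int c))"
    unfolding eta_rational_series[OF c(1) y] by (rule infsum_cmult_right')
  also have "of_real (sqrt (y / of_int (12 * c))) * \<dots> =
     2 * (eta_factor c b * sqrt y * eta ((24 * of_int b' + \<i> * of_real y) / of_int c))"
    using c by (simp add: eta_factor_def real_sqrt_divide real_sqrt_mult field_simps)
  finally show ?thesis by simp
qed

text \<open>\<open>eta_quot\<close> and \<open>eta_quot'\<close> are F and G of the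
  overview.\<close>

definition eta_quot :: "complex \<Rightarrow> complex" where
  "eta_quot w = eta (2 * w) ^ 3 / eta w ^ 2"

definition eta_quot' :: "complex \<Rightarrow> complex" where
  "eta_quot' w = eta w ^ 3 / eta (2 * w) ^ 2"

text \<open>Doubling the argument doubles b on one side and b' on the other: eta (2 w) uses the pair
  (2 b, b') and eta w the pair (b, 2 b'), both covered by 1152 = 2 * 576. Likewise 1 / y pairs with
  y in the first case and 1 / (2 y) with 2 y in the second.\<close>

theorem eta_quot_transform:
  assumes c: "c > 0" "coprime c 12" and inv: "[1152 * b * b' = - 1] (mod c)" and y: "y > 0"
  shows "eta_quot ((24 * of_int b + \<i> * of_real (1 / (2 * y))) / of_int c) =
    eta_factor c (2 * b) ^ 3 / eta_factor c b ^ 2 * (of_real (sqrt y) / 2) *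
    eta_quot' ((24 * of_int b' + \<i> * of_real y) / of_int c)"
proof -
  let ?w = "(24 * of_int b + \<i> * of_real (1 / (2 * y))) / of_int c"
  let ?z = "(24 * of_int b' + \<i> * of_real y) / of_int c"
  have i1: "[576 * (2 * b) * b' = - 1] (mod c)" and i2: "[576 * b * (2 * b') = - 1] (mod c)"
    using inv by (simp_all add: mult_ac)
  have "2 * ?w = (24 * of_int (2 * b) + \<i> * of_real (1 / y)) / of_int c"
    using c y by (simp add: field_simps)
  then have 1: "eta (2 * ?w) = eta_factor c (2 * b) * sqrt y * eta ?z"
    using eta_transform[OF c i1 y] by simp
  have "eta ?w = eta_factor c b * sqrt (2 * y) * eta ((24 * of_int (2 * b') + \<i> * of_real (2 * y)) / of_int c)"
    using eta_transform[OF c i2, of "2 * y"] y by simp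
  also have "(24 * of_int (2 * b') + \<i> * of_real (2 * y)) / of_int c = 2 * ?z"
    using c by (simp add: field_simps)
  finally have 2: "eta ?w = eta_factor c b * sqrt (2 * y) * eta (2 * ?z)" .
  have 3: "complex_of_real (sqrt y) ^ 3 = of_real y * of_real (sqrt y)"
    "complex_of_real (sqrt (2 * y)) ^ 2 = 2 * of_real y"
    using y by (simp_all add: power3_eq_cube flip: of_real_mult of_real_power) simp
  show ?thesis unfolding eta_quot_def eta_quot'_def 1 2 power_mult_distrib 3
    using y by (simp add: field_simps)
qed

section \<open>The Hecke operator and the Fricke involution\<close>

text \<open>The involution matches the translate b of F with the translate \<sigma> b of G; as
  \<sigma> permutes the units modulo c, sums over b can be reindexed.\<close>

lemma negative_inverse_permutation:
  fixes c k :: int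
  assumes c: "c > 0" and k: "coprime k c"
  defines "U \<equiv> {b\<in>{0..<c}. coprime b c}"
  obtains \<sigma> where "bij_betw \<sigma> U U" "\<And>b. b \<in> U \<Longrightarrow> [k * b * \<sigma> b = - 1] (mod c)"
proof -
  have "\<exists>b'. b' \<in> U \<and> [k * b * b' = - 1] (mod c)" if b: "b \<in> U" for b
  proof -
    have "coprime (k * b) c" using b k by (simp add: U_def)
    then obtain x where x: "[k * b * x = 1] (mod c)" using cong_solve_coprime_int by blast
    define b' where "b' = (- x) mod c"
    have b': "[b' = - x] (mod c)" by (simp add: b'_def)
    have "[k * b * b' = k * b * (- x)] (mod c)" using b' by (rule cong_scalar_left)
    also have "k * b * (- x) = - (k * b * x)" by simp
    also have "[- (k * b * x) = - 1] (mod c)" using x by (simp add: cong_minus_minus_iff)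
    finally have *: "[k * b * b' = - 1] (mod c)" .
    have "coprime (k * b * b') c"
      using * by (metis cong_imp_coprime cong_sym coprime_1_left coprime_minus_left_iff)
    then have "coprime b' c" by simp
    then have "b' \<in> U" using c by (simp add: U_def b'_def)
    then show ?thesis using * by blast
  qed
  then obtain \<sigma> where \<sigma>: "\<And>b. b \<in> U \<Longrightarrow> \<sigma> b \<in> U" "\<And>b. b \<in> U \<Longrightarrow> [k * b * \<sigma> b = - 1] (mod c)"
    by metis
  have "inj_on \<sigma> U"
  proof (rule inj_onI)
    fix x y assume xy: "x \<in> U" "y \<in> U" "\<sigma> x = \<sigma> y"
    have "[k * x * \<sigma> x = k * y * \<sigma> x] (mod c)"
      using \<sigma>(2)[OF xy(1)] \<sigma>(2)[OF xy(2)] xy(3) by (metis cong_sym cong_trans)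
    moreover have "coprime (\<sigma> x) c" using \<sigma>(1)[OF xy(1)] by (simp add: U_def)
    ultimately have "[k * x = k * y] (mod c)" by (simp add: cong_mult_rcancel)
    then have "[x = y] (mod c)" using k by (simp add: cong_mult_lcancel)
    then show "x = y" using xy by (simp add: U_def cong_def)
  qed
  moreover have "finite U" by (rule finite_subset[of _ "{0..<c}"]) (auto simp: U_def)
  ultimately have "bij_betw \<sigma> U U"
    unfolding bij_betw_def using \<sigma>(1) by (metis endo_inj_surj image_subsetI)
  then show ?thesis using \<sigma>(2) that by blast
qed

text \<open>With c = 1 every congruence holds, and the formula is the plain Fricke
  involution.\<close>

lemma eta_quot_transform_one:
  assumes y: "y > 0"
  shows "eta_quot (\<i> * of_real (1 / (2 * y))) = (of_real (sqrt y) / 2) * eta_quot' (\<i> * of_real y)"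
proof -
  have "eta_factor 1 0 = 1"
    by (simp add: eta_factor_def quad_gauss_sum_def chi12_def)
  then show ?thesis using eta_quot_transform[of 1 0 0 y] y by simp
qed

text \<open>This is p times the usual T(p^2) of weight 1/2, written with averages over translates;
  on coefficients it is p * a(p^2 e) + s * (e/p) * a(e) + a(e / p^2). Translations by 24 fit the
  exponents e / 24. The sign s is a parameter because F and G carry different ones.\<close>

definition hecke :: "int \<Rightarrow> complex \<Rightarrow> (complex \<Rightarrow> complex) \<Rightarrow> complex \<Rightarrow> complex" where
  "hecke p s f w = (\<Sum>b\<in>{0..<p\<^sup>2}. f ((24 * of_int b + w) / of_int (p\<^sup>2))) / of_int p
     + s / gauss_sum p * (\<Sum>b\<in>{0..<p}. of_int (Legendre b p) * f ((24 * of_int b + of_int p * w) / of_int p))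
     + f (of_int (p\<^sup>2) * w)"

section \<open>The Hecke operator at a prime under the Fricke involution\<close>

context
  fixes p :: int
  assumes p: "prime p" "p > 3"
begin

private lemma p2: "p > 2" using p by simp

private lemma not_dvd_2: "\<not> p dvd 2" and not_dvd_3: "\<not> p dvd 3"
  using p by (auto dest!: zdvd_imp_le)

private lemma not_dvd_1152: "\<not> p dvd 1152" and not_dvd_144: "\<not> p dvd 144" and not_dvd_24: "\<not> p dvd 24"
proof -
  have "\<not> p dvd 2 ^ 7 * 3 ^ 2" "\<not> p dvd 2 ^ 4 * 3 ^ 2" "\<not> p dvd 2 ^ 3 * 3 ^ 1"
    using not_dvd_2 not_dvd_3 p(1) prime_dvd_power by (metis prime_dvd_mult_iff)+
  then show "\<not> p dvd 1152" "\<not> p dvd 144" "\<not> p dvd 24" by simp_all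
qed

lemma coprime_prime_iff: "coprime b p \<longleftrightarrow> \<not> p dvd b"
  using p by (metis coprime_commute coprime_absorb_left not_prime_unit prime_imp_coprime)

text \<open>After cancelling, 24 b / p^2 has denominator 1, p or p^2 on the three classes, and the
  involution acts on each with its own multiplier.\<close>

lemma sum_prime_square_split:
  fixes h :: "int \<Rightarrow> complex"
  shows "(\<Sum>b\<in>{0..<p\<^sup>2}. h b) = h 0 + (\<Sum>b\<in>{b\<in>{0..<p}. coprime b p}. h (p * b)) + (\<Sum>b\<in>{b\<in>{0..<p\<^sup>2}. coprime b (p\<^sup>2)}. h b)"
proof -
  have p0: "p > 0" using p by simp
  let ?U = "{b\<in>{0..<p\<^sup>2}. coprime b (p\<^sup>2)}" and ?V = "{b\<in>{0..<p\<^sup>2}. p dvd b}"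
  have U: "{0..<p\<^sup>2} = ?U \<union> ?V" "?U \<inter> ?V = {}"
    by (auto simp: coprime_power_right_iff coprime_prime_iff)
  have "(\<Sum>b\<in>{0..<p\<^sup>2}. h b) = (\<Sum>b\<in>?V. h b) + (\<Sum>b\<in>?U. h b)"
  proof -
    have "finite ?U" "finite ?V" by (rule finite_subset[of _ "{0..<p\<^sup>2}"]; auto)+
    then show ?thesis by (subst U(1), subst sum.union_disjoint) (simp_all only: U(2) add.commute)
  qed
  also have "?V = (\<lambda>b. p * b) ` {0..<p}"
    using p0 by (auto simp: power2_eq_square elim!: dvdE simp: zero_le_mult_iff image_iff)
  also have "(\<Sum>b\<in>(\<lambda>b. p * b) ` {0..<p}. h b) = (\<Sum>b\<in>{0..<p}. h (p * b))"
    using p0 by (subst sum.reindex) (auto simp: inj_on_def)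
  also have "{0..<p} = insert 0 {b\<in>{0..<p}. coprime b p}"
    using p0 by (auto simp: coprime_prime_iff dest!: zdvd_imp_le)
  also have "(\<Sum>b\<in>\<dots>. h (p * b)) = h 0 + (\<Sum>b\<in>{b\<in>{0..<p}. coprime b p}. h (p * b))"
  proof -
    have "finite {b\<in>{0..<p}. coprime b p}" by (rule finite_subset[of _ "{0..<p}"]) auto
    then show ?thesis by (subst sum.insert) (simp_all add: coprime_prime_iff)
  qed
  finally show ?thesis by simp
qed

lemma chi12_prime: "chi12 p = Legendre 3 p"
  using Legendre_3_eq_chi12[of "nat p"] p by simp

lemma chi12_prime_square: "chi12 p * chi12 p = 1"
  unfolding chi12_prime using Legendre_mult_self[OF p(1) p2 not_dvd_3] .

lemma gauss_sum_square: "gauss_sum p * gauss_sum p = of_int (Legendre (-1) p) * of_int p"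
  using gauss_sum_squared[OF p(1) p2] by (simp add: power2_eq_square)

lemma Legendre_minus_one_square: "Legendre (-1) p * Legendre (-1) p = 1"
  using Legendre_mult_self[OF p(1) p2, of "-1"] p by auto

lemma gauss_sum_nonzero: "gauss_sum p \<noteq> 0"
  using gauss_sum_square Legendre_minus_one_square p by auto

lemma coprime_p_12: "coprime p 12"
proof -
  have "\<not> p dvd 12" using not_dvd_24 by (metis dvd_mult mult_2 numeral_Bit0 dvd_add)
  then show ?thesis using coprime_prime_iff[of 12] by (simp add: coprime_commute)
qed

lemma eta_factor_prime:
  assumes "\<not> p dvd b"
  shows "eta_factor p b = of_int (chi12 p * Legendre b p) * gauss_sum p / sqrt (of_int p)"
proof -
  have "\<not> p dvd 144 * b" using assms not_dvd_144 p(1) by (simp add: prime_dvd_mult_iff)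
  moreover have "Legendre (144 * b) p = Legendre b p"
  proof -
    have "\<not> p dvd 12" using coprime_p_12 coprime_prime_iff[of 12] by (simp add: coprime_commute)
    then have "Legendre (12\<^sup>2) p = 1" by (rule Legendre_square[OF p(1) p2])
    then show ?thesis using Legendre_mult[OF p(1) p2, of 144 b] by simp
  qed
  ultimately show ?thesis
    by (simp add: eta_factor_def quad_gauss_sum_prime[OF p(1) p2])
qed

text \<open>The square of the multiplier at p is the same for every unit, so the cube over the
  square collapses to \<open>eta_factor p (2 * b)\<close>, whose Legendre symbol survives.\<close>

lemma eta_quot_transform_prime:
  assumes b: "\<not> p dvd b" and inv: "[1152 * b * b' = - 1] (mod p)" and y: "y > 0"
  shows "eta_quot ((24 * of_int b + \<i> * of_real (1 / (2 * y))) / of_int p) =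
    of_int (chi12 p * Legendre (2 * b) p) * gauss_sum p * (of_real (sqrt (y / of_int p)) / 2) *
    eta_quot' ((24 * of_int b' + \<i> * of_real y) / of_int p)"
proof -
  have p0: "p > 0" using p by simp
  have 2: "\<not> p dvd 2 * b" using b not_dvd_2 p(1) by (simp add: prime_dvd_mult_iff)
  have "eta_factor p a ^ 2 = gauss_sum p ^ 2 / of_int p" if "\<not> p dvd a" for a
  proof -
    have "(chi12 p * Legendre a p)\<^sup>2 = 1"
      using chi12_prime_square Legendre_mult_self[OF p(1) p2 that] by (simp add: power2_eq_square mult_ac)
    then have "(complex_of_int (chi12 p * Legendre a p))\<^sup>2 = 1" by (metis of_int_1 of_int_power)
    then show ?thesis unfolding eta_factor_prime[OF that] using p0
      by (simp add: power_divide power_mult_distrib flip: of_real_power)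
  qed
  from this[OF b] this[OF 2] have "eta_factor p (2 * b) ^ 2 = eta_factor p b ^ 2" "eta_factor p b ^ 2 \<noteq> 0"
    using p0 gauss_sum_nonzero by auto
  then have "eta_factor p (2 * b) ^ 3 / eta_factor p b ^ 2 = eta_factor p (2 * b)"
    by (simp add: power3_eq_cube power2_eq_square)
  then have "eta_quot ((24 * of_int b + \<i> * of_real (1 / (2 * y))) / of_int p) =
    eta_factor p (2 * b) * (of_real (sqrt y) / 2) * eta_quot' ((24 * of_int b' + \<i> * of_real y) / of_int p)"
    using eta_quot_transform[OF p0 coprime_p_12 inv y] by simp
  then show ?thesis unfolding eta_factor_prime[OF 2] using p0 by (simp add: real_sqrt_divide)
qed

text \<open>Modulo p^2 the Gauss sum equals p, the square root of the modulus, and chi12 (p^2) = 1,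
  so the multiplier is 1.\<close>

lemma eta_quot_transform_prime_square:
  assumes b: "\<not> p dvd b" and inv: "[1152 * b * b' = - 1] (mod p\<^sup>2)" and y: "y > 0"
  shows "eta_quot ((24 * of_int b + \<i> * of_real (1 / (2 * y))) / of_int (p\<^sup>2)) =
    (of_real (sqrt y) / 2) * eta_quot' ((24 * of_int b' + \<i> * of_real y) / of_int (p\<^sup>2))"
proof -
  have p0: "p > 0" using p by simp
  have "eta_factor (p\<^sup>2) a = 1" if "\<not> p dvd a" for a
  proof -
    have "\<not> p dvd 144 * a" using that not_dvd_144 p(1) by (simp add: prime_dvd_mult_iff)
    then have "quad_gauss_sum (144 * a) (p\<^sup>2) = of_int p"
      by (rule quad_gauss_sum_prime_square[OF p(1) p2])
    moreover have "chi12 (p\<^sup>2) = 1" using chi12_prime_square by (simp add: power2_eq_square chi12_mult)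
    ultimately show ?thesis using p0 by (simp add: eta_factor_def)
  qed
  moreover have "\<not> p dvd 2 * b" using b not_dvd_2 p(1) by (simp add: prime_dvd_mult_iff)
  ultimately show ?thesis using b eta_quot_transform[of "p\<^sup>2" b b' y] inv y p0 coprime_p_12 by simp
qed

text \<open>The involution matches the unit translates of F with those of G, exchanges the translate
  b = 0 with the term at p^2 w, and exchanges the translates p * b with the twisted sum. The last
  exchange forces the signs: (3/p) for G, from chi12 p, and (6/p) for F.\<close>

theorem hecke_eta_quot_transform:
  assumes y: "y > 0"
  shows "hecke p (of_int (Legendre 6 p)) eta_quot (\<i> * of_real (1 / (2 * y))) =
    (of_real (sqrt y) / 2) * hecke p (of_int (Legendre 3 p)) eta_quot' (\<i> * of_real y)"
proof -
  have p0: "p > 0" using p by simp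
  define r where "r = complex_of_real (sqrt y) / 2"
  define U1 where "U1 = {b\<in>{0..<p}. coprime b p}"
  define U2 where "U2 = {b\<in>{0..<p\<^sup>2}. coprime b (p\<^sup>2)}"
  define g where "g = gauss_sum p"
  have g: "g \<noteq> 0" "g * g = of_int (Legendre (-1) p) * of_int p"
    using gauss_sum_nonzero gauss_sum_square by (auto simp: g_def)
  have "coprime 1152 p" using not_dvd_1152 by (simp add: coprime_prime_iff)
  then have c2: "coprime 1152 (p\<^sup>2)" by simp
  obtain \<sigma> where \<sigma>: "bij_betw \<sigma> U1 U1" "\<And>b. b \<in> U1 \<Longrightarrow> [1152 * b * \<sigma> b = - 1] (mod p)"
    by (rule negative_inverse_permutation[OF p0 \<open>coprime 1152 p\<close>]) (use U1_def in blast)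
  obtain \<tau> where \<tau>: "bij_betw \<tau> U2 U2" "\<And>b. b \<in> U2 \<Longrightarrow> [1152 * b * \<tau> b = - 1] (mod p\<^sup>2)"
    by (rule negative_inverse_permutation[OF _ c2]) (use p0 U2_def in auto)
  have U1: "\<not> p dvd b" if "b \<in> U1" for b using that by (simp add: U1_def coprime_prime_iff)
  have U2: "\<not> p dvd b" if "b \<in> U2" for b using that by (simp add: U2_def coprime_prime_iff)
  let ?w = "\<i> * complex_of_real (1 / (2 * y))" and ?z = "\<i> * complex_of_real y"
  let ?FA = "\<lambda>b. eta_quot ((24 * of_int (p * b) + ?w) / of_int (p\<^sup>2))"
    and ?GA = "\<lambda>b. eta_quot' ((24 * of_int (p * b) + ?z) / of_int (p\<^sup>2))"
    and ?FM = "\<lambda>b. eta_quot ((24 * of_int b + of_int p * ?w) / of_int p)"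
    and ?GM = "\<lambda>b. eta_quot' ((24 * of_int b + of_int p * ?z) / of_int p)"

  have sq: "complex_of_real (sqrt (of_int (p\<^sup>2) * y)) = of_int p * of_real (sqrt y)"
    "complex_of_real (sqrt (y / of_int (p\<^sup>2))) = of_real (sqrt y) / of_int p"
    using p0 by (simp_all add: real_sqrt_mult real_sqrt_divide)
  \<comment> \<open>The factor 1/p here and the factor p in \<open>A0\<close> come from the square
    root of the rescaled y; they balance the 1/p in front of the translates.\<close>
  have V: "eta_quot (of_int (p\<^sup>2) * ?w) = r * eta_quot' ((24 * of_int 0 + ?z) / of_int (p\<^sup>2)) / of_int p"
  proof -
    have "of_int (p\<^sup>2) * ?w = \<i> * of_real (1 / (2 * (y / of_int (p\<^sup>2))))" using y p0 by (simp add: field_simps)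
    then show ?thesis using eta_quot_transform_one[of "y / of_int (p\<^sup>2)"] y p0 unfolding sq by (simp add: r_def mult_ac)
  qed
  have A0: "eta_quot ((24 * of_int 0 + ?w) / of_int (p\<^sup>2)) = of_int p * r * eta_quot' (of_int (p\<^sup>2) * ?z)"
  proof -
    have "(24 * of_int 0 + ?w) / of_int (p\<^sup>2) = \<i> * of_real (1 / (2 * (of_int (p\<^sup>2) * y)))" using y p0 by (simp add: field_simps)
    then show ?thesis using eta_quot_transform_one[of "of_int (p\<^sup>2) * y"] y p0 unfolding sq by (simp add: r_def mult_ac)
  qed
  have A2: "(\<Sum>b\<in>U2. eta_quot ((24 * of_int b + ?w) / of_int (p\<^sup>2))) = r * (\<Sum>b\<in>U2. eta_quot' ((24 * of_int b + ?z) / of_int (p\<^sup>2)))"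
  proof -
    have "(\<Sum>b\<in>U2. eta_quot ((24 * of_int b + ?w) / of_int (p\<^sup>2))) = (\<Sum>b\<in>U2. r * eta_quot' ((24 * of_int (\<tau> b) + ?z) / of_int (p\<^sup>2)))"
      unfolding r_def by (intro sum.cong refl eta_quot_transform_prime_square U2 \<tau> y)
    also have "\<dots> = (\<Sum>b\<in>U2. r * eta_quot' ((24 * of_int b + ?z) / of_int (p\<^sup>2)))"
      by (rule sum.reindex_bij_betw[OF \<tau>(1)])
    finally show ?thesis by (simp add: sum_distrib_left)
  qed
  \<comment> \<open>Since 1152 * b * \<sigma> b = 24^2 * (2 * b) * \<sigma> b is -1 modulo p, the
    symbols of 2 * b and \<sigma> b differ by (-1/p).\<close>
  have Leg: "Legendre (2 * b) p = Legendre (-1) p * Legendre (\<sigma> b) p" if b: "b \<in> U1" for b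
  proof -
    have s: "\<not> p dvd \<sigma> b" using \<sigma>(1) b U1 by (meson bij_betwE)
    have "\<not> p dvd 24" by (rule not_dvd_24)
    then have "Legendre (24\<^sup>2) p = 1" by (rule Legendre_square[OF p(1) p2])
    moreover have "Legendre (24\<^sup>2 * (2 * b) * \<sigma> b) p = Legendre (-1) p"
      using \<sigma>(2)[OF b] by (intro Legendre_cong[OF p(1) p2]) (simp add: mult_ac)
    ultimately have "Legendre (2 * b) p * Legendre (\<sigma> b) p = Legendre (-1) p"
      by (simp only: Legendre_mult[OF p(1) p2] mult_1_left)
    then have "Legendre (2 * b) p * (Legendre (\<sigma> b) p * Legendre (\<sigma> b) p) = Legendre (-1) p * Legendre (\<sigma> b) p"
      by (simp add: mult_ac)
    then show ?thesis using Legendre_mult_self[OF p(1) p2 s] by simp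
  qed
  have A1: "(\<Sum>b\<in>U1. ?FA b) / of_int p =
      r * (of_int (Legendre 3 p) / g * (\<Sum>b\<in>U1. of_int (Legendre b p) * ?GM b))"
  proof -
    have "(\<Sum>b\<in>U1. ?FA b) =
        (\<Sum>b\<in>U1. (of_int p * r * of_int (Legendre 3 p) / g) * (of_int (Legendre (\<sigma> b) p) * ?GM (\<sigma> b)))"
    proof (intro sum.cong refl)
      fix b assume b: "b \<in> U1"
      \<comment> \<open>Cancelling one p changes the denominator to p and the parameter y to p *
        y.\<close>
      have *: "(24 * of_int (p * b) + ?w) / of_int (p\<^sup>2) = (24 * of_int b + \<i> * of_real (1 / (2 * (of_int p * y)))) / of_int p"
        using p0 y by (simp add: field_simps power2_eq_square)
      have "?FA b =
         of_int (Legendre 3 p * (Legendre (-1) p * Legendre (\<sigma> b) p)) * g * r *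
         ?GM (\<sigma> b)"
      proof -
        have 1: "0 < of_int p * y" using p0 y by simp
        have 2: "sqrt (of_int p * y / of_int p) = sqrt y" using p0 by simp
        have 3: "\<i> * of_real (of_int p * y) = of_int p * ?z" by (simp add: mult_ac)
        show ?thesis
          using eta_quot_transform_prime[OF U1[OF b] \<sigma>(2)[OF b] 1] *
          unfolding 2 3 g_def r_def chi12_prime Leg[OF b] by (simp only: mult_ac)
      qed
      also have "\<dots> = of_int (Legendre 3 p) * of_int (Legendre (\<sigma> b) p) * (of_int (Legendre (-1) p) * g) * r * ?GM (\<sigma> b)"
        by (simp only: of_int_mult mult_ac)
      also have "of_int (Legendre (-1) p) * g = of_int p / g"
      proof -
        have "of_int (Legendre (-1) p) * g * g = of_int (Legendre (-1) p * Legendre (-1) p) * of_int p"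
          using g(2) by (simp add: mult.assoc)
        then show ?thesis using g(1) Legendre_minus_one_square by (simp add: field_simps)
      qed
      finally show "?FA b = (of_int p * r * of_int (Legendre 3 p) / g) * (of_int (Legendre (\<sigma> b) p) * ?GM (\<sigma> b))"
        by (simp add: mult_ac)
    qed
    also have "\<dots> = (\<Sum>b\<in>U1. (of_int p * r * of_int (Legendre 3 p) / g) * (of_int (Legendre b p) * ?GM b))"
      by (rule sum.reindex_bij_betw[OF \<sigma>(1)])
    also have "\<dots> = (of_int p * r * of_int (Legendre 3 p) / g) * (\<Sum>b\<in>U1. of_int (Legendre b p) * ?GM b)"
      by (rule sum_distrib_left[symmetric])
    finally have eq: "(\<Sum>b\<in>U1. ?FA b) =
       (of_int p * r * of_int (Legendre 3 p) / g) * (\<Sum>b\<in>U1. of_int (Legendre b p) * ?GM b)" .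
    show ?thesis unfolding eq using p0 by simp
  qed
  have M: "of_int (Legendre 6 p) / g * (\<Sum>b\<in>U1. of_int (Legendre b p) * ?FM b) =
      r * ((\<Sum>b\<in>U1. ?GA b) / of_int p)"
  proof -
    have "(\<Sum>b\<in>U1. of_int (Legendre b p) * ?FM b) =
        (\<Sum>b\<in>U1. (g * of_int (Legendre 6 p) * r / of_int p) * ?GA (\<sigma> b))"
    proof (intro sum.cong refl)
      fix b assume b: "b \<in> U1"
      have 1: "24 * of_int b + of_int p * ?w = 24 * of_int b + \<i> * of_real (1 / (2 * (y / of_int p)))"
        using p0 y by (simp add: field_simps)
      have 2: "(24 * of_int (\<sigma> b) + \<i> * of_real (y / of_int p)) / of_int p = (24 * of_int (p * \<sigma> b) + ?z) / of_int (p\<^sup>2)"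
        using p0 by (simp add: field_simps power2_eq_square)
      have 3: "complex_of_real (sqrt (y / of_int p / of_int p)) / 2 = r / of_int p"
        using p0 by (simp add: r_def real_sqrt_divide)
      have "?FM b =
         of_int (Legendre 3 p * Legendre (2 * b) p) * g * (r / of_int p) * ?GA (\<sigma> b)"
        unfolding 1 using eta_quot_transform_prime[OF U1[OF b] \<sigma>(2)[OF b], of "y / of_int p"] p0 y
        unfolding 2 3 by (simp add: g_def chi12_prime)
      moreover have "Legendre b p * (Legendre 3 p * Legendre (2 * b) p) = Legendre 6 p"
      proof -
        have "Legendre 6 p = Legendre 3 p * Legendre 2 p"
          using Legendre_mult[OF p(1) p2, of 3 2] by simp
        then show ?thesis
          using Legendre_mult_self[OF p(1) p2 U1[OF b]] by (simp add: Legendre_mult[OF p(1) p2] mult_ac)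
      qed
      then have "complex_of_int (Legendre b p) * of_int (Legendre 3 p * Legendre (2 * b) p) = of_int (Legendre 6 p)"
        by (metis of_int_mult)
      ultimately show "of_int (Legendre b p) * ?FM b = (g * of_int (Legendre 6 p) * r / of_int p) * ?GA (\<sigma> b)"
        by (simp add: mult.assoc[symmetric])
    qed
    also have "\<dots> = (\<Sum>b\<in>U1. (g * of_int (Legendre 6 p) * r / of_int p) * ?GA b)"
      by (rule sum.reindex_bij_betw[OF \<sigma>(1)])
    finally have eq: "(\<Sum>b\<in>U1. of_int (Legendre b p) * ?FM b) =
      (g * of_int (Legendre 6 p) * r / of_int p) * (\<Sum>b\<in>U1. ?GA b)"
      by (simp only: sum_distrib_left)
    have "\<not> p dvd 2 * 3" using not_dvd_2 not_dvd_3 p(1) prime_dvd_mult_iff by blast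
    then have "complex_of_int (Legendre 6 p) * of_int (Legendre 6 p) = 1"
      using Legendre_mult_self[OF p(1) p2, of 6] by (metis of_int_1 of_int_mult mult_numeral_1 numeral_times_numeral semiring_norm(12,13) num_double)
    then show ?thesis unfolding eq using g(1) by (simp add: field_simps)
  qed
  have L: "(\<Sum>b\<in>{0..<p}. of_int (Legendre b p) * h b) = (\<Sum>b\<in>U1. of_int (Legendre b p) * h b)" for h :: "int \<Rightarrow> complex"
    by (rule sum.mono_neutral_right) (auto simp: U1_def coprime_prime_iff Legendre_eq_0_iff[OF p(1) p2])
  \<comment> \<open>The five relations combined over opaque numbers: x and y name the three classes
    of translates for F and G, m the twisted sums, v the terms at p^2 w.\<close>
  have alg: "(x0 + x1 + x2) / P + m + v = r * ((y0 + y1 + y2) / P + m' + v')"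
    if "x0 = P * r * v'" "x1 / P = r * m'" "x2 = r * y2" "m = r * (y1 / P)" "v = r * y0 / P" "P \<noteq> 0"
    for x0 x1 x2 m v y0 y1 y2 m' v' P :: complex
    using that by (simp add: add_divide_distrib ring_distribs)
  show ?thesis unfolding hecke_def L g_def[symmetric] r_def[symmetric]
    unfolding sum_prime_square_split U1_def[symmetric] U2_def[symmetric]
    by (rule alg[OF A0 A1 A2 M V]) (use p0 in simp)
qed

end

section \<open>A vanishing principle\<close>

lemma qexp_of_int [simp]: "qexp (of_int k) = 1"
  using qexp_of_int_divide[of k 1] unity_root_self[of 1 k] by simp

lemma qexp_surj:
  assumes "q \<noteq> 0" "norm q < 1"
  obtains w where "Im w > 0" "qexp w = q"
proof -
  define w where "w = Ln q / (2 * of_real pi * \<i>)"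
  have "qexp w = q" using assms by (simp add: qexp_def w_def)
  moreover from this have "exp (- 2 * pi * Im w) < 1" using assms norm_qexp[of w] by simp
  then have "Im w > 0" by (simp add: zero_less_mult_iff)
  ultimately show ?thesis using that by blast
qed

lemma qexp_holomorphic [holomorphic_intros]:
  "f holomorphic_on S \<Longrightarrow> (\<lambda>z. qexp (f z)) holomorphic_on S"
  unfolding qexp_def by (intro holomorphic_intros)

text \<open>Translate to |Re z| \<le> 1/2. If the height is below 1/4, then |z|^2 \<le> 1/4 + 1/16 =
  5/16 and the involution multiplies the height by 1 / (2 |z|^2) \<ge> 8/5. Finitely many rounds
  reach height 1/4; the induction counts them through the bound (5/8)^n / 4.\<close>

lemma fricke_reduction:
  fixes K :: "complex \<Rightarrow> real"
  assumes shift: "\<And>z k. Im z > 0 \<Longrightarrow> K (z - of_int k) = K z"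
    and fricke: "\<And>z. Im z > 0 \<Longrightarrow> K (- 1 / (2 * z)) = K z"
    and z: "Im z > 0"
  obtains z' where "Im z' \<ge> 1 / 4" "K z' = K z"
proof -
  have *: "\<exists>z'. Im z' \<ge> 1 / 4 \<and> K z' = K z" if "Im z \<ge> (5 / 8) ^ n / 4" for n z
    using that
  proof (induction n arbitrary: z)
    case (Suc n)
    show ?case
    proof (cases "Im z \<ge> 1 / 4")
      case False
      have pos: "Im z > 0" using Suc.prems by (smt (verit) divide_pos_pos zero_less_power)
      define z1 where "z1 = z - of_int (round (Re z))"
      have im: "Im z1 = Im z" by (simp add: z1_def)
      have "\<bar>Re z1\<bar> \<le> 1 / 2"
        using of_int_round_abs_le[of "Re z"] by (simp add: z1_def abs_minus_commute)
      then have "(Re z1)\<^sup>2 \<le> (1 / 2)\<^sup>2" by (metis abs_ge_zero power2_abs power_mono)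
      moreover have "(Im z1)\<^sup>2 \<le> (1 / 4)\<^sup>2" using False pos im by (intro power_mono) auto
      ultimately have n1: "(norm z1)\<^sup>2 \<le> 5 / 16" by (simp add: cmod_power2 power_divide)
      have n0: "(norm z1)\<^sup>2 > 0" using pos im by (metis zero_less_norm_iff complex.sel(2) less_irrefl zero_complex.sel(2) zero_less_power)
      define z2 where "z2 = - 1 / (2 * z1)"
      have "Im z2 = Im z1 / (2 * (norm z1)\<^sup>2)"
        unfolding z2_def cmod_power2 using n0[unfolded cmod_power2]
        by (simp add: Im_divide power_mult_distrib divide_simps)
      also have "\<dots> \<ge> Im z1 / (5 / 8)"
        using n0 n1 pos im by (intro divide_left_mono) auto
      finally have "Im z2 \<ge> (5 / 8) ^ n / 4" using Suc.prems im by simp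
      then obtain z' where "Im z' \<ge> 1 / 4" "K z' = K z2" using Suc.IH by blast
      moreover have "K z2 = K z" using fricke[of z1] shift[of z "round (Re z)"] pos im
        by (simp add: z2_def z1_def)
      ultimately show ?thesis by auto
    qed auto
  qed auto
  have "(\<lambda>n. (5 / 8 :: real) ^ n / 4) \<longlonglongrightarrow> 0 / 4"
    by (intro tendsto_divide LIMSEQ_realpow_zero tendsto_const) auto
  then have "eventually (\<lambda>n. (5 / 8 :: real) ^ n / 4 < Im z) sequentially"
    using z by (intro order_tendstoD(2)) auto
  then obtain n where "(5 / 8 :: real) ^ n / 4 < Im z" by (auto simp: eventually_sequentially)
  then show ?thesis using *[of n z] that by auto
qed

text \<open>The maximum K of |H| and |H'| is invariant under translation and involution, so by
  \<open>fricke_reduction\<close> its supremum is attained on a compact disc. By the maximum modulus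
  principle the function attaining it is constant; after a swap this is H', whose value at the cusp
  q = 0 is 0.\<close>

theorem fricke_pair_vanishes:
  assumes H: "H holomorphic_on ball 0 1" and H': "H' holomorphic_on ball 0 1"
    and imag: "\<And>y. y > 0 \<Longrightarrow> H (qexp (\<i> * of_real (1 / (2 * y)))) = H' (qexp (\<i> * of_real y))"
    and zero: "H' 0 = 0" and q: "norm q < 1"
  shows "H q = 0"
proof -
  have Im_fricke: "Im (- 1 / (2 * z)) > 0" if "Im z > 0" for z
    using that by (auto simp: Im_divide intro!: divide_pos_pos) (smt (verit) sum_power2_gt_zero_iff)
  \<comment> \<open>The hypothesis covers the imaginary axis only; the identity theorem spreads it
    over the upper half-plane.\<close>
  have swap: "H (qexp (- 1 / (2 * z))) = H' (qexp z)" if z: "Im z > 0" for z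
  proof -
    let ?f = "\<lambda>z. H (qexp (- 1 / (2 * z))) - H' (qexp z)"
    have "?f z = 0"
    proof (rule analytic_continuation[of ?f "{z. Im z > 0}" "{z. Re z = 0 \<and> Im z > 0}" \<i>])
      have 1: "(\<lambda>z. H (qexp (- 1 / (2 * z)))) holomorphic_on {z. Im z > 0}"
      proof (rule holomorphic_on_compose_gen[of _ _ H "ball 0 1", unfolded o_def])
        show "(\<lambda>z. qexp (- 1 / (2 * z))) holomorphic_on {z. Im z > 0}"
          by (intro holomorphic_intros) auto
        show "(\<lambda>z. qexp (- 1 / (2 * z))) ` {z. Im z > 0} \<subseteq> ball 0 1"
          using Im_fricke norm_qexp_less_1 by auto
      qed (rule H)
      have 2: "(\<lambda>z. H' (qexp z)) holomorphic_on {z. Im z > 0}"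
      proof (rule holomorphic_on_compose_gen[of _ _ H' "ball 0 1", unfolded o_def])
        show "qexp holomorphic_on {z. Im z > 0}"
          using qexp_holomorphic[of "\<lambda>z. z"] by (simp add: holomorphic_on_ident)
        show "qexp ` {z. Im z > 0} \<subseteq> ball 0 1" using norm_qexp_less_1 by auto
      qed (rule H')
      show "?f holomorphic_on {z. Im z > 0}" using 1 2 by (intro holomorphic_intros)
      show "connected {z. Im z > 0}" by (intro convex_connected convex_halfspace_Im_gt)
      show "\<i> islimpt {z. Re z = 0 \<and> Im z > 0}"
        unfolding islimpt_approachable
      proof safe
        fix e :: real assume "e > 0"
        then show "\<exists>x'\<in>{z. Re z = 0 \<and> 0 < Im z}. x' \<noteq> \<i> \<and> dist x' \<i> < e"
          by (intro bexI[of _ "\<i> * of_real (1 + e / 2)"]) (auto simp: dist_norm ring_distribs norm_mult complex_eq_iff)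
      qed
      fix x assume "x \<in> {z. Re z = 0 \<and> Im z > 0}"
      then have x: "x = \<i> * of_real (Im x)" "Im x > 0" by (auto simp: complex_eq_iff)
      have "- 1 / (2 * x) = \<i> * of_real (1 / (2 * Im x))"
        by (subst x(1)) (use x(2) in \<open>simp add: field_simps\<close>)
      then show "?f x = 0" using imag[OF x(2)] x(1) by simp
    qed (use z open_halfspace_Im_gt in auto)
    then show ?thesis by simp
  qed
  define K where "K z = max (norm (H (qexp z))) (norm (H' (qexp z)))" for z
  have K_fricke: "K (- 1 / (2 * z)) = K z" if z: "Im z > 0" for z
  proof -
    have "- 1 / (2 * (- 1 / (2 * z))) = z" using z by auto
    then have "H' (qexp (- 1 / (2 * z))) = H (qexp z)" using swap[OF Im_fricke[OF z]] by simp
    then show ?thesis using swap[OF z] by (simp add: K_def max.commute)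
  qed
  have K_shift: "K (z - of_int k) = K z" for z k
    using qexp_add[of z "of_int (- k)"] qexp_of_int[of "- k"] by (simp add: K_def)
  \<comment> \<open>The value of |q| at height 1/4.\<close>
  define \<rho> where "\<rho> = exp (- pi / 2)"
  have \<rho>: "0 < \<rho>" "\<rho> < 1" by (auto simp: \<rho>_def)
  define k where "k q = max (norm (H q)) (norm (H' q))" for q
  have kb: "norm (H q) \<le> k q" "norm (H' q) \<le> k q" for q by (simp_all add: k_def)
  have "continuous_on (cball 0 \<rho>) k" unfolding k_def
    by (intro continuous_intros holomorphic_on_imp_continuous_on[OF holomorphic_on_subset[OF H]]
         holomorphic_on_imp_continuous_on[OF holomorphic_on_subset[OF H']]) (use \<rho> in auto)
  then obtain q0 where q0: "q0 \<in> cball 0 \<rho>" "\<And>q. q \<in> cball 0 \<rho> \<Longrightarrow> k q \<le> k q0"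
    using continuous_attains_sup[of "cball 0 \<rho>" k] \<rho> by auto
  have max: "k q \<le> k q0" if q: "norm q < 1" for q
  proof (cases "q = 0")
    case False
    obtain w where w: "Im w > 0" "qexp w = q" by (rule qexp_surj[OF False q])
    obtain z where z: "Im z \<ge> 1 / 4" "K z = K w"
      by (rule fricke_reduction[OF K_shift K_fricke w(1)])
    have "- 2 * pi * Im z \<le> - 2 * pi * (1 / 4)" using z(1) by (intro mult_left_mono_neg) auto
    then have "norm (qexp z) \<le> \<rho>" by (simp add: norm_qexp \<rho>_def)
    then have "k (qexp z) \<le> k q0" by (intro q0(2)) auto
    moreover have "k (qexp z) = K z" "k q = K w" using w(2) by (simp_all add: K_def k_def)
    ultimately show ?thesis using z(2) by simp
  qed (use q0(2)[of 0] \<rho> in auto)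
  have const: "f q = f x" if f: "f holomorphic_on ball 0 1" and x: "norm x < 1" "\<And>q. norm q < 1 \<Longrightarrow> norm (f q) \<le> norm (f x)" and q: "norm q < 1" for f :: "complex \<Rightarrow> complex" and x q
  proof -
    have "f constant_on ball 0 1"
      by (rule maximum_modulus_principle[OF f _ _ _ subset_refl, of x]) (use x in auto)
    then show ?thesis using q x by (auto simp: constant_on_def)
  qed
  \<comment> \<open>If H attains the maximum, it is constant, and \<open>swap\<close> at z = i
    carries the value over to H'; otherwise q0 itself serves.\<close>
  have "\<exists>x. norm x < 1 \<and> norm (H' x) = k q0"
  proof (cases "norm (H q0) = k q0")
    case True
    define x where "x = qexp \<i>"
    have x: "norm x < 1" by (simp add: x_def norm_qexp_less_1)
    have "H (qexp (- 1 / (2 * \<i>))) = H q0"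
    proof (rule const[OF H])
      show "norm (H q) \<le> norm (H q0)" if "norm q < 1" for q
        using max[OF that] kb(1)[of q] True by linarith
      show "norm (qexp (- 1 / (2 * \<i>))) < 1" by (rule norm_qexp_less_1) simp
      show "norm q0 < 1" using q0(1) \<rho> by simp
    qed
    then have "norm (H' x) = k q0" using swap[of \<i>] True by (simp add: x_def)
    then show ?thesis using x by blast
  next
    case False
    moreover have "k q0 = norm (H q0) \<or> k q0 = norm (H' q0)" by (simp add: k_def max_def)
    ultimately have "norm (H' q0) = k q0" by simp
    then show ?thesis using q0(1) \<rho> by (intro exI[of _ q0]) simp
  qed
  then obtain x where x: "norm x < 1" "norm (H' x) = k q0" by blast
  have "H' 0 = H' x"
  proof (rule const[OF H' x(1)])
    show "norm (H' q) \<le> norm (H' x)" if "norm q < 1" for q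
      using max[OF that] kb(2)[of q] x(2) by linarith
  qed simp
  then have "k q0 = 0" using zero x(2) by simp
  then have "norm (H q) \<le> 0" using max[OF q] kb(1)[of q] by linarith
  then show ?thesis by simp
qed

section \<open>Fourier expansions of the Hecke images\<close>

text \<open>Every q with 0 < |q| < 1 is some \<open>qexp w\<close>, so an expansion known in w
  converges on the whole disc; at q = 0 only the constant coefficient contributes.\<close>

lemma disc_fps_of_sums:
  assumes "\<And>w. Im w > 0 \<Longrightarrow> (\<lambda>n. of_int (c n) * qexp w ^ n) sums S w"
  shows "\<exists>\<phi>. disc_fps (Abs_fps c) \<phi> \<and> (\<forall>w. Im w > 0 \<longrightarrow> S w = \<phi> (qexp w))"
proof -
  define \<phi> where "\<phi> q = (\<Sum>n. of_int (c n) * q ^ n)" for q :: complex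
  have "(\<lambda>n. of_int (c n) * q ^ n) sums \<phi> q" if q: "norm q < 1" for q
  proof (cases "q = 0")
    case True
    then show ?thesis using powser_sums_zero[of "\<lambda>n. complex_of_int (c n)"] unfolding \<phi>_def
      by (auto simp: sums_iff)
  next
    case False
    obtain w where "Im w > 0" "qexp w = q" by (rule qexp_surj[OF False q])
    then show ?thesis using assms[of w] by (auto simp: sums_iff \<phi>_def)
  qed
  then have "disc_fps (Abs_fps c) \<phi>" by (simp add: disc_fps_def)
  moreover have "S w = \<phi> (qexp w)" if "Im w > 0" for w
    using assms[OF that] by (simp add: sums_iff \<phi>_def)
  ultimately show ?thesis by blast
qed

lemma Im_divide_of_int: "Im (z / of_int c) = Im z / of_int c"
  by (metis Im_divide_of_real of_real_of_int_eq)

text \<open>Averaging over b isolates the exponents divisible by p^2, and p^2 / p leaves the factor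
  p. The offset h will be 4 for F and -1 for G.\<close>

lemma hecke_U_sums:
  assumes f: "\<And>w. Im w > 0 \<Longrightarrow> (\<lambda>n. of_int (a n) * qexp (w * of_int (24 * int n + h) / 24)) sums f w"
    and p: "p > 0" and w: "Im w > 0"
  shows "(\<lambda>n. if p\<^sup>2 dvd 24 * int n + h
             then of_int (p * a n) * qexp (w * of_int (24 * int n + h) / (24 * of_int (p\<^sup>2))) else 0)
      sums ((\<Sum>b\<in>{0..<p\<^sup>2}. f ((24 * of_int b + w) / of_int (p\<^sup>2))) / of_int p)"
proof -
  have "Im ((24 * of_int b + w) / of_int (p\<^sup>2)) > 0" for b
    unfolding Im_divide_of_int using w p by simp
  then have "(\<lambda>n. (\<Sum>b\<in>{0..<p\<^sup>2}. of_int (a n) * qexp ((24 * of_int b + w) / of_int (p\<^sup>2) * of_int (24 * int n + h) / 24)) / of_int p)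
     sums ((\<Sum>b\<in>{0..<p\<^sup>2}. f ((24 * of_int b + w) / of_int (p\<^sup>2))) / of_int p)"
    by (intro sums_divide sums_sum f)
  moreover have "(\<Sum>b\<in>{0..<p\<^sup>2}. of_int (a n) * qexp ((24 * of_int b + w) / of_int (p\<^sup>2) * of_int (24 * int n + h) / 24)) / of_int p =
     (if p\<^sup>2 dvd 24 * int n + h
             then of_int (p * a n) * qexp (w * of_int (24 * int n + h) / (24 * of_int (p\<^sup>2))) else 0)" for n
  proof -
    define e where "e = 24 * int n + h"
    have "qexp ((24 * of_int b + w) / of_int (p\<^sup>2) * of_int e / 24) = qexp (w * of_int e / (24 * of_int (p\<^sup>2))) * unity_root (p\<^sup>2) (e * b)" for b
    proof -
      have "(24 * of_int b + w) / of_int (p\<^sup>2) * of_int e / 24 = w * of_int e / (24 * of_int (p\<^sup>2)) + of_int (e * b) / of_int (p\<^sup>2)"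
        using p by (simp add: field_simps)
      then show ?thesis by (simp only: qexp_add qexp_of_int_divide)
    qed
    then have "(\<Sum>b\<in>{0..<p\<^sup>2}. of_int (a n) * qexp ((24 * of_int b + w) / of_int (p\<^sup>2) * of_int e / 24)) =
      of_int (a n) * qexp (w * of_int e / (24 * of_int (p\<^sup>2))) * (\<Sum>b\<in>{0..<p\<^sup>2}. unity_root (p\<^sup>2) (e * b))"
      by (simp add: sum_distrib_left mult.assoc)
    also have "(\<Sum>b\<in>{0..<p\<^sup>2}. unity_root (p\<^sup>2) (e * b)) = (if p\<^sup>2 dvd e then of_int (p\<^sup>2) else 0)"
      using p by (intro sum_unity_root) simp
    finally show ?thesis using p by (simp add: e_def[symmetric] power2_eq_square)
  qed
  ultimately show ?thesis by simp
qed

text \<open>\<open>gauss_sum_twist\<close> converts the weighted sum over b into (e/p) times the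
  Gauss sum, which the definition of \<open>hecke\<close> divides out.\<close>

lemma hecke_M_sums:
  assumes f: "\<And>w. Im w > 0 \<Longrightarrow> (\<lambda>n. of_int (a n) * qexp (w * of_int (24 * int n + h) / 24)) sums f w"
    and p: "prime p" "p > 3" and w: "Im w > 0"
  shows "(\<lambda>n. of_int (s * Legendre (24 * int n + h) p * a n) * qexp (w * of_int (24 * int n + h) / 24))
      sums (of_int s / gauss_sum p * (\<Sum>b\<in>{0..<p}. of_int (Legendre b p) * f ((24 * of_int b + of_int p * w) / of_int p)))"
proof -
  have p2: "p > 2" using p by simp
  have "Im ((24 * of_int b + of_int p * w) / of_int p) > 0" for b
    unfolding Im_divide_of_int using w p by simp
  then have "(\<lambda>n. of_int s / gauss_sum p * (\<Sum>b\<in>{0..<p}. of_int (Legendre b p) * (of_int (a n) * qexp ((24 * of_int b + of_int p * w) / of_int p * of_int (24 * int n + h) / 24))))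
     sums (of_int s / gauss_sum p * (\<Sum>b\<in>{0..<p}. of_int (Legendre b p) * f ((24 * of_int b + of_int p * w) / of_int p)))"
    by (intro sums_mult sums_sum f)
  moreover have "of_int s / gauss_sum p * (\<Sum>b\<in>{0..<p}. of_int (Legendre b p) * (of_int (a n) * qexp ((24 * of_int b + of_int p * w) / of_int p * of_int (24 * int n + h) / 24))) =
     of_int (s * Legendre (24 * int n + h) p * a n) * qexp (w * of_int (24 * int n + h) / 24)" for n
  proof -
    define e where "e = 24 * int n + h"
    have "qexp ((24 * of_int b + of_int p * w) / of_int p * of_int e / 24) = qexp (w * of_int e / 24) * unity_root p (e * b)" for b
    proof -
      have "(24 * of_int b + of_int p * w) / of_int p * of_int e / 24 = w * of_int e / 24 + of_int (e * b) / of_int p"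
        using p by (simp add: field_simps)
      then show ?thesis by (simp only: qexp_add qexp_of_int_divide)
    qed
    then have "(\<Sum>b\<in>{0..<p}. of_int (Legendre b p) * (of_int (a n) * qexp ((24 * of_int b + of_int p * w) / of_int p * of_int e / 24))) =
      of_int (a n) * qexp (w * of_int e / 24) * (\<Sum>b\<in>{0..<p}. of_int (Legendre b p) * unity_root p (e * b))"
      by (simp add: sum_distrib_left mult_ac)
    also have "\<dots> = of_int (a n) * qexp (w * of_int e / 24) * (of_int (Legendre e p) * gauss_sum p)"
      by (simp only: gauss_sum_twist[OF p(1) p2])
    finally show ?thesis using gauss_sum_nonzero[OF p] by (simp add: e_def[symmetric])
  qed
  ultimately show ?thesis by simp
qed

section \<open>The congruence\<close>

lemma eta_quot_eq: "eta_quot w = qexp (w / 6) * (euler ((qexp w)\<^sup>2) ^ 3 / euler (qexp w) ^ 2)"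
proof -
  define x where "x = qexp (w / 24)"
  have "qexp (w / 6) = x ^ 4" "qexp (2 * w / 24) = x ^ 2" "qexp (2 * w) = (qexp w)\<^sup>2"
    using qexp_of_nat_mult[of 4 "w / 24"] qexp_of_nat_mult[of 2 "w / 24"] qexp_of_nat_mult[of 2 w]
    by (simp_all add: x_def)
  moreover have "x \<noteq> 0" by (simp add: x_def)
  moreover have "(x\<^sup>2 * a) ^ 3 / (x * b)\<^sup>2 = x ^ 4 * (a ^ 3 / b\<^sup>2)" if "x \<noteq> 0" for a b
  proof -
    have "(x\<^sup>2) ^ 3 = x\<^sup>2 * x ^ 4" by (simp flip: power_mult power_add)
    then show ?thesis unfolding power_mult_distrib mult.assoc using that
      by (simp only: mult.assoc) (subst mult_divide_mult_cancel_left; simp)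
  qed
  ultimately show ?thesis unfolding eta_quot_def eta_def x_def[symmetric] by simp
qed

text \<open>In units of 1/24 the leading exponent is 3 - 2 * 2 = -1, against 2 * 3 - 2 = 4 for
  \<open>eta_quot\<close>; the negative sign is the source of the pole.\<close>

lemma eta_quot'_eq: "eta_quot' w = qexp (- w / 24) * (euler (qexp w) ^ 3 / euler ((qexp w)\<^sup>2) ^ 2)"
proof -
  define x where "x = qexp (w / 24)"
  have "qexp (2 * w / 24) = x ^ 2" "qexp (2 * w) = (qexp w)\<^sup>2"
    using qexp_of_nat_mult[of 2 "w / 24"] qexp_of_nat_mult[of 2 w]
    by (simp_all add: x_def)
  moreover have "x \<noteq> 0" by (simp add: x_def)
  moreover have "qexp (- w / 24) = inverse x"
    using qexp_add[of "w / 24" "- w / 24"] by (simp add: x_def inverse_unique)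
  moreover have "(x * b) ^ 3 / (x\<^sup>2 * a)\<^sup>2 = inverse x * (b ^ 3 / a\<^sup>2)" if "x \<noteq> 0" for a b
  proof -
    have "(x\<^sup>2)\<^sup>2 = x ^ 3 * x" by (simp add: power2_eq_square power3_eq_cube)
    then show ?thesis using that by (simp add: power_mult_distrib mult.assoc) (simp add: divide_inverse mult_ac)
  qed
  ultimately show ?thesis unfolding eta_quot'_def eta_def x_def[symmetric] by simp
qed

text \<open>The function t of the overview, written in q: the 24th power turns the q^(1/24) of the
  eta quotient into q.\<close>

definition hauptmodul :: "complex \<Rightarrow> complex" where
  "hauptmodul q = q * (euler (q\<^sup>2) / euler q) ^ 24"

text \<open>Inversion contributes sqrt y from eta (2 w) and sqrt (2 y) from eta w, so the two eta
  quotients multiply to 1 / sqrt 2. Its 24th power is 2^(-12), the origin of the modulus.\<close>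

lemma hauptmodul_fricke:
  assumes y: "y > 0"
  shows "2 ^ 12 * hauptmodul (qexp (\<i> * of_real (1 / (2 * y)))) * hauptmodul (qexp (\<i> * of_real y)) = 1"
proof -
  have eq: "hauptmodul (qexp w) = (eta (2 * w) / eta w) ^ 24" for w
  proof -
    define x where "x = qexp (w / 24)"
    have "qexp w = x ^ 24" "qexp (2 * w / 24) = x ^ 2" "qexp (2 * w) = (qexp w)\<^sup>2" "x \<noteq> 0"
      using qexp_of_nat_mult[of 24 "w / 24"] qexp_of_nat_mult[of 2 "w / 24"] qexp_of_nat_mult[of 2 w]
      by (simp_all add: x_def)
    then have "eta (2 * w) / eta w = x * (euler ((qexp w)\<^sup>2) / euler (qexp w))"
      unfolding eta_def x_def[symmetric] by (simp add: power2_eq_square)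
    then have "(eta (2 * w) / eta w) ^ 24 = x ^ 24 * (euler ((qexp w)\<^sup>2) / euler (qexp w)) ^ 24"
      by (simp only: power_mult_distrib)
    then show ?thesis using \<open>qexp w = x ^ 24\<close> by (simp only: hauptmodul_def)
  qed
  have 1: "eta (\<i> * of_real (1 / t)) = of_real (sqrt t) * eta (\<i> * of_real t)" if "t > 0" for t
  proof -
    have "eta_factor 1 0 = 1" by (simp add: eta_factor_def quad_gauss_sum_def chi12_def)
    then show ?thesis using eta_transform[of 1 0 0 t] that by simp
  qed
  define w z where "w = \<i> * complex_of_real (1 / (2 * y))" and "z = \<i> * complex_of_real y"
  have nz: "eta v \<noteq> 0" if "Im v > 0" for v
    using euler_nonzero norm_qexp_less_1[OF that] by (simp add: eta_def)
  have z: "eta z \<noteq> 0" "eta (2 * z) \<noteq> 0" using y by (auto intro!: nz simp: z_def)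
  have "2 * w = \<i> * of_real (1 / y)" by (simp add: w_def)
  then have w1: "eta (2 * w) = of_real (sqrt y) * eta z" using 1[OF y] by (simp add: z_def)
  have "eta w = of_real (sqrt (2 * y)) * eta (\<i> * of_real (2 * y))" using 1[of "2 * y"] y by (simp add: w_def)
  also have "\<i> * of_real (2 * y) = 2 * z" by (simp add: z_def)
  finally have w2: "eta w = of_real (sqrt (2 * y)) * eta (2 * z)" .
  have "eta (2 * w) / eta w = of_real (sqrt y / sqrt (2 * y)) * (eta z / eta (2 * z))"
    by (simp add: w1 w2)
  also have "sqrt y / sqrt (2 * y) = 1 / sqrt 2" using y by (simp add: real_sqrt_mult)
  finally have "(eta (2 * w) / eta w) * (eta (2 * z) / eta z) = of_real (1 / sqrt 2)"
    using z by simp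
  then have "((eta (2 * w) / eta w) * (eta (2 * z) / eta z)) ^ 24 = of_real ((1 / sqrt 2) ^ 24)"
    by (simp only: of_real_power)
  also have "(1 / sqrt 2) ^ 24 = (1 / 2 ^ 12 :: real)"
  proof -
    have "(1 / sqrt 2) ^ 24 = ((1 / sqrt 2)\<^sup>2) ^ 12" by (simp only: power_mult[symmetric]) simp
    then show ?thesis by (simp add: power_divide)
  qed
  finally have "(eta (2 * w) / eta w) ^ 24 * (eta (2 * z) / eta z) ^ 24 = 1 / 2 ^ 12"
    by (simp only: power_mult_distrib of_real_divide of_real_1 of_real_power of_real_numeral)
  then show ?thesis unfolding w_def[symmetric] z_def[symmetric] eq by (simp add: mult_ac)
qed

text \<open>The power (X * E)^j begins with X^j and coefficient 1, so each r j is read off as the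
  next coefficient of the remainder without division; this keeps the polynomial P integral.\<close>

lemma expand_in_powers:
  fixes S E :: "int fps"
  assumes E: "fps_nth E 0 = 1"
  shows "\<exists>r. fps_X ^ n dvd S - (\<Sum>j<n. fps_const (r j) * (fps_X * E) ^ j)"
proof (induction n)
  case (Suc n)
  then obtain r where r: "fps_X ^ n dvd S - (\<Sum>j<n. fps_const (r j) * (fps_X * E) ^ j)" by blast
  define D where "D = S - (\<Sum>j<n. fps_const (r j) * (fps_X * E) ^ j)"
  define r' where "r' = r(n := fps_nth D n)"
  have eq: "S - (\<Sum>j<Suc n. fps_const (r' j) * (fps_X * E) ^ j) = D - fps_const (fps_nth D n) * (fps_X * E) ^ n"
  proof -
    have "(\<Sum>j<n. fps_const (r' j) * (fps_X * E) ^ j) = (\<Sum>j<n. fps_const (r j) * (fps_X * E) ^ j)"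
      by (intro sum.cong) (auto simp: r'_def)
    then show ?thesis by (simp add: D_def r'_def)
  qed
  have "fps_nth (D - fps_const (fps_nth D n) * (fps_X * E) ^ n) i = 0" if i: "i < Suc n" for i
  proof (cases "i = n")
    case True
    then show ?thesis using E by (simp add: power_mult_distrib fps_X_power_mult_nth fps_nth_power_0)
  next
    case False
    then have "i < n" using i by simp
    then have "fps_nth D i = 0" using r unfolding D_def[symmetric] fps_X_power_dvd_iff_nth by blast
    moreover have "fps_nth ((fps_X * E) ^ n) i = 0"
      unfolding power_mult_distrib fps_X_power_mult_nth using \<open>i < n\<close> by (rule if_P)
    ultimately show ?thesis by (simp only: fps_sub_nth fps_mult_left_const_nth mult_zero_right diff_self)
  qed
  then have "fps_X ^ Suc n dvd S - (\<Sum>j<Suc n. fps_const (r' j) * (fps_X * E) ^ j)"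
    unfolding eq fps_X_power_dvd_iff_nth by blast
  then show ?case by blast
qed auto

lemma disc_fps_shift:
  assumes f: "disc_fps f \<phi>" and "fps_X ^ n dvd f"
  obtains g \<gamma> where "disc_fps g \<gamma>" "\<And>q. norm q < 1 \<Longrightarrow> \<phi> q = q ^ n * \<gamma> q"
proof -
  obtain g where g: "f = fps_X ^ n * g" using assms by (elim dvdE)
  have shift: "complex_fps g = fps_shift n (complex_fps f)"
    by (rule fps_ext) (simp add: g fps_X_power_mult_nth)
  have dg: "disc_fps g (eval_fps (complex_fps g))"
    using f unfolding disc_fps_iff shift by simp
  have "disc_fps f (\<lambda>q. q ^ n * eval_fps (complex_fps g) q)"
    unfolding g by (intro disc_fps_mult disc_fps_power disc_fps_X dg)
  then have "\<phi> q = q ^ n * eval_fps (complex_fps g) q" if "norm q < 1" for q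
    using disc_fps_eval[OF f that] disc_fps_eval[OF _ that] by metis
  then show ?thesis using dg that by blast
qed

lemma alpha_gf_nth_0: "fps_nth alpha_gf 0 = 1"
  using disc_fps_at_0[OF disc_fps_alpha] disc_fps_at_0[OF disc_fps_euler] by simp

lemma qexp_alpha_exponent: "qexp (w * of_int (24 * int n + 4) / 24) = qexp (w / 6) * qexp w ^ n"
proof -
  have "w * of_int (24 * int n + 4) / 24 = w / 6 + of_nat n * w" by (simp add: field_simps)
  then show ?thesis by (simp only: qexp_add qexp_of_nat_mult)
qed

lemma qexp_beta_exponent: "qexp (w * of_int (24 * int n + (-1)) / 24) = qexp (- w / 24) * qexp w ^ n"
proof -
  have "w * of_int (24 * int n + (-1)) / 24 = - w / 24 + of_nat n * w" by (simp add: field_simps)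
  then show ?thesis by (simp only: qexp_add qexp_of_nat_mult)
qed

lemma eta_quot_sums:
  assumes w: "Im w > 0"
  shows "(\<lambda>n. of_int (fps_nth alpha_gf n) * qexp (w * of_int (24 * int n + 4) / 24)) sums eta_quot w"
proof -
  have "(\<lambda>n. qexp (w / 6) * (of_int (fps_nth alpha_gf n) * qexp w ^ n)) sums eta_quot w"
    unfolding eta_quot_eq using disc_fps_alpha norm_qexp_less_1[OF w]
    by (intro sums_mult) (simp add: disc_fps_def)
  then show ?thesis unfolding qexp_alpha_exponent by (simp add: mult_ac)
qed

lemma beta_fps_exists:
  obtains B where "disc_fps B (\<lambda>q. euler q ^ 3 / euler (q\<^sup>2) ^ 2)"
proof -
  have "norm (q\<^sup>2) < 1" if "norm q < 1" for q :: complex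
    using that by (simp add: norm_power power_less_one_iff)
  then obtain g where "disc_fps g (\<lambda>q. inverse (euler (q\<^sup>2)))"
    using disc_fps_inverse[OF disc_fps_compose_X_power[OF disc_fps_euler, of 2]] euler_nonzero
    by (metis euler_fps_nth_0 fps_nth_compose_X_power div_0 dvd_0_right pos2)
  from disc_fps_mult[OF disc_fps_power[OF disc_fps_euler, of 3] disc_fps_power[OF this, of 2]]
  have "disc_fps (euler_fps ^ 3 * g ^ 2) (\<lambda>q. euler q ^ 3 / euler (q\<^sup>2) ^ 2)"
    by (simp add: field_simps)
  then show ?thesis by (rule that)
qed

lemma eta_quot'_sums:
  assumes B: "disc_fps B (\<lambda>q. euler q ^ 3 / euler (q\<^sup>2) ^ 2)" and w: "Im w > 0"
  shows "(\<lambda>n. of_int (fps_nth B n) * qexp (w * of_int (24 * int n + (-1)) / 24)) sums eta_quot' w"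
proof -
  have "(\<lambda>n. qexp (- w / 24) * (of_int (fps_nth B n) * qexp w ^ n)) sums eta_quot' w"
    unfolding eta_quot'_eq using B norm_qexp_less_1[OF w]
    by (intro sums_mult) (simp add: disc_fps_def)
  then show ?thesis unfolding qexp_beta_exponent by (simp add: mult_ac)
qed

section \<open>The Hecke images for l^2 = 24 M + 1\<close>

context
  fixes l M :: nat
  assumes l: "prime l" "l > 3" and M: "l\<^sup>2 = 24 * M + 1"
begin

private lemma p: "prime (int l)" "int l > 3"
  using l by auto

private lemma Legendre_4: "Legendre 4 (int l) = 1"
proof -
  have "\<not> int l dvd 2" using l by (auto dest!: zdvd_imp_le)
  then show ?thesis using Legendre_square[OF p(1), of 2] l by simp
qed

private lemma Mi: "(int l)\<^sup>2 = 24 * int M + 1"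
  using M by (metis of_nat_1 of_nat_add of_nat_mult of_nat_numeral of_nat_power)

private lemma M_pos: "M > 0"
proof (rule ccontr)
  assume "\<not> M > 0"
  then have "l\<^sup>2 = 1" using M by simp
  then show False using l by (simp add: power2_eq_square)
qed

private lemma coprime_24: "coprime ((int l)\<^sup>2) 24"
proof -
  have "gcd 24 (int M * 24 + 1) = gcd 24 1" by (rule gcd_add_mult)
  then have "coprime (24 * int M + 1) 24" by (simp add: coprime_iff_gcd_eq_1 gcd.commute[of 24] mult.commute)
  then show ?thesis by (simp add: Mi)
qed

text \<open>The series of q^(-1/6) F|T. Since l^2 * (24 n + 4) = 24 * (l^2 n + 4 M) + 4, index n of
  the first summand reads the coefficient at l^2 n + 4 M, and F(l^2 z) contributes the shift by 4
  M.\<close>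

definition hecke_alpha_fps :: "int fps" where
  "hecke_alpha_fps = Abs_fps (\<lambda>n. int l * fps_nth alpha_gf (l\<^sup>2 * n + 4 * M))
     + Abs_fps (\<lambda>n. Legendre 6 (int l) * Legendre (24 * int n + 4) (int l) * fps_nth alpha_gf n)
     + fps_X ^ (4 * M) * (alpha_gf oo fps_X ^ (l\<^sup>2))"

lemma hecke_alpha_disc:
  obtains \<phi> where "disc_fps hecke_alpha_fps \<phi>"
    "\<And>w. Im w > 0 \<Longrightarrow> hecke (int l) (of_int (Legendre 6 (int l))) eta_quot w = qexp (w / 6) * \<phi> (qexp w)"
proof -
  define UF where "UF w = (\<Sum>b\<in>{0..<(int l)\<^sup>2}. eta_quot ((24 * of_int b + w) / of_int ((int l)\<^sup>2))) / of_int (int l)" for w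
  define MF where "MF w = of_int (Legendre 6 (int l)) / gauss_sum (int l) * (\<Sum>b\<in>{0..<int l}. of_int (Legendre b (int l)) * eta_quot ((24 * of_int b + of_int (int l) * w) / of_int (int l)))" for w
  have l0: "l > 0" using l by simp
  have "(\<lambda>n. of_int (int l * fps_nth alpha_gf (l\<^sup>2 * n + 4 * M)) * qexp w ^ n) sums (UF w / qexp (w / 6))" if w: "Im w > 0" for w
  proof -
    let ?g = "\<lambda>n. if (int l)\<^sup>2 dvd 24 * int n + 4
             then of_int (int l * fps_nth alpha_gf n) * qexp (w * of_int (24 * int n + 4) / (24 * of_int ((int l)\<^sup>2))) else 0"
    have g: "?g sums UF w" unfolding UF_def
      by (rule hecke_U_sums[OF eta_quot_sums]) (use l0 w in auto)
    have mono: "strict_mono (\<lambda>n. l\<^sup>2 * n + 4 * M)" using l0 by (simp add: strict_mono_def)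
    \<comment> \<open>Coprimality of l^2 and 24 reduces the divisibility to n = 4 M modulo l^2; a
      negative multiple is excluded because it would make n negative.\<close>
    have out: "?g n = 0" if n: "n \<notin> range (\<lambda>n. l\<^sup>2 * n + 4 * M)" for n
    proof -
      have "\<not> (int l)\<^sup>2 dvd 24 * int n + 4"
      proof
        assume "(int l)\<^sup>2 dvd 24 * int n + 4"
        then have "(int l)\<^sup>2 dvd (24 * int n + 4) - 4 * (int l)\<^sup>2" by (rule dvd_diff) simp
        also have "(24 * int n + 4) - 4 * (int l)\<^sup>2 = 24 * (int n - 4 * int M)" by (simp add: Mi)
        finally have "(int l)\<^sup>2 dvd int n - 4 * int M"
          using coprime_dvd_mult_right_iff[OF coprime_24] by blast
        then obtain k where k: "int n - 4 * int M = (int l)\<^sup>2 * k" by (elim dvdE)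
        have "k \<ge> 0"
        proof (rule ccontr)
          assume "\<not> k \<ge> 0"
          then have "(int l)\<^sup>2 * k \<le> (int l)\<^sup>2 * (- 1)" by (intro mult_left_mono) auto
          then show False using k Mi by linarith
        qed
        then have "int n = int (l\<^sup>2 * nat k + 4 * M)" using k by simp
        then have "n = l\<^sup>2 * nat k + 4 * M" by (simp only: of_nat_eq_iff)
        then show False using n by blast
      qed
      then show ?thesis by simp
    qed
    have "(\<lambda>n. ?g (l\<^sup>2 * n + 4 * M)) sums UF w"
      using g out by (subst sums_mono_reindex[OF mono]) auto
    moreover have "?g (l\<^sup>2 * n + 4 * M) = of_int (int l * fps_nth alpha_gf (l\<^sup>2 * n + 4 * M)) * (qexp (w / 6) * qexp w ^ n)" for n
    proof -
      have e: "24 * int (l\<^sup>2 * n + 4 * M) + 4 = (int l)\<^sup>2 * (24 * int n + 4)"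
        using Mi by (simp add: algebra_simps)
      have "w * of_int ((int l)\<^sup>2 * (24 * int n + 4)) / (24 * of_int ((int l)\<^sup>2)) = w * of_int (24 * int n + 4) / 24"
        using l0 by (simp add: field_simps)
      then show ?thesis unfolding e qexp_alpha_exponent[symmetric] by (simp only: if_True dvd_triv_left)
    qed
    ultimately have "(\<lambda>n. of_int (int l * fps_nth alpha_gf (l\<^sup>2 * n + 4 * M)) * (qexp (w / 6) * qexp w ^ n)) sums UF w"
      by (simp only:)
    from sums_divide[OF this, of "qexp (w / 6)"] show ?thesis by (simp add: mult_ac)
  qed
  then have "\<exists>\<phi>. disc_fps (Abs_fps (\<lambda>n. int l * fps_nth alpha_gf (l\<^sup>2 * n + 4 * M))) \<phi> \<and> (\<forall>w. Im w > 0 \<longrightarrow> UF w / qexp (w / 6) = \<phi> (qexp w))"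
    by (rule disc_fps_of_sums)
  then obtain \<phi>1 where \<phi>1: "disc_fps (Abs_fps (\<lambda>n. int l * fps_nth alpha_gf (l\<^sup>2 * n + 4 * M))) \<phi>1"
      "\<And>w. Im w > 0 \<Longrightarrow> UF w / qexp (w / 6) = \<phi>1 (qexp w)"
    by blast
  have "(\<lambda>n. of_int (Legendre 6 (int l) * Legendre (24 * int n + 4) (int l) * fps_nth alpha_gf n) * qexp w ^ n) sums (MF w / qexp (w / 6))" if w: "Im w > 0" for w
    using sums_divide[OF hecke_M_sums[OF eta_quot_sums p w, of "Legendre 6 (int l)"], of "qexp (w / 6)"]
    unfolding MF_def[symmetric] qexp_alpha_exponent by (simp add: mult_ac)
  then have "\<exists>\<phi>. disc_fps (Abs_fps (\<lambda>n. Legendre 6 (int l) * Legendre (24 * int n + 4) (int l) * fps_nth alpha_gf n)) \<phi> \<and> (\<forall>w. Im w > 0 \<longrightarrow> MF w / qexp (w / 6) = \<phi> (qexp w))"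
    by (rule disc_fps_of_sums)
  then obtain \<phi>2 where \<phi>2: "disc_fps (Abs_fps (\<lambda>n. Legendre 6 (int l) * Legendre (24 * int n + 4) (int l) * fps_nth alpha_gf n)) \<phi>2"
      "\<And>w. Im w > 0 \<Longrightarrow> MF w / qexp (w / 6) = \<phi>2 (qexp w)"
    by blast
  define fa where "fa q = euler (q\<^sup>2) ^ 3 / euler q ^ 2" for q
  have \<phi>3: "disc_fps (fps_X ^ (4 * M) * (alpha_gf oo fps_X ^ (l\<^sup>2))) (\<lambda>q. q ^ (4 * M) * fa (q ^ (l\<^sup>2)))"
    unfolding fa_def using l0
    by (intro disc_fps_mult disc_fps_power disc_fps_X disc_fps_compose_X_power[OF disc_fps_alpha]) auto
  have V: "eta_quot (of_int ((int l)\<^sup>2) * w) = qexp (w / 6) * (qexp w ^ (4 * M) * fa (qexp w ^ (l\<^sup>2)))" for w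
  proof -
    have 1: "of_int ((int l)\<^sup>2) * w = of_nat (l\<^sup>2) * w" by simp
    have "of_nat (l\<^sup>2) * w / 6 = w / 6 + of_nat (4 * M) * w" unfolding M by (simp add: field_simps)
    then have "qexp (of_nat (l\<^sup>2) * w / 6) = qexp (w / 6) * qexp w ^ (4 * M)"
      by (simp only: qexp_add qexp_of_nat_mult)
    then show ?thesis unfolding 1 eta_quot_eq fa_def[symmetric] qexp_of_nat_mult by simp
  qed
  show ?thesis
  proof (rule that)
    show "disc_fps hecke_alpha_fps (\<lambda>q. \<phi>1 q + \<phi>2 q + q ^ (4 * M) * fa (q ^ (l\<^sup>2)))"
      unfolding hecke_alpha_fps_def by (intro disc_fps_add \<phi>1(1) \<phi>2(1) \<phi>3)
    fix w assume w: "Im w > 0"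
    show "hecke (int l) (of_int (Legendre 6 (int l))) eta_quot w = qexp (w / 6) * (\<phi>1 (qexp w) + \<phi>2 (qexp w) + qexp w ^ (4 * M) * fa (qexp w ^ (l\<^sup>2)))"
      unfolding hecke_def UF_def[symmetric] MF_def[symmetric] V \<phi>1(2)[OF w, symmetric] \<phi>2(2)[OF w, symmetric]
      by (simp add: ring_distribs)
  qed
qed

text \<open>The factor q^M clears the pole, which comes from G(l^2 w) alone: its leading exponent is
  -l^2 / 24 = -1/24 - M, while the other two terms begin at -1/24 or later.\<close>

lemma hecke_beta_disc:
  assumes B: "disc_fps B (\<lambda>q. euler q ^ 3 / euler (q\<^sup>2) ^ 2)"
  obtains b \<phi> where "disc_fps b \<phi>"
    "\<And>w. Im w > 0 \<Longrightarrow> hecke (int l) (of_int (Legendre 3 (int l))) eta_quot' w = qexp (- w / 24) / qexp w ^ M * \<phi> (qexp w)"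
proof -
  define UF where "UF w = (\<Sum>b\<in>{0..<(int l)\<^sup>2}. eta_quot' ((24 * of_int b + w) / of_int ((int l)\<^sup>2))) / of_int (int l)" for w
  define MF where "MF w = of_int (Legendre 3 (int l)) / gauss_sum (int l) * (\<Sum>b\<in>{0..<int l}. of_int (Legendre b (int l)) * eta_quot' ((24 * of_int b + of_int (int l) * w) / of_int (int l)))" for w
  have l0: "l > 0" using l by simp
  \<comment> \<open>l^2 divides 24 n - 1 exactly when n = -M modulo l^2, and the least such index is
    l^2 - M. The quotient at \<open>s n\<close> is 24 (n + 1) - 1, so this series starts one power
    of q later; hence the division by \<open>qexp w\<close> below and \<open>Suc M\<close> at the
    end.\<close>
  define s where "s n = l\<^sup>2 * n + (l\<^sup>2 - M)" for n
  have s: "int (s n) = (int l)\<^sup>2 * (int n + 1) - int M" for n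
  proof -
    have "M \<le> l\<^sup>2" using M by simp
    then show ?thesis by (simp add: s_def of_nat_diff algebra_simps)
  qed
  have "(\<lambda>n. of_int (int l * fps_nth B (s n)) * qexp w ^ n) sums (UF w / (qexp (- w / 24) * qexp w))" if w: "Im w > 0" for w
  proof -
    let ?g = "\<lambda>n. if (int l)\<^sup>2 dvd 24 * int n + (-1)
             then of_int (int l * fps_nth B n) * qexp (w * of_int (24 * int n + (-1)) / (24 * of_int ((int l)\<^sup>2))) else 0"
    have g: "?g sums UF w" unfolding UF_def
      by (rule hecke_U_sums[OF eta_quot'_sums[OF B]]) (use l0 w in auto)
    have mono: "strict_mono s" using l0 by (simp add: strict_mono_def s_def)
    have out: "?g n = 0" if n: "n \<notin> range s" for n
    proof -
      have "\<not> (int l)\<^sup>2 dvd 24 * int n + (-1)"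
      proof
        assume "(int l)\<^sup>2 dvd 24 * int n + (-1)"
        then have "(int l)\<^sup>2 dvd (24 * int n + (-1)) + (int l)\<^sup>2" by (rule dvd_add) simp
        also have "(24 * int n + (-1)) + (int l)\<^sup>2 = 24 * (int n + int M)" by (simp add: Mi)
        finally have "(int l)\<^sup>2 dvd int n + int M"
          using coprime_dvd_mult_right_iff[OF coprime_24] by blast
        then obtain k where k: "int n + int M = (int l)\<^sup>2 * k" by (elim dvdE)
        have "k \<ge> 1"
        proof (rule ccontr)
          assume "\<not> k \<ge> 1"
          then have "(int l)\<^sup>2 * k \<le> (int l)\<^sup>2 * 0" by (intro mult_left_mono) auto
          then show False using k M_pos by linarith
        qed
        then have "int n = int (s (nat (k - 1)))" using k by (simp add: s)
        then have "n = s (nat (k - 1))" by (simp only: of_nat_eq_iff)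
        then show False using n by blast
      qed
      then show ?thesis by simp
    qed
    have "(\<lambda>n. ?g (s n)) sums UF w"
      using g out by (subst sums_mono_reindex[OF mono]) auto
    moreover have "?g (s n) = of_int (int l * fps_nth B (s n)) * (qexp (- w / 24) * qexp w ^ Suc n)" for n
    proof -
      have e: "24 * int (s n) + (-1) = (int l)\<^sup>2 * (24 * int (Suc n) + (-1))"
        unfolding s using Mi by (simp add: algebra_simps)
      have "w * of_int ((int l)\<^sup>2 * (24 * int (Suc n) + (-1))) / (24 * of_int ((int l)\<^sup>2)) = w * of_int (24 * int (Suc n) + (-1)) / 24"
        using l0 by (simp add: field_simps)
      then show ?thesis unfolding e qexp_beta_exponent[symmetric] by (simp only: if_True dvd_triv_left)
    qed
    ultimately have "(\<lambda>n. of_int (int l * fps_nth B (s n)) * (qexp (- w / 24) * qexp w ^ Suc n)) sums UF w"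
      by (simp only:)
    from sums_divide[OF this, of "qexp (- w / 24) * qexp w"] show ?thesis by (simp add: mult_ac)
  qed
  then have "\<exists>\<phi>. disc_fps (Abs_fps (\<lambda>n. int l * fps_nth B (s n))) \<phi> \<and> (\<forall>w. Im w > 0 \<longrightarrow> UF w / (qexp (- w / 24) * qexp w) = \<phi> (qexp w))"
    by (rule disc_fps_of_sums)
  then obtain \<phi>1 where \<phi>1: "disc_fps (Abs_fps (\<lambda>n. int l * fps_nth B (s n))) \<phi>1"
      "\<And>w. Im w > 0 \<Longrightarrow> UF w / (qexp (- w / 24) * qexp w) = \<phi>1 (qexp w)"
    by blast
  have "(\<lambda>n. of_int (Legendre 3 (int l) * Legendre (24 * int n + (-1)) (int l) * fps_nth B n) * qexp w ^ n) sums (MF w / qexp (- w / 24))" if w: "Im w > 0" for w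
    using sums_divide[OF hecke_M_sums[OF eta_quot'_sums[OF B] p w, of "Legendre 3 (int l)"], of "qexp (- w / 24)"]
    unfolding MF_def[symmetric] qexp_beta_exponent by (simp add: mult_ac)
  then have "\<exists>\<phi>. disc_fps (Abs_fps (\<lambda>n. Legendre 3 (int l) * Legendre (24 * int n + (-1)) (int l) * fps_nth B n)) \<phi> \<and> (\<forall>w. Im w > 0 \<longrightarrow> MF w / qexp (- w / 24) = \<phi> (qexp w))"
    by (rule disc_fps_of_sums)
  then obtain \<phi>2 where \<phi>2: "disc_fps (Abs_fps (\<lambda>n. Legendre 3 (int l) * Legendre (24 * int n + (-1)) (int l) * fps_nth B n)) \<phi>2"
      "\<And>w. Im w > 0 \<Longrightarrow> MF w / qexp (- w / 24) = \<phi>2 (qexp w)"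
    by blast
  define fb where "fb q = euler q ^ 3 / euler (q\<^sup>2) ^ 2" for q
  have \<phi>3: "disc_fps (B oo fps_X ^ (l\<^sup>2)) (\<lambda>q. fb (q ^ (l\<^sup>2)))"
    unfolding fb_def using l0 by (intro disc_fps_compose_X_power[OF B]) auto
  have V: "eta_quot' (of_int ((int l)\<^sup>2) * w) = qexp (- w / 24) / qexp w ^ M * fb (qexp w ^ (l\<^sup>2))" for w
  proof -
    have 1: "of_int ((int l)\<^sup>2) * w = of_nat (l\<^sup>2) * w" by simp
    have "- w / 24 = - (of_nat (l\<^sup>2) * w) / 24 + of_nat M * w" unfolding M by (simp add: field_simps)
    then have "qexp (- w / 24) = qexp (- (of_nat (l\<^sup>2) * w) / 24) * qexp w ^ M"
      by (metis qexp_add qexp_of_nat_mult)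
    then show ?thesis unfolding 1 eta_quot'_eq fb_def[symmetric] qexp_of_nat_mult by simp
  qed
  show ?thesis
  proof (rule that)
    show "disc_fps (fps_X ^ Suc M * Abs_fps (\<lambda>n. int l * fps_nth B (s n)) +
        fps_X ^ M * Abs_fps (\<lambda>n. Legendre 3 (int l) * Legendre (24 * int n + (-1)) (int l) * fps_nth B n) + (B oo fps_X ^ (l\<^sup>2)))
       (\<lambda>q. q ^ Suc M * \<phi>1 q + q ^ M * \<phi>2 q + fb (q ^ (l\<^sup>2)))"
      by (intro disc_fps_add disc_fps_mult disc_fps_power disc_fps_X \<phi>1(1) \<phi>2(1) \<phi>3)
    fix w assume w: "Im w > 0"
    show "hecke (int l) (of_int (Legendre 3 (int l))) eta_quot' w = qexp (- w / 24) / qexp w ^ M * (qexp w ^ Suc M * \<phi>1 (qexp w) + qexp w ^ M * \<phi>2 (qexp w) + fb (qexp w ^ (l\<^sup>2)))"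
      unfolding hecke_def UF_def[symmetric] MF_def[symmetric] V \<phi>1(2)[OF w, symmetric] \<phi>2(2)[OF w, symmetric]
      by (simp add: ring_distribs)
  qed
qed

text \<open>The polynomial P is indexed backwards: r j multiplies (1/t)^(M - j) on the side of G and
  (2^12 t)^(M - j) on the side of F, so j = M is its constant term.\<close>

theorem hecke_alpha_fps_expansion:
  "\<exists>r E. hecke_alpha_fps = alpha_gf * (\<Sum>j\<le>M. fps_const (r j * (2 ^ 12) ^ (M - j)) * (fps_X * E) ^ (M - j))"
proof -
  define fa where "fa q = euler (q\<^sup>2) ^ 3 / euler q ^ 2" for q
  define fb where "fb q = euler q ^ 3 / euler (q\<^sup>2) ^ 2" for q
  define \<epsilon> where "\<epsilon> q = (euler (q\<^sup>2) / euler q) ^ 24" for q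
  have nz: "euler q \<noteq> 0" "euler (q\<^sup>2) \<noteq> 0" if "norm q < 1" for q
    using euler_nonzero[of q] euler_nonzero[of "q\<^sup>2"] that by (auto simp: norm_power power_less_one_iff)
  have nz': "fa q \<noteq> 0" "fb q \<noteq> 0" "\<epsilon> q \<noteq> 0" if "norm q < 1" for q
    using nz[OF that] by (auto simp: fa_def fb_def \<epsilon>_def)
  obtain I where I: "euler_fps * I = 1" "disc_fps I (\<lambda>q. inverse (euler q))"
    using disc_fps_inverse[OF disc_fps_euler] euler_nonzero by auto
  define E where "E = ((euler_fps oo fps_X\<^sup>2) * I) ^ 24"
  have "fps_nth I 0 = 1" using arg_cong[OF I(1), of "\<lambda>f. fps_nth f 0"] by simp
  then have E0: "fps_nth E 0 = 1" by (simp add: E_def fps_nth_power_0 fps_nth_compose_X_power)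
  have dE: "disc_fps E \<epsilon>"
    using disc_fps_power[OF disc_fps_mult[OF disc_fps_compose_X_power[OF disc_fps_euler, of 2] I(2)], of 24]
    by (simp add: E_def \<epsilon>_def[abs_def] divide_inverse)
  have dT: "disc_fps (fps_X * E) hauptmodul"
    using disc_fps_mult[OF disc_fps_X dE] by (simp add: hauptmodul_def[abs_def] \<epsilon>_def)
  have T: "hauptmodul q = q * \<epsilon> q" for q by (simp add: hauptmodul_def \<epsilon>_def)
  obtain B where B: "disc_fps B (\<lambda>q. euler q ^ 3 / euler (q\<^sup>2) ^ 2)" by (rule beta_fps_exists)
  obtain \<phi> where \<phi>: "disc_fps hecke_alpha_fps \<phi>"
    "\<And>w. Im w > 0 \<Longrightarrow> hecke (int l) (of_int (Legendre 6 (int l))) eta_quot w = qexp (w / 6) * \<phi> (qexp w)"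
    by (rule hecke_alpha_disc) blast
  obtain b \<psi> where \<psi>: "disc_fps b \<psi>"
    "\<And>w. Im w > 0 \<Longrightarrow> hecke (int l) (of_int (Legendre 3 (int l))) eta_quot' w = qexp (- w / 24) / qexp w ^ M * \<psi> (qexp w)"
    by (rule hecke_beta_disc[OF B]) blast
  \<comment> \<open>The series of t^M times G|T / G; the middle factor inverts G up to its power of
    q.\<close>
  define S where "S = b * ((euler_fps oo fps_X\<^sup>2) ^ 2 * I ^ 3) * E ^ M"
  have dS: "disc_fps S (\<lambda>q. \<psi> q / fb q * \<epsilon> q ^ M)"
  proof -
    have "disc_fps S (\<lambda>q. \<psi> q * (euler (q\<^sup>2) ^ 2 * inverse (euler q) ^ 3) * \<epsilon> q ^ M)"
      unfolding S_def by (intro disc_fps_mult disc_fps_power disc_fps_compose_X_power disc_fps_euler \<psi>(1) I(2) dE) auto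
    then show ?thesis by (simp add: fb_def field_simps)
  qed
  \<comment> \<open>Order M + 1 is one beyond the pole, so that after division by t^M the constant
    term is matched too and the remainder vanishes at q = 0.\<close>
  obtain r where r: "fps_X ^ Suc M dvd S - (\<Sum>j<Suc M. fps_const (r j) * (fps_X * E) ^ j)"
    using expand_in_powers[OF E0] by blast
  have "disc_fps (S - (\<Sum>j<Suc M. fps_const (r j) * (fps_X * E) ^ j))
     (\<lambda>q. \<psi> q / fb q * \<epsilon> q ^ M - (\<Sum>j<Suc M. of_int (r j) * hauptmodul q ^ j))"
    by (intro disc_fps_diff disc_fps_sum disc_fps_mult disc_fps_power disc_fps_const dS dT)
  from disc_fps_shift[OF this r] obtain g \<gamma> where g: "disc_fps g \<gamma>"
    "\<And>q. norm q < 1 \<Longrightarrow> \<psi> q / fb q * \<epsilon> q ^ M - (\<Sum>j<Suc M. of_int (r j) * hauptmodul q ^ j) = q ^ Suc M * \<gamma> q"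
    by blast
  \<comment> \<open>\<open>H\<close> is F|T / F - P(2^12 t) and \<open>H'\<close> is G|T / G -
    P(1/t), the latter written through the remainder so that it is visibly holomorphic at 0.\<close>
  define H where "H q = \<phi> q / fa q - (\<Sum>j\<le>M. of_int (r j) * (2 ^ 12 * hauptmodul q) ^ (M - j))" for q
  define H' where "H' q = q * \<gamma> q / \<epsilon> q ^ M" for q
  have hol: "\<phi> holomorphic_on ball 0 1" "\<gamma> holomorphic_on ball 0 1" "\<epsilon> holomorphic_on ball 0 1" "fa holomorphic_on ball 0 1"
    "hauptmodul holomorphic_on ball 0 1"
    using disc_fps_holomorphic \<phi>(1) g(1) dE disc_fps_alpha dT unfolding fa_def[abs_def] by auto
  have "H q = 0" if q: "norm q < 1" for q
  proof (rule fricke_pair_vanishes[of H H'])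
    show "H holomorphic_on ball 0 1" unfolding H_def using nz'
      by (intro holomorphic_intros hol) auto
    show "H' holomorphic_on ball 0 1" unfolding H'_def using nz'
      by (intro holomorphic_intros hol) auto
    show "H' 0 = 0" by (simp add: H'_def)
    fix y :: real assume y: "y > 0"
    define w z where "w = \<i> * complex_of_real (1 / (2 * y))" and "z = \<i> * complex_of_real y"
    define u v where "u = qexp w" and "v = qexp z"
    have wz: "Im w > 0" "Im z > 0" using y by (simp_all add: w_def z_def)
    have u: "norm u < 1" "u \<noteq> 0" and v: "norm v < 1" "v \<noteq> 0"
      using norm_qexp_less_1 wz by (simp_all add: u_def v_def)
    define \<rho> where "\<rho> = complex_of_real (sqrt y) / 2"
    have \<rho>: "\<rho> \<noteq> 0" using y by (simp add: \<rho>_def)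
    \<comment> \<open>Dividing the transformation of F|T by that of F cancels the weight factor and
      the fractional powers of q.\<close>
    have quot: "\<phi> u / fa u = \<psi> v / (v ^ M * fb v)"
    proof -
      have "hecke (int l) (of_int (Legendre 6 (int l))) eta_quot w = \<rho> * hecke (int l) (of_int (Legendre 3 (int l))) eta_quot' z"
        unfolding w_def z_def \<rho>_def by (rule hecke_eta_quot_transform[OF p y])
      then have "qexp (w / 6) * \<phi> u = \<rho> * (qexp (- z / 24) / v ^ M * \<psi> v)"
        unfolding \<phi>(2)[OF wz(1)] \<psi>(2)[OF wz(2)] u_def v_def .
      moreover have "eta_quot w = \<rho> * eta_quot' z"
        unfolding w_def z_def \<rho>_def by (rule eta_quot_transform_one[OF y])
      then have "qexp (w / 6) * fa u = \<rho> * (qexp (- z / 24) * fb v)"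
        unfolding eta_quot_eq eta_quot'_eq u_def v_def fa_def fb_def .
      ultimately have "(qexp (w / 6) * \<phi> u) / (qexp (w / 6) * fa u) = (\<rho> * (qexp (- z / 24) / v ^ M * \<psi> v)) / (\<rho> * (qexp (- z / 24) * fb v))"
        by simp
      then show ?thesis using \<rho> nz'[OF u(1)] nz'[OF v(1)] v by (simp add: field_simps)
    qed
    have tt: "2 ^ 12 * hauptmodul u = 1 / hauptmodul v"
      using hauptmodul_fricke[OF y] unfolding w_def[symmetric] z_def[symmetric] u_def[symmetric] v_def[symmetric]
      by (metis mult_eq_0_iff nonzero_eq_divide_eq zero_neq_one)
    have tv: "hauptmodul v \<noteq> 0" using v nz'[OF v(1)] by (simp add: T)
    have "H u = \<psi> v / (v ^ M * fb v) - (\<Sum>j\<le>M. of_int (r j) * hauptmodul v ^ j / hauptmodul v ^ M)"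
    proof -
      have "of_int (r j) * (1 / hauptmodul v) ^ (M - j) = of_int (r j) * hauptmodul v ^ j / hauptmodul v ^ M" if "j \<le> M" for j
        using tv that by (simp add: power_diff field_simps)
      then show ?thesis unfolding H_def quot tt by simp
    qed
    also have "\<dots> = (\<psi> v / fb v * \<epsilon> v ^ M - (\<Sum>j\<le>M. of_int (r j) * hauptmodul v ^ j)) / hauptmodul v ^ M"
      using nz'[OF v(1)] v by (simp add: diff_divide_distrib sum_divide_distrib T power_mult_distrib)
    also have "\<dots> = v ^ Suc M * \<gamma> v / hauptmodul v ^ M"
      using g(2)[OF v(1)] by (simp add: lessThan_Suc_atMost)
    also have "\<dots> = H' v" using v by (simp add: H'_def T power_mult_distrib)
    finally show "H (qexp (\<i> * of_real (1 / (2 * y)))) = H' (qexp (\<i> * of_real y))"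
      by (simp add: u_def v_def w_def z_def)
  qed (rule q)
  then have H0: "\<phi> q / fa q = (\<Sum>j\<le>M. of_int (r j) * (2 ^ 12 * hauptmodul q) ^ (M - j))" if "norm q < 1" for q
    using that by (simp add: H_def)
  have eq: "\<phi> q = fa q * (\<Sum>j\<le>M. of_int (r j * (2 ^ 12) ^ (M - j)) * hauptmodul q ^ (M - j))" if "norm q < 1" for q
  proof -
    have "\<phi> q = fa q * (\<phi> q / fa q)" using nz'[OF that] by simp
    also have "\<phi> q / fa q = (\<Sum>j\<le>M. of_int (r j * (2 ^ 12) ^ (M - j)) * hauptmodul q ^ (M - j))"
      unfolding H0[OF that] by (simp add: power_mult_distrib mult.assoc)
    finally show ?thesis .
  qed
  \<comment> \<open>Back from functions to integral series: equal values on the disc force equal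
    coefficients.\<close>
  have "disc_fps (alpha_gf * (\<Sum>j\<le>M. fps_const (r j * (2 ^ 12) ^ (M - j)) * (fps_X * E) ^ (M - j)))
     (\<lambda>q. fa q * (\<Sum>j\<le>M. of_int (r j * (2 ^ 12) ^ (M - j)) * hauptmodul q ^ (M - j)))"
    unfolding fa_def by (intro disc_fps_mult disc_fps_alpha disc_fps_sum disc_fps_power disc_fps_const dT)
  then have "disc_fps (alpha_gf * (\<Sum>j\<le>M. fps_const (r j * (2 ^ 12) ^ (M - j)) * (fps_X * E) ^ (M - j))) \<phi>"
    by (rule disc_fps_cong) (simp add: eq)
  then show ?thesis using disc_fps_unique[OF \<phi>(1)] by blast
qed

text \<open>Every summand with j < M carries a factor 2^12, so only r M remains; since \<alpha>(0) =
  1, the coefficient at 0 identifies r M modulo 2^12.\<close>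

corollary hecke_alpha_fps_cong:
  "[fps_nth hecke_alpha_fps n = fps_nth hecke_alpha_fps 0 * fps_nth alpha_gf n] (mod 2 ^ 12)"
proof -
  obtain r E where A: "hecke_alpha_fps = alpha_gf * (\<Sum>j\<le>M. fps_const (r j * (2 ^ 12) ^ (M - j)) * (fps_X * E) ^ (M - j))"
    using hecke_alpha_fps_expansion by blast
  define Q where "Q = (\<Sum>j<M. fps_const (r j * (2 ^ 12) ^ (M - j - 1)) * (fps_X * E) ^ (M - j))"
  have "(\<Sum>j\<le>M. fps_const (r j * (2 ^ 12) ^ (M - j)) * (fps_X * E) ^ (M - j)) = fps_const (2 ^ 12) * Q + fps_const (r M)"
  proof -
    have "fps_const (r j * (2 ^ 12) ^ (M - j)) = fps_const (2 ^ 12) * fps_const (r j * (2 ^ 12) ^ (M - j - 1))" if "j < M" for j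
    proof -
      have "M - j = Suc (M - j - 1)" using that by simp
      then have "(2 ^ 12 :: int) ^ (M - j) = 2 ^ 12 * (2 ^ 12) ^ (M - j - 1)" by (metis power_Suc)
      then show ?thesis by (simp add: mult_ac)
    qed
    then have "(\<Sum>j<M. fps_const (r j * (2 ^ 12) ^ (M - j)) * (fps_X * E) ^ (M - j)) = fps_const (2 ^ 12) * Q"
      unfolding Q_def sum_distrib_left by (intro sum.cong) (auto simp: mult.assoc)
    then show ?thesis by (simp add: lessThan_Suc_atMost[symmetric])
  qed
  then have "hecke_alpha_fps = fps_const (2 ^ 12) * (alpha_gf * Q) + fps_const (r M) * alpha_gf"
    unfolding A by (simp only: ring_distribs mult_ac)
  then have A': "fps_nth hecke_alpha_fps k = 2 ^ 12 * fps_nth (alpha_gf * Q) k + r M * fps_nth alpha_gf k" for k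
    by (simp only: fps_add_nth fps_mult_left_const_nth)
  have c: "[fps_nth hecke_alpha_fps k = r M * fps_nth alpha_gf k] (mod 2 ^ 12)" for k
    unfolding A' by (simp add: cong_def)
  from c[of 0] have "[r M = fps_nth hecke_alpha_fps 0] (mod 2 ^ 12)"
    by (simp add: alpha_gf_nth_0 cong_sym)
  then have "[r M * fps_nth alpha_gf n = fps_nth hecke_alpha_fps 0 * fps_nth alpha_gf n] (mod 2 ^ 12)"
    by (rule cong_scalar_right)
  with c[of n] show ?thesis by (rule cong_trans)
qed

section \<open>The coefficients in terms of \<alpha>\<close>

lemma N_ell_eq: "N_ell l = 4 * int M"
  using six_N_ell[OF l] Mi by simp

lemma hecke_alpha_fps_nth:
  "fps_nth hecke_alpha_fps n = int l * alpha (of_nat l ^ 2 * of_nat n + of_int (N_ell l))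
          + Legendre (-1) (int l) * Legendre (N_ell l - int n) (int l) * alpha (of_nat n)
          + alpha ((of_nat n - of_int (N_ell l)) / of_nat l ^ 2)"
proof -
  have p2: "int l > 2" using l by simp
  have "of_nat l ^ 2 * of_nat n + of_int (N_ell l) = (of_nat (l\<^sup>2 * n + 4 * M) :: rat)"
    by (simp add: N_ell_eq)
  then have 1: "alpha (of_nat l ^ 2 * of_nat n + of_int (N_ell l)) = fps_nth alpha_gf (l\<^sup>2 * n + 4 * M)"
    by (simp only: alpha_of_nat)
  have 2: "Legendre 6 (int l) * Legendre (24 * int n + 4) (int l) = Legendre (-1) (int l) * Legendre (N_ell l - int n) (int l)"
  proof -
    \<comment> \<open>The difference of the two sides is 4 + 24 N_l = 4 l^2. Writing 24 as 4 * 6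
      exposes a square and a second (6/l), which cancels the sign of the Hecke operator.\<close>
    have "[24 * int n + 4 = (- 1) * (4 * 6) * (N_ell l - int n)] (mod int l)"
    proof -
      have "24 * int n + 4 - (- 1) * (4 * 6) * (N_ell l - int n) = int l * (4 * int l)"
        using Mi by (simp add: N_ell_eq power2_eq_square)
      then show ?thesis by (simp add: cong_iff_dvd_diff)
    qed
    then have "Legendre (24 * int n + 4) (int l) = Legendre ((- 1) * (4 * 6) * (N_ell l - int n)) (int l)"
      by (rule Legendre_cong[OF p(1) p2])
    also have "\<dots> = Legendre (-1) (int l) * (Legendre 4 (int l) * Legendre 6 (int l)) * Legendre (N_ell l - int n) (int l)"
      by (simp only: Legendre_mult[OF p(1) p2])
    also note Legendre_4
    finally have eq: "Legendre (24 * int n + 4) (int l) = Legendre (-1) (int l) * Legendre 6 (int l) * Legendre (N_ell l - int n) (int l)" by simp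
    have "\<not> int l dvd 6"
    proof
      assume "int l dvd 6"
      then have "(int l) dvd 2 * 3" by simp
      then have "int l dvd 2 \<or> int l dvd 3" using p(1) by (simp only: prime_dvd_mult_iff)
      then show False using p by (auto dest!: zdvd_imp_le)
    qed
    from Legendre_mult_self[OF p(1) p2 this] show ?thesis unfolding eq by (simp add: mult_ac)
  qed
  \<comment> \<open>Both sides vanish unless n = l^2 m + 4 M: on the left the argument is not a
    natural number, on the right the series has no such exponent.\<close>
  have 3: "alpha ((of_nat n - of_int (N_ell l)) / of_nat l ^ 2) = fps_nth (fps_X ^ (4 * M) * (alpha_gf oo fps_X ^ (l\<^sup>2))) n"
  proof (cases "\<exists>m. n = l\<^sup>2 * m + 4 * M")
    case True
    then obtain m where m: "n = l\<^sup>2 * m + 4 * M" by blast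
    have "(of_nat n - of_int (N_ell l)) / of_nat l ^ 2 = (of_nat m :: rat)"
      using l by (simp add: m N_ell_eq)
    moreover have "fps_nth (fps_X ^ (4 * M) * (alpha_gf oo fps_X ^ (l\<^sup>2))) n = fps_nth alpha_gf m"
      using l by (simp add: m fps_X_power_mult_nth fps_nth_compose_X_power)
    ultimately show ?thesis by (simp only: alpha_of_nat)
  next
    case False
    have "(of_nat n - of_int (N_ell l)) / of_nat l ^ 2 \<notin> (\<nat> :: rat set)"
    proof
      assume "(of_nat n - of_int (N_ell l)) / of_nat l ^ 2 \<in> (\<nat> :: rat set)"
      then obtain m where "(of_nat n - of_int (N_ell l)) / of_nat l ^ 2 = (of_nat m :: rat)" by (elim Nats_cases)
      then have "of_nat n = (of_nat (l\<^sup>2 * m + 4 * M) :: rat)" using l by (simp add: N_ell_eq field_simps)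
      then show False using False by (simp only: of_nat_eq_iff) blast
    qed
    moreover have "fps_nth (fps_X ^ (4 * M) * (alpha_gf oo fps_X ^ (l\<^sup>2))) n = 0"
    proof -
      have "\<not> l\<^sup>2 dvd n - 4 * M" if "n \<ge> 4 * M"
      proof
        assume "l\<^sup>2 dvd n - 4 * M"
        then obtain m where "n - 4 * M = l\<^sup>2 * m" by (elim dvdE)
        then have "n = l\<^sup>2 * m + 4 * M" using that by simp
        then show False using False by blast
      qed
      then show ?thesis using l by (simp add: fps_X_power_mult_nth fps_nth_compose_X_power)
    qed
    ultimately show ?thesis by (simp add: alpha_def)
  qed
  show ?thesis unfolding hecke_alpha_fps_def 1 3 alpha_of_nat by (simp add: 2)
qed

text \<open>At n = 0 the last summand vanishes because M > 0, and the middle one is (6/l) (4/l)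
  \<alpha>(0) = (6/l).\<close>

lemma hecke_alpha_fps_nth_0: "fps_nth hecke_alpha_fps 0 = c_ell l"
proof -
  have "fps_nth alpha_gf (4 * M) = alpha (of_int (N_ell l))"
    using alpha_of_nat[of "4 * M"] by (simp add: N_ell_eq)
  then show ?thesis
    using M_pos by (simp add: hecke_alpha_fps_def c_ell_def alpha_gf_nth_0 Legendre_4 fps_X_power_mult_nth)
qed

end

text \<open>An odd square is 1 modulo 8, and the factor 3 comes from
  \<open>six_N_ell\<close>.\<close>

lemma prime_square_mod_24:
  assumes "prime l" "l > 3"
  obtains M where "l\<^sup>2 = 24 * M + (1::nat)"
proof -
  have "odd l" using assms primes_dvd_imp_eq[of 2 l] by auto
  then obtain k where k: "l = 2 * k + 1" by (elim oddE)
  have "even (k * (k + 1))" by simp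
  then obtain j where j: "k * (k + 1) = 2 * j" by (elim evenE)
  have l8: "l\<^sup>2 = 8 * j + 1"
  proof -
    have "l\<^sup>2 = 4 * (k * (k + 1)) + 1" by (simp add: k power2_eq_square algebra_simps)
    then show ?thesis unfolding j by simp
  qed
  have "3 dvd j"
  proof -
    have "6 * N_ell l = int l ^ 2 - 1" using six_N_ell assms by blast
    moreover have "int l ^ 2 = 8 * int j + 1" using l8 by (metis of_nat_1 of_nat_add of_nat_mult of_nat_numeral of_nat_power)
    ultimately have "3 * N_ell l = 4 * int j" by simp
    then have "3 dvd int j" by presburger
    then show ?thesis by presburger
  qed
  then obtain M where "j = 3 * M" by (elim dvdE)
  then have "l\<^sup>2 = 24 * M + 1" using l8 by simp
  then show ?thesis by (rule that)
qed

theorem theorem1p1: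
  fixes l n :: nat
  assumes "prime l" and "l > 3"
  shows "[int l * alpha (of_nat l ^ 2 * of_nat n + of_int (N_ell l))
          + Legendre (-1) (int l) * Legendre (N_ell l - int n) (int l) * alpha (of_nat n)
          + alpha ((of_nat n - of_int (N_ell l)) / of_nat l ^ 2)
        = c_ell l * alpha (of_nat n)] (mod 2 ^ 12)"
proof -
  obtain M where M: "l\<^sup>2 = 24 * M + 1" using assms by (rule prime_square_mod_24)
  show ?thesis
    using hecke_alpha_fps_cong[OF assms M, of n]
    unfolding hecke_alpha_fps_nth_0[OF assms M]
    unfolding hecke_alpha_fps_nth[OF assms M] alpha_of_nat .
qed

end
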